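(* Let $\mu$ be a probability measure on $\mathbb{C}$ and let $\{a_k\}_{k\ge1}$, $\{b_k\}_{k\ge1}$ be two sequences of complex numbers that are both $\mu$-distributed and log-Cesàro bounded, and such that $a_k\ne b_k$ for infinitely many $k$. Let $\xi_1,\xi_2,\dots$ be independent random variables with $\Pr(\xi_k=a_k)=\Pr(\xi_k=b_k)=\tfrac12$ (if $a_k=b_k$ then $\xi_k=a_k$). Let $P_n(z)=(z-\xi_1)\cdots(z-\xi_n)$. Then $\mathscr{M}(P_n)\to\mu$ weakly almost surely, and $\mathscr{M}(P_n')\to\mu$ weakly in probability.
   Context: A sequence $\{a_n\}$ of complex numbers is $\mu$-distributed if $\frac1n\sum_{k=1}^n\delta_{a_k}$ converges weakly to $\mu$ (i.e. $\frac1n\sum_{k\le n} f(a_k)\to\int f\,d\mu$ for all $f\in C_c^\infty(\mathbb{C})$). It is log-Cesàro bounded if the sequence $\frac1n\sum_{k=1}^n\log_+|a_k|$ is bounded, where $\log_+x=\max(\log x,0)$. For a nonconstant polynomial $P$, $\mathscr{M}(P)$ is the uniform probability measure on the multiset of zeros of $P$ (counted with multiplicity). For random probability measures $\mu_n$ on $\mathbb{C}$ (space of probability measures with the weak topology), $\mu_n\to\mu$ in probability means $\Pr(\mu_n\in N)\to1$ for every weak neighbourhood $N$ of $\mu$; almost surely means $\mu_n\to\mu$ weakly with probability one. *)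

theory Defs
  imports "HOL-Probability.Probability" "HOL-Computational_Algebra.Polynomial"
begin

fun Ck :: "nat \<Rightarrow> (complex \<Rightarrow> real) set" where
  "Ck 0 = {f. continuous_on UNIV f}"
| "Ck (Suc k) = {f. continuous_on UNIV f \<and>
      (\<forall>v\<in>{1, \<i>}. \<exists>g\<in>Ck k. \<forall>z.
         ((\<lambda>t. f (z + complex_of_real t * v)) has_real_derivative g z) (at 0))}"

definition smooth_c :: "(complex \<Rightarrow> real) \<Rightarrow> bool" where
  "smooth_c f \<longleftrightarrow> (\<forall>k. f \<in> Ck k)"

definition Cc_inf :: "(complex \<Rightarrow> real) \<Rightarrow> bool" where
  "Cc_inf f \<longleftrightarrow> smooth_c f \<and> compact (closure {z. f z \<noteq> 0})"

definition mu_distributed :: "complex measure \<Rightarrow> (nat \<Rightarrow> complex) \<Rightarrow> bool" where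
  "mu_distributed \<mu> a \<longleftrightarrow>
     (\<forall>f. Cc_inf f \<longrightarrow>
        (\<lambda>n. (\<Sum>k=1..n. f (a k)) / real n) \<longlonglongrightarrow> (\<integral>z. f z \<partial>\<mu>))"

definition log_plus :: "real \<Rightarrow> real" where
  "log_plus x = max (ln x) 0"

definition log_cesaro_bounded :: "(nat \<Rightarrow> complex) \<Rightarrow> bool" where
  "log_cesaro_bounded a \<longleftrightarrow>
     Bseq (\<lambda>n. (\<Sum>k=1..n. log_plus (cmod (a k))) / real n)"

definition zero_measure :: "complex poly \<Rightarrow> complex measure" where
  "zero_measure P = measure_pmf (pmf_of_multiset (proots P))"

definition weak_conv_c :: "(nat \<Rightarrow> complex measure) \<Rightarrow> complex measure \<Rightarrow> bool" where
  "weak_conv_c \<mu>s \<mu> \<longleftrightarrow>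
     (\<forall>f::complex \<Rightarrow> real. continuous_on UNIV f \<and> bounded (range f) \<longrightarrow>
        (\<lambda>n. \<integral>z. f z \<partial>(\<mu>s n)) \<longlonglongrightarrow> (\<integral>z. f z \<partial>\<mu>))"

definition weak_nbhd :: "complex measure \<Rightarrow> (complex \<Rightarrow> real) set \<Rightarrow> real \<Rightarrow> complex measure set" where
  "weak_nbhd \<mu> F e = {\<nu>. \<forall>f\<in>F. \<bar>(\<integral>z. f z \<partial>\<nu>) - (\<integral>z. f z \<partial>\<mu>)\<bar> < e}"

definition weak_conv_in_prob ::
  "'w measure \<Rightarrow> (nat \<Rightarrow> 'w \<Rightarrow> complex measure) \<Rightarrow> complex measure \<Rightarrow> bool" where
  "weak_conv_in_prob M \<mu>s \<mu> \<longleftrightarrow>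
     (\<forall>F e. finite F \<and> (\<forall>f\<in>F. continuous_on UNIV f \<and> bounded (range f)) \<and> e > 0 \<longrightarrow>
        (\<lambda>n. measure M {\<omega>\<in>space M. \<mu>s n \<omega> \<in> weak_nbhd \<mu> F e}) \<longlonglongrightarrow> 1)"

definition rand_poly :: "(nat \<Rightarrow> complex) \<Rightarrow> nat \<Rightarrow> complex poly" where
  "rand_poly x n = (\<Prod>k=1..n. [:- x k, 1:])"

end

(*
  Write L = P'/P = sum 1/(z - xi_k). The zeros of P are handled by the strong law of large numbers on a countable
  family of smooth test functions. The zeros of P' are compared with them through potentials: a compactly supported
  continuous f is a uniform limit of potentials w -> int ln|z - w| phi(z) dz, on which the two zero counting measures
  differ by (1/n) int (ln|L| - ln n) phi. So it suffices that the expectation of (1/n) int_Q |ln|L|| tends to 0 for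
  discs Q. The positive part is bounded deterministically. The negative part is uniformly integrable, because
  - ln|L| = sum ln|z - xi_k| - sum ln|z - zeta_j| - ln n and log-Cesaro boundedness controls ln^+|z - xi_k|; it tends
  to 0 in probability for almost every z, because the independent two-valued summands of L are infinitely often
  nondegenerate, so that L does not concentrate on shrinking discs.
*)

theory Submission
  imports Defs "HOL-Complex_Analysis.Complex_Analysis" "HOL-Real_Asymp.Real_Asymp"
    "HOL-Computational_Algebra.Fundamental_Theorem_Algebra"
begin

section \<open>Anticoncentration of sums of independent two-valued variables\<close>

text \<open>The concentration of the law tends to 0 without any rate, since the indices with
  \<open>a k \<noteq> b k\<close> may be arbitrarily sparse. The probabilities that \<open>L\<close>
  is tiny need not be summable, so Borel-Cantelli is out of reach for the zeros of
  \<open>P'\<close>: they are treated in expectation, with Markov's inequality at the end. Nothing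
  is known about where those zeros lie. Only their nearness to \<open>z\<close> can hurt, and the
  integral of 1/|z - w| over a disc is bounded uniformly in \<open>w\<close>; the split
  \<open>- ln r \<le> T + exp (- T) / r\<close> turns this into uniform integrability, with
  \<open>T\<close> fixed before \<open>n\<close> grows. Nor are those zeros given as measurable
  functions. Measurability of averages over them is read off the potential identity, which expresses
  sums over the zeros through integrals of ln|L|. Compactly supported test functions suffice because
  all measures have mass 1: the tail of a zero measure is controlled by that of \<mu> and one cutoff
  integral.\<close>

fun two_point_law :: "(nat \<Rightarrow> complex) \<Rightarrow> (nat \<Rightarrow> complex) \<Rightarrow> nat \<Rightarrow> complex set \<Rightarrow> real" where
  "two_point_law \<alpha> \<beta> 0 A = indicator A 0"
| "two_point_law \<alpha> \<beta> (Suc n) A =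
     (two_point_law \<alpha> \<beta> n {s. s + \<alpha> (Suc n) \<in> A} + two_point_law \<alpha> \<beta> n {s. s + \<beta> (Suc n) \<in> A}) / 2"

context
  fixes \<alpha> \<beta> :: "nat \<Rightarrow> complex"
begin

abbreviation "D \<equiv> two_point_law \<alpha> \<beta>"

lemma law_nonneg: "D n A \<ge> 0"
  by (induction n arbitrary: A) auto

text \<open>The combinatorial argument treats the law of the sum as a recursive set function on
  arbitrary sets, for which additivity is a plain induction; \<open>prob_sum_mem\<close> later links
  it to the random variables.\<close>

lemma law_Un_disjoint: "A \<inter> B = {} \<Longrightarrow> D n (A \<union> B) = D n A + D n B"
proof (induction n arbitrary: A B)
  case 0
  then show ?case by (auto simp: indicator_def)
next
  case (Suc n)
  have *: "D n {s. s + c \<in> A \<union> B} = D n {s. s + c \<in> A} + D n {s. s + c \<in> B}" for c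
  proof -
    have "{s. s + c \<in> A \<union> B} = {s. s + c \<in> A} \<union> {s. s + c \<in> B}" by auto
    then show ?thesis using Suc by (simp, subst Suc.IH) auto
  qed
  show ?case by (simp only: two_point_law.simps *) (simp add: field_simps)
qed

lemma law_le_1: "D n A \<le> 1"
proof (induction n arbitrary: A)
  case (Suc n)
  show ?case
    using Suc[of "{s. s + \<alpha> (Suc n) \<in> A}"] Suc[of "{s. s + \<beta> (Suc n) \<in> A}"] by simp
qed (auto simp: indicator_def)

lemma law_empty [simp]: "D n {} = 0"
  using law_Un_disjoint[of "{}" "{}" n] by simp

fun law_support :: "nat \<Rightarrow> complex set" where
  "law_support 0 = {0}"
| "law_support (Suc n) = (\<lambda>s. s + \<alpha> (Suc n)) ` law_support n \<union> (\<lambda>s. s + \<beta> (Suc n)) ` law_support n"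

lemma finite_law_support: "finite (law_support n)"
  by (induction n) auto

lemma law_restrict: "D n A = D n (A \<inter> law_support n)"
proof (induction n arbitrary: A)
  case 0
  then show ?case by (auto simp: indicator_def)
next
  case (Suc n)
  have *: "D n {s. s + c \<in> A} = D n {s. s + c \<in> A \<inter> law_support (Suc n)}"
    if "c = \<alpha> (Suc n) \<or> c = \<beta> (Suc n)" for c
  proof -
    have "{s. s + c \<in> A} \<inter> law_support n = {s. s + c \<in> A \<inter> law_support (Suc n)} \<inter> law_support n"
      using that by auto
    then show ?thesis by (metis Suc.IH)
  qed
  show ?case
    by (simp only: two_point_law.simps) (use * in metis)
qed

text \<open>A concentration function that counts atoms instead of measuring balls, so that shifting
  a set becomes a combinatorial operation. Only \<open>r = 1\<close> is wanted in the end, but the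
  convexity argument needs every \<open>r\<close>.\<close>

definition conc :: "nat \<Rightarrow> nat \<Rightarrow> real" where
  "conc n r = (SUP X\<in>{X. finite X \<and> card X \<le> r}. D n X)"

lemma conc_bdd: "bdd_above ((\<lambda>X. D n X) ` S)"
  using law_le_1 by (auto intro!: bdd_aboveI)

lemma law_le_conc: "finite X \<Longrightarrow> card X \<le> r \<Longrightarrow> D n X \<le> conc n r"
  unfolding conc_def by (intro cSUP_upper conc_bdd) auto

lemma conc_least: "(\<And>X. finite X \<Longrightarrow> card X \<le> r \<Longrightarrow> D n X \<le> c) \<Longrightarrow> conc n r \<le> c"
  unfolding conc_def by (rule cSUP_least) (auto intro!: exI[of _ "{}"])

lemma conc_le_1: "conc n r \<le> 1"
  by (rule conc_least) (rule law_le_1)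

lemma conc_nonneg: "conc n r \<ge> 0"
  using law_le_conc[of "{}" r n] by simp

lemma conc_0 [simp]: "conc n 0 = 0"
  by (intro antisym conc_nonneg conc_least) auto

lemma translate_vimage: "{s. s + c \<in> X} = (\<lambda>x. x - c) ` X" for c :: complex
  by force

lemma translate_finite: "finite X \<Longrightarrow> finite {s. s + c \<in> X}" for c :: complex
  by (simp add: translate_vimage)

lemma translate_card: "card {s. s + c \<in> X} = card X" for c :: complex
  by (simp add: translate_vimage card_image inj_on_def)

lemma conc_Suc_le: "conc (Suc n) r \<le> conc n r"
proof (rule conc_least)
  fix X :: "complex set" assume X: "finite X" "card X \<le> r"
  have "D n {s. s + c \<in> X} \<le> conc n r" for c
    by (intro law_le_conc) (use X in \<open>auto simp: translate_finite translate_card\<close>)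
  from this[of "\<alpha> (Suc n)"] this[of "\<beta> (Suc n)"] show "D (Suc n) X \<le> conc n r"
    by simp
qed

text \<open>Two distinct translates \<open>X\<^sub>1, X\<^sub>2\<close> of an \<open>r\<close>-element set: moving a point of
  \<open>X\<^sub>1 - X\<^sub>2\<close> over to \<open>X\<^sub>2\<close> leaves sets of \<open>r - 1\<close> and \<open>r + 1\<close> elements.\<close>

lemma conc_Suc_le_average:
  assumes "\<alpha> (Suc n) \<noteq> \<beta> (Suc n)"
  shows "conc (Suc n) (Suc r) \<le> (conc n (Suc (Suc r)) + conc n r) / 2"
proof (rule conc_least)
  fix X :: "complex set" assume X: "finite X" "card X \<le> Suc r"
  define X1 X2 where "X1 = {s. s + \<alpha> (Suc n) \<in> X}" and "X2 = {s. s + \<beta> (Suc n) \<in> X}"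
  have fin: "finite X1" "finite X2" and card: "card X1 = card X" "card X2 = card X"
    using X by (auto simp: X1_def X2_def translate_finite translate_card)
  show "D (Suc n) X \<le> (conc n (Suc (Suc r)) + conc n r) / 2"
  proof (cases "X = {}")
    case True
    then show ?thesis using conc_nonneg[of n] by (simp del: two_point_law.simps)
  next
    case False
    \<comment> \<open>A shift by \<open>c\<close> changes the element sum by
      \<open>card X * c\<close>, so equal translates would force equal shifts.\<close>
    have "X1 \<noteq> X2"
    proof
      assume "X1 = X2"
      have *: "\<Sum>{s. s + c \<in> X} = \<Sum>X - of_nat (card X) * c" for c
        unfolding translate_vimage
        by (subst sum.reindex) (auto simp: inj_on_def sum_subtractf)
      have "\<Sum>X - of_nat (card X) * \<alpha> (Suc n) = \<Sum>X - of_nat (card X) * \<beta> (Suc n)"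
        unfolding *[symmetric] using \<open>X1 = X2\<close> by (simp only: X1_def X2_def)
      then show False using assms False X(1) by simp
    qed
    \<comment> \<open>Distinct finite sets of equal size cannot be nested.\<close>
    then obtain x where x: "x \<in> X1" "x \<notin> X2"
      using fin card by (metis card_subset_eq subsetI)
    have "D n X1 = D n {x} + D n (X1 - {x})"
      using x by (subst law_Un_disjoint[symmetric]) (auto simp: insert_absorb)
    moreover have "D n (insert x X2) = D n {x} + D n X2"
      using x by (subst law_Un_disjoint[symmetric]) auto
    moreover have "D n (insert x X2) \<le> conc n (Suc (Suc r))"
      by (rule law_le_conc) (use fin card X x in auto)
    moreover have "D n (X1 - {x}) \<le> conc n r"
      by (rule law_le_conc) (use fin card X x in auto)
    ultimately show ?thesis by (simp flip: X1_def X2_def)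
  qed
qed

text \<open>The limits \<open>L r\<close> of \<open>conc n r\<close> form a bounded convex sequence with \<open>L 0 = 0\<close>, hence vanish.\<close>

lemma conc_tendsto_0:
  assumes inf: "infinite {k. k \<ge> 1 \<and> \<alpha> k \<noteq> \<beta> k}"
  shows "(\<lambda>n. conc n 1) \<longlonglongrightarrow> 0"
proof -
  have dec: "decseq (\<lambda>n. conc n r)" for r
    by (rule decseq_SucI) (rule conc_Suc_le)
  define L where "L r = (INF n. conc n r)" for r
  have bdd: "bdd_below (range (\<lambda>n. conc n r))" for r
    using conc_nonneg by (auto intro!: bdd_belowI)
  have lim: "(\<lambda>n. conc n r) \<longlonglongrightarrow> L r" for r
    unfolding L_def by (rule LIMSEQ_decseq_INF[OF bdd dec])
  have L0: "L 0 = 0" by (simp add: L_def)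
  have Lle: "L r \<le> 1" for r
    using lim[of r] by (rule LIMSEQ_le_const2) (auto intro: conc_le_1)
  have Lconv: "L (Suc r) \<le> (L (Suc (Suc r)) + L r) / 2" for r
  proof (rule ccontr)
    assume "\<not> ?thesis"
    then have "(L (Suc (Suc r)) + L r) / 2 < L (Suc r)" by simp
    moreover have "(\<lambda>n. (conc n (Suc (Suc r)) + conc n r) / 2) \<longlonglongrightarrow> (L (Suc (Suc r)) + L r) / 2"
      by (intro tendsto_intros lim) auto
    ultimately have "eventually (\<lambda>n. (conc n (Suc (Suc r)) + conc n r) / 2 < L (Suc r)) sequentially"
      using order_tendstoD(2) by blast
    then obtain N where N: "\<And>n. n \<ge> N \<Longrightarrow> (conc n (Suc (Suc r)) + conc n r) / 2 < L (Suc r)"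
      by (auto simp: eventually_sequentially)
    \<comment> \<open>Averaging is available only where
      \<open>\<alpha> k \<noteq> \<beta> k\<close>; one such index beyond \<open>N\<close> is enough
      for the contradiction.\<close>
    obtain k where k: "k > N" "\<alpha> k \<noteq> \<beta> k"
      using inf unfolding infinite_nat_iff_unbounded by blast
    then obtain n where n: "k = Suc n" by (cases k) auto
    have "L (Suc r) \<le> conc (Suc n) (Suc r)"
      unfolding L_def by (rule cINF_lower[OF bdd]) auto
    also have "\<dots> \<le> (conc n (Suc (Suc r)) + conc n r) / 2"
      using k n by (intro conc_Suc_le_average) auto
    finally show False using N[of n] k n by auto
  qed
  have incr: "L (Suc r) - L r \<ge> L 1" for r
  proof (induction r)
    case 0 then show ?case by (simp add: L0)
  next
    case (Suc r) then show ?case using Lconv[of r] by simp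
  qed
  have lin: "L r \<ge> real r * L 1" for r
  proof (induction r)
    case 0 then show ?case by (simp add: L0)
  next
    case (Suc r) then show ?case using incr[of r] by (simp add: algebra_simps)
  qed
  have "L 1 \<le> 0"
  proof (rule ccontr)
    assume "\<not> L 1 \<le> 0"
    then obtain r where "1 < real r * L 1"
      using reals_Archimedean3[of "L 1"] by (auto simp: not_le)
    then show False using lin[of r] Lle[of r] by simp
  qed
  moreover have "L 1 \<ge> 0"
    using lim[of 1] by (rule LIMSEQ_le_const) (auto intro: conc_nonneg)
  ultimately show ?thesis using lim[of 1] by simp
qed

text \<open>A further summand replaces the mass of a ball by the mean of the masses of two balls of
  the same radius, so a bound uniform in the centre survives.\<close>

lemma law_ball_le:
  assumes "\<And>x. D n (ball x \<rho>) \<le> c" and "n \<le> m"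
  shows "D m (ball x \<rho>) \<le> c"
  using assms(2)
proof (induction m arbitrary: x rule: dec_induct)
  case (step m)
  have "{s. s + c \<in> ball x \<rho>} = ball (x - c) \<rho>" for c
    by (auto simp: dist_norm algebra_simps)
  then show ?case using step.IH[of "x - \<alpha> (Suc m)"] step.IH[of "x - \<beta> (Suc m)"] by simp
qed (use assms in auto)

text \<open>The support at step \<open>n\<close> is finite, so a radius below half its smallest gap
  leaves at most one atom in any ball.\<close>

lemma law_small_ball_le_conc:
  shows "eventually (\<lambda>\<rho>. \<forall>x. D n (ball x \<rho>) \<le> conc n 1) (at_right 0)"
proof -
  define S where "S = (\<lambda>(s, t). dist s t) ` (law_support n \<times> law_support n) - {0}"
  have fin: "finite S" unfolding S_def by (simp add: finite_law_support)
  \<comment> \<open>The extra 1 keeps \<open>Min\<close> defined when the support is a single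
    point.\<close>
  define d where "d = Min (insert 1 S)"
  have dpos: "d > 0" using fin by (auto simp: d_def S_def)
  have d: "d \<le> dist s t" if "s \<in> law_support n" "t \<in> law_support n" "s \<noteq> t" for s t
    unfolding d_def using that fin by (intro Min_le) (auto simp: S_def image_iff)
  have "D n (ball x \<rho>) \<le> conc n 1" if "0 < \<rho>" "\<rho> < d / 2" for x \<rho>
  proof -
    have "s = t" if "s \<in> ball x \<rho> \<inter> law_support n" "t \<in> ball x \<rho> \<inter> law_support n" for s t
    proof (rule ccontr)
      assume "s \<noteq> t"
      then have "d \<le> dist s t" using d that by auto
      also have "\<dots> \<le> dist x s + dist x t" by (metis dist_commute dist_triangle)
      also have "\<dots> < d" using that \<open>\<rho> < d / 2\<close> by auto
      finally show False by simp
    qed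
    then have "card (ball x \<rho> \<inter> law_support n) \<le> 1"
      by (simp add: card_le_Suc0_iff_eq finite_law_support)
    then show ?thesis
      by (subst law_restrict) (intro law_le_conc, auto simp: finite_law_support)
  qed
  then show ?thesis
    using dpos by (intro eventually_at_rightI[of 0 "d / 2"]) auto
qed

text \<open>The order of choices matters: \<open>m\<close> makes \<open>conc m 1\<close> small, then
  a large \<open>n \<ge> m\<close> makes the radius small relative to the gaps between the atoms at
  step \<open>m\<close>, and \<open>law_ball_le\<close> carries the bound from \<open>m\<close> to
  \<open>n\<close>.\<close>

lemma law_shrinking_ball_tendsto_0:
  assumes inf: "infinite {k. k \<ge> 1 \<and> \<alpha> k \<noteq> \<beta> k}"
    and \<rho>: "\<rho> \<longlonglongrightarrow> 0" "\<And>n. \<rho> n > 0"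
  shows "(\<lambda>n. D n (ball x (\<rho> n))) \<longlonglongrightarrow> 0"
proof (rule order_tendstoI)
  fix e :: real assume "0 < e"
  then obtain m where m: "conc m 1 < e"
    using order_tendstoD(2)[OF conc_tendsto_0[OF inf]] by (metis eventually_happens sequentially_bot)
  have "filterlim \<rho> (at_right 0) sequentially"
    using \<rho> by (auto simp: filterlim_at intro!: always_eventually less_imp_neq[THEN not_sym])
  then have "eventually (\<lambda>n. \<forall>x. D m (ball x (\<rho> n)) \<le> conc m 1) sequentially"
    using law_small_ball_le_conc by (rule eventually_compose_filterlim[rotated])
  then show "eventually (\<lambda>n. D n (ball x (\<rho> n)) < e) sequentially"
    using eventually_ge_at_top[of m]
  proof eventually_elim
    case (elim n)
    then show ?case using law_ball_le[of m "\<rho> n" "conc m 1" n x] m by auto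
  qed
next
  fix e :: real assume "e < 0"
  then show "eventually (\<lambda>n. e < D n (ball x (\<rho> n))) sequentially"
    using law_nonneg by (auto intro!: always_eventually intro: less_le_trans)
qed

end

section \<open>Logarithmic potentials\<close>

lemma cball_in_sets_borel [measurable]: "cball (c :: 'a :: metric_space) r \<in> sets borel"
  by (simp add: borel_closed)

lemma ball_in_sets_borel [measurable]: "ball (c :: 'a :: metric_space) r \<in> sets borel"
  by (simp add: borel_open)

text \<open>Dyadic layers in place of polar coordinates: the weight \<open>2 ^ Suc k\<close> meets a
  disc of area of order 4^-k, so the series is integrable. At \<open>z = w\<close> the left side is
  0 by \<open>1 / 0 = 0\<close>.\<close>

lemma inverse_dist_le_dyadic:
  fixes z w :: complex
  shows "ennreal (1 / cmod (z - w)) \<le> 1 + (\<Sum>k. ennreal (2 ^ Suc k) * indicator (ball w ((1/2) ^ k)) z)"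
proof (cases "cmod (z - w) = 0 \<or> cmod (z - w) \<ge> 1")
  case True
  then have "1 / cmod (z - w) \<le> 1" by (auto simp: divide_simps)
  then have "ennreal (1 / cmod (z - w)) \<le> 1" by simp
  then show ?thesis by (rule order_trans) simp
next
  case False
  define d where "d = cmod (z - w)"
  have d: "d > 0" "d < 1" using False by (auto simp: d_def)
  obtain m where m: "(1/2) ^ m < d" using real_arch_pow_inv[of d "1/2"] d by auto
  \<comment> \<open>Selects the layer of \<open>d\<close>: 2^-(k+1) <= d < 2^-k.\<close>
  define k where "k = (LEAST k. (1/2) ^ Suc k \<le> d)"
  have ex: "(1/2) ^ Suc m \<le> d" using m d by (simp add: field_simps)
  have k: "(1/2) ^ Suc k \<le> d" unfolding k_def by (rule LeastI[of _ m]) (rule ex)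
  have lt: "d < (1/2) ^ k"
  proof (cases k)
    case (Suc j)
    then have "\<not> (1/2) ^ Suc j \<le> d" using not_less_Least[of j "\<lambda>k. (1/2) ^ Suc k \<le> d"] by (simp add: k_def)
    then show ?thesis by (simp add: Suc)
  qed (use d in auto)
  have "1 / d \<le> 1 / (1/2) ^ Suc k" using k d by (intro divide_left_mono) auto
  also have "\<dots> = 2 ^ Suc k" by (simp add: power_divide)
  finally have "ennreal (1 / d) \<le> ennreal (2 ^ Suc k)" by (rule ennreal_leI)
  also have "\<dots> = ennreal (2 ^ Suc k) * indicator (ball w ((1/2) ^ k)) z"
    using lt by (simp add: d_def dist_norm norm_minus_commute)
  also have "\<dots> \<le> (\<Sum>k. ennreal (2 ^ Suc k) * indicator (ball w ((1/2) ^ k)) z)"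
  proof -
    have "g k \<le> suminf g" for g :: "nat \<Rightarrow> ennreal"
      using sum_le_suminf[of g "{k}"] by simp
    then show ?thesis .
  qed
  also have "\<dots> \<le> 1 + \<dots>" by simp
  finally show ?thesis by (simp add: d_def)
qed

lemma emeasure_cball_complex: "A \<ge> 0 \<Longrightarrow> emeasure lborel (cball (c::complex) A) = ennreal (pi * A^2)"
  by (simp add: emeasure_cball unit_ball_vol_2)

lemma emeasure_ball_complex: "A \<ge> 0 \<Longrightarrow> emeasure lborel (ball (c::complex) A) = ennreal (pi * A^2)"
  by (simp add: emeasure_ball unit_ball_vol_2)

text \<open>The bound is independent of \<open>w\<close>, so it applies to zeros whose location is
  unknown. The constant 1 contributes the area of the disc, and layer \<open>k\<close> contributes
  2^(k+1) * pi * 4^-k = 2 pi * 2^-k, which sums to 4 pi.\<close>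

lemma nn_integral_inverse_dist_le:
  fixes w :: complex
  assumes "A \<ge> 0"
  shows "(\<integral>\<^sup>+z. ennreal (1 / cmod (z - w)) * indicator (cball 0 A) z \<partial>lborel) \<le> ennreal (pi * A^2 + 4 * pi)"
proof -
  let ?g = "\<lambda>k z. ennreal (2 ^ Suc k) * indicator (ball w ((1/2) ^ k)) z"
  have [measurable]: "?g k \<in> borel_measurable borel" for k
    by (intro borel_measurable_times_ennreal borel_measurable_const borel_measurable_indicator) simp
  have "(\<integral>\<^sup>+z. ennreal (1 / cmod (z - w)) * indicator (cball 0 A) z \<partial>lborel) \<le>
      (\<integral>\<^sup>+z. indicator (cball 0 A) z + (\<Sum>k. ?g k z) \<partial>lborel)"
    by (intro nn_integral_mono) (use inverse_dist_le_dyadic[of _ w] in \<open>auto simp: indicator_def\<close>)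
  also have "\<dots> = emeasure lborel (cball (0::complex) A) + (\<integral>\<^sup>+z. (\<Sum>k. ?g k z) \<partial>lborel)"
    by (subst nn_integral_add) auto
  also have "(\<integral>\<^sup>+z. (\<Sum>k. ?g k z) \<partial>lborel) = (\<Sum>k. \<integral>\<^sup>+z. ?g k z \<partial>lborel)"
    by (rule nn_integral_suminf) measurable
  also have "(\<lambda>k. \<integral>\<^sup>+z. ?g k z \<partial>lborel) = (\<lambda>k. ennreal (2 * pi * (1/2) ^ k))"
  proof
    fix k
    have "(\<integral>\<^sup>+z. ?g k z \<partial>lborel) = ennreal (2 ^ Suc k) * ennreal (pi * ((1/2) ^ k)\<^sup>2)"
      by (subst nn_integral_cmult) (measurable, simp add: emeasure_ball_complex)
    also have "\<dots> = ennreal (2 ^ Suc k * (pi * ((1/2) ^ k)\<^sup>2))"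
      by (rule ennreal_mult[symmetric]) auto
    also have "2 ^ Suc k * (pi * ((1/2) ^ k)\<^sup>2) = 2 * pi * (1/2) ^ k"
      by (simp add: power2_eq_square power_divide)
    finally show "(\<integral>\<^sup>+z. ?g k z \<partial>lborel) = ennreal (2 * pi * (1/2) ^ k)" .
  qed
  also have "(\<Sum>k. ennreal (2 * pi * (1/2) ^ k)) = ennreal (4 * pi)"
  proof (rule suminf_ennreal_eq)
    have "(\<lambda>k. (1/2::real) ^ k) sums 2" using geometric_sums[of "1/2::real"] by simp
    from sums_mult[OF this, of "2 * pi"] show "(\<lambda>k. 2 * pi * (1/2) ^ k) sums (4 * pi)" by simp
  qed auto
  also have "emeasure lborel (cball (0::complex) A) + ennreal (4 * pi) = ennreal (pi * A^2 + 4 * pi)"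
    using assms by (simp add: emeasure_cball_complex)
  finally show ?thesis .
qed

text \<open>Crude, but it reduces the logarithm to the kernel 1/|z - w|. At 0 both sides vanish,
  because \<open>ln 0 = 0\<close> and \<open>1 / 0 = 0\<close>.\<close>

lemma abs_ln_le:
  fixes x :: real
  assumes "x \<ge> 0"
  shows "\<bar>ln x\<bar> \<le> x + 1 / x"
proof (cases "x = 0")
  case False
  then have "x > 0" using assms by simp
  then have "ln x \<le> x" "ln (1 / x) \<le> 1 / x" by (simp_all add: ln_bound)
  then show ?thesis using \<open>x > 0\<close> assms by (simp add: ln_div abs_le_iff add_increasing add_increasing2)
qed simp

lemma nn_integral_abs_ln_dist_finite:
  fixes w :: complex
  assumes "A \<ge> 0"
  shows "(\<integral>\<^sup>+z. ennreal \<bar>ln (cmod (z - w))\<bar> * indicator (cball 0 A) z \<partial>lborel) < \<infinity>"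
proof -
  have "(\<integral>\<^sup>+z. ennreal \<bar>ln (cmod (z - w))\<bar> * indicator (cball 0 A) z \<partial>lborel) \<le>
    (\<integral>\<^sup>+z. ennreal (A + cmod w) * indicator (cball 0 A) z + ennreal (1 / cmod (z - w)) * indicator (cball 0 A) z \<partial>lborel)"
  proof (intro nn_integral_mono)
    fix z :: complex
    have "\<bar>ln (cmod (z - w))\<bar> \<le> (A + cmod w) + 1 / cmod (z - w)" if "cmod z \<le> A"
      using abs_ln_le[of "cmod (z - w)"] norm_triangle_ineq4[of z w] that by simp
    then show "ennreal \<bar>ln (cmod (z - w))\<bar> * indicator (cball 0 A) z \<le>
       ennreal (A + cmod w) * indicator (cball 0 A) z + ennreal (1 / cmod (z - w)) * indicator (cball 0 A) z"
      using assms by (auto simp: indicator_def ennreal_leI simp flip: ennreal_plus)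
  qed
  also have "\<dots> = ennreal (A + cmod w) * emeasure lborel (cball (0::complex) A) +
      (\<integral>\<^sup>+z. ennreal (1 / cmod (z - w)) * indicator (cball 0 A) z \<partial>lborel)"
    by (subst nn_integral_add) (measurable, simp add: nn_integral_cmult)
  also have "\<dots> \<le> ennreal (A + cmod w) * ennreal (pi * A^2) + ennreal (pi * A^2 + 4 * pi)"
    using nn_integral_inverse_dist_le[OF assms, of w] assms by (simp add: emeasure_cball_complex add_left_mono)
  also have "\<dots> < \<infinity>" by (simp add: ennreal_mult_less_top)
  finally show ?thesis .
qed

section \<open>Circular means of ln|u - w| (Jensen's formula)\<close>

lemma circle_mean_holomorphic:
  assumes "f holomorphic_on cball 0 \<rho>" "\<rho> > 0"
  shows "((\<lambda>t. f (of_real \<rho> * exp (2 * of_real pi * \<i> * of_real t))) has_integral f 0) {0..1}"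
proof -
  \<comment> \<open>On the circle du/u = 2 pi i dt, which turns Cauchy's formula at the centre into
    the mean value property.\<close>
  have "((\<lambda>u. f u / (u - 0)) has_contour_integral (2 * of_real pi * \<i> * f 0)) (circlepath 0 \<rho>)"
    by (rule Cauchy_integral_circlepath_simple) (use assms in auto)
  then have "((\<lambda>t. f (circlepath 0 \<rho> t) / circlepath 0 \<rho> t * (2 * pi * \<i> * \<rho> * exp (2 * of_real pi * \<i> * t)))
      has_integral (2 * of_real pi * \<i> * f 0)) {0..1}"
    unfolding has_contour_integral_def
    by (rule has_integral_eq[rotated]) (simp add: vector_derivative_circlepath01)
  then have "((\<lambda>t. (2 * of_real pi * \<i>) * f (of_real \<rho> * exp (2 * of_real pi * \<i> * of_real t)))
      has_integral (2 * of_real pi * \<i> * f 0)) {0..1}"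
    by (rule has_integral_eq[rotated]) (use assms in \<open>simp add: circlepath\<close>)
  from has_integral_mult_right[OF this, of "1 / (2 * of_real pi * \<i>)"] show ?thesis by simp
qed

text \<open>From |c u| < 1 the value 1 - c u stays in the right half-plane, off the branch
  cut.\<close>

lemma holomorphic_on_Ln_one_minus:
  assumes "cmod c * \<rho> < 1"
  shows "(\<lambda>u. Ln (1 - c * u)) holomorphic_on cball 0 \<rho>"
proof (intro holomorphic_intros)
  fix u :: complex assume "u \<in> cball 0 \<rho>"
  then have "cmod (c * u) \<le> cmod c * \<rho>" by (simp add: norm_mult mult_left_mono)
  also have "\<dots> < 1" by fact
  finally have "Re (c * u) < 1" using complex_Re_le_cmod[of "c * u"] by linarith
  then show "1 - c * u \<notin> \<real>\<^sub>\<le>\<^sub>0" by (auto simp: complex_nonpos_Reals_iff)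
qed

text \<open>The mean value property for the real part of \<open>Ln (1 - c * u)\<close>, which
  vanishes at the centre.\<close>

lemma circle_mean_ln_one_minus:
  assumes "cmod c * \<rho> < 1" "\<rho> > 0"
  shows "((\<lambda>t. ln (cmod (1 - c * (of_real \<rho> * exp (2 * of_real pi * \<i> * of_real t))))) has_integral 0) {0..1}"
proof -
  have "((\<lambda>t. Ln (1 - c * (of_real \<rho> * exp (2 * of_real pi * \<i> * of_real t)))) has_integral Ln (1 - c * 0)) {0..1}"
    by (rule circle_mean_holomorphic[OF holomorphic_on_Ln_one_minus[OF assms(1)] assms(2)])
  from has_integral_linear[OF this bounded_linear_Re]
  have "((\<lambda>t. Re (Ln (1 - c * (of_real \<rho> * exp (2 * of_real pi * \<i> * of_real t))))) has_integral 0) {0..1}"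
    by (simp add: o_def)
  then show ?thesis
  proof (rule has_integral_eq[rotated])
    fix t :: real
    have "cmod (c * (of_real \<rho> * exp (2 * of_real pi * \<i> * of_real t))) < 1"
      using assms by (simp add: norm_mult)
    then have "1 - c * (of_real \<rho> * exp (2 * of_real pi * \<i> * of_real t)) \<noteq> 0" by (metis eq_iff_diff_eq_0 norm_one order_less_irrefl)
    then show "Re (Ln (1 - c * (of_real \<rho> * exp (2 * of_real pi * \<i> * of_real t)))) =
      ln (cmod (1 - c * (of_real \<rho> * exp (2 * of_real pi * \<i> * of_real t))))" by simp
  qed
qed

text \<open>Inside the circle, \<open>\<bar>u - w\<bar> = \<bar>\<rho>\<^sup>2 - cnj w u\<bar> / \<rho>\<close> on \<open>\<bar>u\<bar> = \<rho>\<close>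
  moves the zero outside.\<close>

lemma circle_mean_ln_dist:
  assumes "\<rho> > 0" "cmod w \<noteq> \<rho>"
  shows "((\<lambda>t. ln (cmod (of_real \<rho> * exp (2 * of_real pi * \<i> * of_real t) - w))) has_integral ln (max \<rho> (cmod w))) {0..1}"
proof (cases "\<rho> < cmod w")
  case True
  then have w: "w \<noteq> 0" using assms by auto
  \<comment> \<open>Here u - w = - w (1 - u / w), and the second factor has no zero in the closed
    disc.\<close>
  have "((\<lambda>t. ln (cmod (1 - (1/w) * (of_real \<rho> * exp (2 * of_real pi * \<i> * of_real t))))) has_integral 0) {0..1}"
    using True w assms by (intro circle_mean_ln_one_minus) (auto simp: norm_divide divide_simps)
  from has_integral_add[OF this has_integral_const_real[of "ln (cmod w)" 0 1]]
  have "((\<lambda>t. ln (cmod (1 - (1/w) * (of_real \<rho> * exp (2 * of_real pi * \<i> * of_real t)))) + ln (cmod w)) has_integral ln (cmod w)) {0..1}"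
    by simp
  then have "((\<lambda>t. ln (cmod (of_real \<rho> * exp (2 * of_real pi * \<i> * of_real t) - w))) has_integral ln (cmod w)) {0..1}"
  proof (rule has_integral_eq[rotated])
    fix t :: real
    define u where "u = of_real \<rho> * exp (2 * of_real pi * \<i> * of_real t)"
    have "cmod u = \<rho>" using assms by (simp add: u_def norm_mult)
    then have "u \<noteq> w" using True by auto
    then have "1 - (1/w) * u \<noteq> 0" using w by (simp add: field_simps)
    then have "ln (cmod (1 - (1/w) * u)) + ln (cmod w) = ln (cmod ((1 - (1/w) * u) * w))"
      using w by (simp add: norm_mult ln_mult)
    also have "(1 - (1/w) * u) * w = w - u" using w by (simp add: field_simps)
    finally show "ln (cmod (1 - (1/w) * u)) + ln (cmod w) = ln (cmod (u - w))" by (simp add: norm_minus_commute)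
  qed
  then show ?thesis using True by (simp add: max_def)
next
  case False
  then have lt: "cmod w < \<rho>" using assms by simp
  define c where "c = cnj w / of_real (\<rho>\<^sup>2)"
  have c: "cmod c * \<rho> < 1"
    using lt assms by (simp add: c_def norm_divide power2_eq_square norm_mult)
  have "((\<lambda>t. ln (cmod (1 - c * (of_real \<rho> * exp (2 * of_real pi * \<i> * of_real t))))) has_integral 0) {0..1}"
    using c assms by (intro circle_mean_ln_one_minus) auto
  from has_integral_add[OF this has_integral_const_real[of "ln \<rho>" 0 1]]
  have "((\<lambda>t. ln (cmod (1 - c * (of_real \<rho> * exp (2 * of_real pi * \<i> * of_real t)))) + ln \<rho>) has_integral ln \<rho>) {0..1}"
    by simp
  then have "((\<lambda>t. ln (cmod (of_real \<rho> * exp (2 * of_real pi * \<i> * of_real t) - w))) has_integral ln \<rho>) {0..1}"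
  proof (rule has_integral_eq[rotated])
    fix t :: real
    define u where "u = of_real \<rho> * exp (2 * of_real pi * \<i> * of_real t)"
    have u: "cmod u = \<rho>" using assms by (simp add: u_def norm_mult)
    then have "cmod (c * u) < 1" using c by (simp add: norm_mult)
    then have nz: "1 - c * u \<noteq> 0" by (metis eq_iff_diff_eq_0 norm_one order_less_irrefl)
    have "of_real (\<rho>\<^sup>2) = u * cnj u" using u complex_norm_square[of u] by simp
    then have "(1 - c * u) * of_real (\<rho>\<^sup>2) = u * cnj u - cnj w * u"
      using assms by (simp add: c_def field_simps)
    also have "\<dots> = u * cnj (u - w)" by (simp add: algebra_simps)
    finally have "cmod ((1 - c * u) * of_real (\<rho>\<^sup>2)) = \<rho> * cmod (u - w)"
      using u by (simp add: norm_mult flip: complex_cnj_diff)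
    then have "cmod (1 - c * u) * \<rho> = cmod (u - w)"
      using assms by (simp add: norm_mult power2_eq_square)
    then show "ln (cmod (1 - c * u)) + ln \<rho> = ln (cmod (u - w))"
      using nz assms by (metis less_numeral_extra(3) ln_mult norm_eq_zero order_less_le zero_less_norm_iff)
  qed
  then show ?thesis using lt by (simp add: max_def)
qed

section \<open>Circular means as convolutions, and their logarithmic potentials\<close>

definition unit_interval :: "real measure" where
  "unit_interval = density lborel (\<lambda>t. ennreal (indicator {0..1} t))"

lemma sets_unit_interval [measurable_cong, simp]: "sets unit_interval = sets borel"
  and space_unit_interval [simp]: "space unit_interval = UNIV"
  by (simp_all add: unit_interval_def)

lemma prob_space_unit_interval: "prob_space unit_interval"
proof
  have "emeasure unit_interval UNIV = (\<integral>\<^sup>+t. ennreal (indicator {0..1::real} t) \<partial>lborel)"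
    unfolding unit_interval_def by (subst emeasure_density) auto
  also have "\<dots> = (\<integral>\<^sup>+t. indicator {0..1::real} t \<partial>lborel)"
    by (intro nn_integral_cong) (simp add: ennreal_indicator)
  also have "\<dots> = 1" by simp
  finally have "emeasure unit_interval UNIV = 1" .
  then show "emeasure unit_interval (space unit_interval) = 1" by simp
qed

text \<open>Passes from the gauge integral of the circular means to a Lebesgue integral over a
  probability measure, where Fubini's theorem applies.\<close>

lemma integral_unit_interval_eq:
  fixes f :: "real \<Rightarrow> real"
  assumes "continuous_on {0..1} f" "f \<in> borel_measurable borel" "(f has_integral I) {0..1}"
  shows "(\<integral>t. f t \<partial>unit_interval) = I"
proof -
  have int: "set_integrable lborel {0..1} f"
    unfolding set_integrable_def by (rule borel_integrable_compact) (use assms in auto)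
  have "(\<integral>t. f t \<partial>unit_interval) = (LINT t:{0..1}|lborel. f t)"
    unfolding unit_interval_def set_lebesgue_integral_def
    by (subst integral_density) (use assms in \<open>auto simp: indicator_def\<close>)
  also have "\<dots> = I"
    using set_borel_integral_eq_integral(2)[OF int] integral_unique[OF assms(3)] by simp
  finally show ?thesis .
qed

abbreviation circle_pt :: "real \<Rightarrow> real \<Rightarrow> complex" where
  "circle_pt \<rho> t \<equiv> of_real \<rho> * exp (2 * of_real pi * \<i> * of_real t)"

lemma norm_circle_pt [simp]: "\<rho> \<ge> 0 \<Longrightarrow> cmod (circle_pt \<rho> t) = \<rho>"
  by (simp add: norm_mult)

lemma circle_pt_measurable [measurable]: "circle_pt \<rho> \<in> borel_measurable borel"
  by (intro borel_measurable_continuous_onI continuous_intros)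

definition circle_mean :: "(complex \<Rightarrow> real) \<Rightarrow> real \<Rightarrow> complex \<Rightarrow> real" where
  "circle_mean f \<rho> z = (\<integral>t. f (z - circle_pt \<rho> t) \<partial>unit_interval)"

lemma lborel_integral_translate:
  fixes f :: "'a :: euclidean_space \<Rightarrow> real"
  assumes "f \<in> borel_measurable borel"
  shows "(\<integral>x. f (c + x) \<partial>lborel) = (\<integral>x. f x \<partial>lborel)"
  using integral_distr[of "(+) c" lborel borel f] assms by (simp add: lborel_distr_plus)

lemma lborel_nn_integral_translate:
  fixes f :: "'a :: euclidean_space \<Rightarrow> ennreal"
  assumes "f \<in> borel_measurable borel"
  shows "(\<integral>\<^sup>+x. f (c + x) \<partial>lborel) = (\<integral>\<^sup>+x. f x \<partial>lborel)"
  using nn_integral_distr[of "(+) c" lborel borel f] assms by (simp add: lborel_distr_plus)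

context
  fixes f :: "complex \<Rightarrow> real" and A B :: real
  assumes f [measurable]: "f \<in> borel_measurable borel"
    and bound: "\<And>z. \<bar>f z\<bar> \<le> B"
    and supp: "\<And>z. cmod z > A \<Longrightarrow> f z = 0"
    and A: "A \<ge> 0"
begin

lemma circle_mean_measurable: "circle_mean f \<rho> \<in> borel_measurable borel"
proof -
  interpret T: prob_space unit_interval by (rule prob_space_unit_interval)
  show ?thesis unfolding circle_mean_def by measurable
qed

lemma circle_mean_bound: "\<bar>circle_mean f \<rho> z\<bar> \<le> B"
proof -
  interpret T: prob_space unit_interval by (rule prob_space_unit_interval)
  have "\<bar>circle_mean f \<rho> z\<bar> \<le> (\<integral>t. B \<partial>unit_interval)"
    unfolding circle_mean_def
    by (rule integral_abs_bound_integral) (use bound in \<open>auto intro!: T.integrable_const_bound[of _ B]\<close>)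
  then show ?thesis using T.prob_space by simp
qed

lemma circle_mean_support:
  assumes "\<rho> \<ge> 0" "cmod z > A + \<rho>"
  shows "circle_mean f \<rho> z = 0"
proof -
  have "f (z - circle_pt \<rho> t) = 0" for t
    using norm_triangle_ineq2[of z "circle_pt \<rho> t"] norm_circle_pt[OF assms(1), of t] assms by (intro supp) simp
  then show ?thesis by (simp add: circle_mean_def)
qed

text \<open>By Fubini, the potential of \<open>f\<close> smeared over circles is \<open>f\<close>
  integrated against the potential of a single circle, and Jensen's formula evaluates the
  latter.\<close>

lemma integral_ln_dist_circle_mean:
  fixes w :: complex
  assumes \<rho>: "\<rho> > 0"
  shows "(\<integral>z. ln (cmod (z - w)) * circle_mean f \<rho> z \<partial>lborel) = (\<integral>c. f c * ln (max \<rho> (cmod (w - c))) \<partial>lborel)"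
proof -
  interpret T: prob_space unit_interval by (rule prob_space_unit_interval)
  interpret P: pair_sigma_finite "lborel :: complex measure" unit_interval ..
  have B: "B \<ge> 0" using bound[of 0] by linarith
  define H where "H z t = ln (cmod (z - w)) * f (z - circle_pt \<rho> t)" for z t
  \<comment> \<open>\<open>K\<close> is \<open>H\<close> after the substitution
    \<open>z = circle_pt \<rho> t + c\<close>; translation invariance transfers the integrability
    and the inner integrals from one to the other.\<close>
  define K where "K c t = f c * ln (cmod (circle_pt \<rho> t - (w - c)))" for c t
  define C where "C = (\<integral>\<^sup>+z. ennreal \<bar>ln (cmod (z - w))\<bar> * indicator (cball 0 (A + \<rho>)) z \<partial>lborel)"
  have C: "C < \<infinity>" unfolding C_def by (rule nn_integral_abs_ln_dist_finite) (use A \<rho> in auto)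
  have Hm [measurable]: "(\<lambda>p. H (fst p) (snd p)) \<in> borel_measurable (lborel \<Otimes>\<^sub>M unit_interval)"
    unfolding H_def by measurable
  have Km [measurable]: "(\<lambda>p. K (fst p) (snd p)) \<in> borel_measurable (lborel \<Otimes>\<^sub>M unit_interval)"
    unfolding K_def by measurable
  have shift: "K c t = H (circle_pt \<rho> t + c) t" for c t
    by (simp add: K_def H_def algebra_simps)
  \<comment> \<open>\<open>f (z - circle_pt \<rho> t)\<close> vanishes unless |z| <= A + \<rho>, so
    a single locally integrable function dominates \<open>H\<close> for all
    \<open>t\<close>.\<close>
  have Hle: "ennreal (norm (H z t)) \<le> ennreal B * (ennreal \<bar>ln (cmod (z - w))\<bar> * indicator (cball 0 (A + \<rho>)) z)" for z t
  proof (cases "cmod z \<le> A + \<rho>")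
    case True
    have "norm (H z t) \<le> B * \<bar>ln (cmod (z - w))\<bar>"
    proof -
      have "\<bar>f x\<bar> * \<bar>ln (cmod (z - w))\<bar> \<le> B * \<bar>ln (cmod (z - w))\<bar>" for x
        by (rule mult_right_mono[OF bound]) simp
      moreover have "norm (H z t) = \<bar>f (z - circle_pt \<rho> t)\<bar> * \<bar>ln (cmod (z - w))\<bar>"
        unfolding H_def real_norm_def abs_mult by (rule mult.commute)
      ultimately show "norm (H z t) \<le> B * \<bar>ln (cmod (z - w))\<bar>" by (simp only:)
    qed
    then show ?thesis using True B by (simp add: ennreal_leI flip: ennreal_mult)
  next
    case False
    then have "f (z - circle_pt \<rho> t) = 0"
      using norm_triangle_ineq2[of z "circle_pt \<rho> t"] norm_circle_pt[of \<rho> t] \<rho> by (intro supp) simp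
    then show ?thesis by (simp add: H_def)
  qed
  have inner: "(\<integral>\<^sup>+z. ennreal (norm (H z t)) \<partial>lborel) \<le> ennreal B * C" for t
  proof -
    have "(\<integral>\<^sup>+z. ennreal (norm (H z t)) \<partial>lborel) \<le>
        (\<integral>\<^sup>+z. ennreal B * (ennreal \<bar>ln (cmod (z - w))\<bar> * indicator (cball 0 (A + \<rho>)) z) \<partial>lborel)"
      by (intro nn_integral_mono Hle)
    also have "\<dots> = ennreal B * C" unfolding C_def by (rule nn_integral_cmult) measurable
    finally show ?thesis .
  qed
  have outer: "(\<integral>\<^sup>+t. ennreal B * C \<partial>unit_interval) < \<infinity>"
    using C by (simp add: T.emeasure_space_1[simplified] ennreal_mult_less_top)
  have intH: "integrable (lborel \<Otimes>\<^sub>M unit_interval) (case_prod H)"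
  proof (rule integrableI_bounded)
    have "(\<integral>\<^sup>+p. ennreal (norm (case_prod H p)) \<partial>(lborel \<Otimes>\<^sub>M unit_interval)) =
        (\<integral>\<^sup>+t. \<integral>\<^sup>+z. ennreal (norm (case_prod H (z, t))) \<partial>lborel \<partial>unit_interval)"
      by (rule P.nn_integral_snd[symmetric]) (simp add: case_prod_beta)
    also have "\<dots> \<le> (\<integral>\<^sup>+t. ennreal B * C \<partial>unit_interval)"
      by (intro nn_integral_mono) (use inner in simp)
    finally show "(\<integral>\<^sup>+p. ennreal (norm (case_prod H p)) \<partial>(lborel \<Otimes>\<^sub>M unit_interval)) < \<infinity>"
      using outer by (rule le_less_trans)
  qed (simp add: case_prod_beta)
  have intK: "integrable (lborel \<Otimes>\<^sub>M unit_interval) (case_prod K)"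
  proof (rule integrableI_bounded)
    have "(\<integral>\<^sup>+p. ennreal (norm (case_prod K p)) \<partial>(lborel \<Otimes>\<^sub>M unit_interval)) =
        (\<integral>\<^sup>+t. \<integral>\<^sup>+c. ennreal (norm (case_prod K (c, t))) \<partial>lborel \<partial>unit_interval)"
      by (rule P.nn_integral_snd[symmetric]) (simp add: case_prod_beta)
    also have "\<dots> = (\<integral>\<^sup>+t. \<integral>\<^sup>+c. ennreal (norm (H (circle_pt \<rho> t + c) t)) \<partial>lborel \<partial>unit_interval)"
      by (simp add: shift)
    also have "\<dots> = (\<integral>\<^sup>+t. \<integral>\<^sup>+z. ennreal (norm (H z t)) \<partial>lborel \<partial>unit_interval)"
    proof (rule nn_integral_cong)
      fix t
      show "(\<integral>\<^sup>+c. ennreal (norm (H (circle_pt \<rho> t + c) t)) \<partial>lborel) = (\<integral>\<^sup>+z. ennreal (norm (H z t)) \<partial>lborel)"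
        by (rule lborel_nn_integral_translate) (simp add: H_def)
    qed
    also have "\<dots> \<le> (\<integral>\<^sup>+t. ennreal B * C \<partial>unit_interval)"
      by (intro nn_integral_mono inner)
    finally show "(\<integral>\<^sup>+p. ennreal (norm (case_prod K p)) \<partial>(lborel \<Otimes>\<^sub>M unit_interval)) < \<infinity>"
      using outer by (rule le_less_trans)
  qed (simp add: case_prod_beta)
  have "(\<integral>z. ln (cmod (z - w)) * circle_mean f \<rho> z \<partial>lborel) = (\<integral>z. \<integral>t. H z t \<partial>unit_interval \<partial>lborel)"
    by (simp add: H_def circle_mean_def)
  also have "\<dots> = (\<integral>t. \<integral>z. H z t \<partial>lborel \<partial>unit_interval)"
    by (rule P.Fubini_integral[OF intH, symmetric])
  also have "\<dots> = (\<integral>t. \<integral>c. K c t \<partial>lborel \<partial>unit_interval)"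
  proof (rule Bochner_Integration.integral_cong[OF refl])
    fix t
    have "(\<integral>c. H (circle_pt \<rho> t + c) t \<partial>lborel) = (\<integral>z. H z t \<partial>lborel)"
      by (rule lborel_integral_translate) (simp add: H_def)
    then show "(\<integral>z. H z t \<partial>lborel) = (\<integral>c. K c t \<partial>lborel)" by (simp add: shift)
  qed
  also have "\<dots> = (\<integral>c. \<integral>t. K c t \<partial>unit_interval \<partial>lborel)"
    by (rule P.Fubini_integral[OF intK])
  also have "\<dots> = (\<integral>c. f c * ln (max \<rho> (cmod (w - c))) \<partial>lborel)"
  proof (rule integral_cong_AE)
    \<comment> \<open>Jensen's formula was shown only off the circle |w - c| = \<rho>, a null set of
      points \<open>c\<close>.\<close>
    have "sphere w \<rho> \<in> null_sets lborel"
      using negligible_sphere[of w \<rho>] by (simp add: null_sets_completion_iff negligible_iff_null_sets)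
    then have "AE c in lborel. c \<notin> sphere w \<rho>" by (rule AE_not_in)
    then show "AE c in lborel. (\<integral>t. K c t \<partial>unit_interval) = f c * ln (max \<rho> (cmod (w - c)))"
    proof eventually_elim
      case (elim c)
      then have ne: "cmod (w - c) \<noteq> \<rho>" by (auto simp: dist_norm)
      have nz: "circle_pt \<rho> t \<noteq> w - c" for t
      proof -
        have "cmod (circle_pt \<rho> t) = \<rho>" by (rule norm_circle_pt) (use \<rho> in simp)
        then show ?thesis using ne by metis
      qed
      have "(\<integral>t. ln (cmod (circle_pt \<rho> t - (w - c))) \<partial>unit_interval) = ln (max \<rho> (cmod (w - c)))"
        by (intro integral_unit_interval_eq circle_mean_ln_dist continuous_intros)
           (use ne nz \<rho> in simp_all)
      then show ?case by (simp add: K_def)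
    qed
    show "(\<lambda>c. \<integral>t. K c t \<partial>unit_interval) \<in> borel_measurable lborel"
      by (rule borel_measurable_integrable) (rule P.integrable_fst[OF intK])
  qed measurable
  finally show ?thesis .
qed

end

section \<open>Uniform approximation of test functions by logarithmic potentials\<close>

lemma integrable_ln_dist_mult:
  fixes w :: complex
  assumes [measurable]: "\<phi> \<in> borel_measurable borel"
    and "\<And>z. \<bar>\<phi> z\<bar> \<le> B" "\<And>z. cmod z > A \<Longrightarrow> \<phi> z = 0" "A \<ge> 0"
  shows "integrable lborel (\<lambda>z. ln (cmod (z - w)) * \<phi> z)"
proof (rule integrableI_bounded)
  have B: "B \<ge> 0" using assms(2)[of 0] by linarith
  have "(\<integral>\<^sup>+z. ennreal (norm (ln (cmod (z - w)) * \<phi> z)) \<partial>lborel) \<le>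
     (\<integral>\<^sup>+z. ennreal B * (ennreal \<bar>ln (cmod (z - w))\<bar> * indicator (cball 0 A) z) \<partial>lborel)"
  proof (intro nn_integral_mono)
    fix z
    have "\<bar>ln (cmod (z - w))\<bar> * \<bar>\<phi> z\<bar> \<le> B * \<bar>ln (cmod (z - w))\<bar>"
      using assms(2)[of z] by (simp add: mult.commute mult_right_mono)
    then show "ennreal (norm (ln (cmod (z - w)) * \<phi> z)) \<le> ennreal B * (ennreal \<bar>ln (cmod (z - w))\<bar> * indicator (cball 0 A) z)"
      using assms(3)[of z] B by (auto simp: indicator_def abs_mult ennreal_leI simp flip: ennreal_mult)
  qed
  also have "\<dots> = ennreal B * (\<integral>\<^sup>+z. ennreal \<bar>ln (cmod (z - w))\<bar> * indicator (cball 0 A) z \<partial>lborel)"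
    by (rule nn_integral_cmult) measurable
  also have "\<dots> < \<infinity>"
    using nn_integral_abs_ln_dist_finite[OF assms(4), of w] by (simp add: ennreal_mult_less_top)
  finally show "(\<integral>\<^sup>+z. ennreal (norm (ln (cmod (z - w)) * \<phi> z)) \<partial>lborel) < \<infinity>" .
qed measurable

lemma uniformly_continuous_compact_support:
  fixes f :: "complex \<Rightarrow> real"
  assumes "continuous_on UNIV f" "\<And>z. cmod z > A \<Longrightarrow> f z = 0" "\<epsilon> > 0"
  obtains r where "r > 0" "\<And>z w. dist z w < r \<Longrightarrow> \<bar>f z - f w\<bar> < \<epsilon>"
proof -
  \<comment> \<open>The margin 2 covers both points when |z| <= A + 1 and their distance is below 1;
    otherwise both lie outside the support.\<close>
  have "uniformly_continuous_on (cball 0 (A + 2)) f"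
    by (intro compact_uniformly_continuous continuous_on_subset[OF assms(1)]) auto
  then obtain d where d: "d > 0" "\<And>z w. z \<in> cball 0 (A + 2) \<Longrightarrow> w \<in> cball 0 (A + 2) \<Longrightarrow> dist w z < d \<Longrightarrow> dist (f w) (f z) < \<epsilon>"
    using assms(3) unfolding uniformly_continuous_on_def by metis
  show ?thesis
  proof (rule that[of "min d 1"])
    fix z w :: complex assume *: "dist z w < min d 1"
    show "\<bar>f z - f w\<bar> < \<epsilon>"
    proof (cases "cmod z \<le> A + 1")
      case True
      then have "cmod w \<le> A + 2" using * norm_triangle_sub[of w z] by (simp add: dist_norm norm_minus_commute)
      then show ?thesis using d(2)[of w z] * True by (simp add: dist_norm)
    next
      case False
      then have "cmod w > A" using * norm_triangle_sub[of z w] by (simp add: dist_norm)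
      then show ?thesis using assms(2)[of z] assms(2)[of w] assms(3) False by simp
    qed
  qed (use d in auto)
qed

text \<open>By Jensen's formula \<open>ln (max (2r) \<bar>w - c\<bar>) - ln (max r \<bar>w - c\<bar>)\<close>, a nonnegative bump around \<open>c\<close>, is the
  logarithmic potential of a signed measure; convolving with \<open>f\<close> gives the approximant.\<close>

lemma log_potential_approx:
  fixes f :: "complex \<Rightarrow> real"
  assumes cont: "continuous_on UNIV f" and supp: "\<And>z. cmod z > A \<Longrightarrow> f z = 0" and "\<epsilon> > 0"
  obtains \<phi> A' B where "\<phi> \<in> borel_measurable borel" "\<And>z. \<bar>\<phi> z\<bar> \<le> B" "\<And>z. cmod z > A' \<Longrightarrow> \<phi> z = 0" "A' \<ge> 0"
    "\<And>w. \<bar>f w - (\<integral>z. ln (cmod (z - w)) * \<phi> z \<partial>lborel)\<bar> \<le> \<epsilon>"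
proof -
  obtain r where r: "r > 0" "\<And>z w. dist z w < r \<Longrightarrow> \<bar>f z - f w\<bar> < \<epsilon>"
    using uniformly_continuous_compact_support[OF cont supp \<open>\<epsilon> > 0\<close>] by metis
  define s where "s = r / 2"
  have s: "s > 0" "2 * s = r" using r by (auto simp: s_def)
  define A0 where "A0 = max A 0"
  have supp0: "\<And>z. cmod z > A0 \<Longrightarrow> f z = 0" using supp by (auto simp: A0_def)
  have A0: "A0 \<ge> 0" by (simp add: A0_def)
  have fm [measurable]: "f \<in> borel_measurable borel" using cont by (rule borel_measurable_continuous_onI)
  have "compact (f ` cball 0 A0)" by (intro compact_continuous_image continuous_on_subset[OF cont]) auto
  then obtain B0 where B0: "\<And>z. z \<in> cball 0 A0 \<Longrightarrow> \<bar>f z\<bar> \<le> B0"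
    using compact_imp_bounded bounded_iff by (metis imageI real_norm_def)
  define B where "B = max B0 0"
  have B: "\<bar>f z\<bar> \<le> B" for z
    using B0[of z] supp0[of z] by (cases "cmod z \<le> A0") (auto simp: B_def)
  have B_nn: "B \<ge> 0" by (simp add: B_def)
  define t where "t c = ln (max r (cmod c)) - ln (max s (cmod c))" for c :: complex
  have tm [measurable]: "t \<in> borel_measurable borel" unfolding t_def by measurable
  have t_nn: "t c \<ge> 0" for c using s by (auto simp: t_def)
  have t_le: "t c \<le> ln 2" for c
  proof -
    have "max r (cmod c) \<le> 2 * max s (cmod c)" using s by (auto simp: max_def)
    then have "ln (max r (cmod c)) \<le> ln (2 * max s (cmod c))" using r s by (subst ln_le_cancel_iff) auto
    also have "\<dots> = ln 2 + ln (max s (cmod c))" using s by (subst ln_mult) auto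
    finally show ?thesis by (simp add: t_def)
  qed
  have t_supp: "t c = 0" if "cmod c \<ge> r" for c using that s r by (auto simp: t_def max_def)
  have t_eq: "t c = ln 2" if "cmod c \<le> s" for c
    using that s r by (auto simp: t_def max_def simp flip: s(2) simp: ln_mult)
  have t_int: "integrable lborel (\<lambda>c. t (w - c))" for w
  proof (rule integrableI_bounded_set[where A="cball w r" and B="ln 2"])
    show "AE c in lborel. c \<in> cball w r \<longrightarrow> norm (t (w - c)) \<le> ln 2" using t_nn t_le by auto
    show "AE c in lborel. c \<notin> cball w r \<longrightarrow> t (w - c) = 0" using t_supp by (auto simp: dist_norm)
  qed (use r in \<open>auto simp: emeasure_cball_complex\<close>)
  \<comment> \<open>Total mass of the bump, used to normalise it; it is positive because
    \<open>t\<close> equals \<open>ln 2\<close> on the disc of radius \<open>s\<close>.\<close>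
  define I where "I = (\<integral>c. t (0 - c) \<partial>lborel)"
  have I_eq: "(\<integral>c. t (w - c) \<partial>lborel) = I" for w
    using lborel_integral_translate[of "\<lambda>c. t (w - c)" w] by (simp add: I_def)
  have I_pos: "I > 0"
  proof -
    have "(\<integral>c. ln 2 * indicator (cball (0::complex) s) c \<partial>lborel) \<le> I"
      unfolding I_def
    proof (rule integral_mono)
      show "integrable lborel (\<lambda>c. ln 2 * indicator (cball (0::complex) s) c :: real)"
        using s by (intro integrable_mult_right integrable_real_indicator) (auto simp: emeasure_cball_complex)
      show "ln 2 * indicator (cball (0::complex) s) c \<le> t (0 - c)" for c
        using t_eq[of "- c"] t_nn[of "- c"] by (auto simp: indicator_def)
    qed (rule t_int)
    moreover have "(\<integral>c. ln 2 * indicator (cball (0::complex) s) c \<partial>lborel) = ln 2 * (pi * s\<^sup>2)"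
      using s by (simp add: measure_def emeasure_cball_complex)
    moreover have "ln 2 * (pi * s\<^sup>2) > 0" using s by simp
    ultimately show ?thesis by linarith
  qed
  define \<phi> where "\<phi> z = (circle_mean f r z - circle_mean f s z) / I" for z
  have cm: "circle_mean f \<rho> \<in> borel_measurable borel" "\<bar>circle_mean f \<rho> z\<bar> \<le> B"
    "\<rho> \<ge> 0 \<Longrightarrow> cmod z > A0 + \<rho> \<Longrightarrow> circle_mean f \<rho> z = 0"
    "\<rho> > 0 \<Longrightarrow> (\<integral>z. ln (cmod (z - w)) * circle_mean f \<rho> z \<partial>lborel) = (\<integral>c. f c * ln (max \<rho> (cmod (w - c))) \<partial>lborel)"
    for \<rho> :: real and z w :: complex
    using circle_mean_measurable[OF fm B supp0 A0, where \<rho>=\<rho>] circle_mean_bound[OF fm B supp0 A0, where \<rho>=\<rho> and z=z]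
      circle_mean_support[OF fm B supp0 A0, where \<rho>=\<rho> and z=z] integral_ln_dist_circle_mean[OF fm B supp0 A0, where \<rho>=\<rho> and w=w]
    by auto
  have f_int: "integrable lborel (\<lambda>c. f c * g c)" if "g \<in> borel_measurable borel" "\<And>c. cmod c \<le> A0 \<Longrightarrow> \<bar>g c\<bar> \<le> G" for g :: "complex \<Rightarrow> real" and G
  proof (rule integrableI_bounded_set[where A="cball 0 A0" and B="B * G"])
    show "AE c in lborel. c \<in> cball 0 A0 \<longrightarrow> norm (f c * g c) \<le> B * G"
      using B that B_nn by (auto simp: abs_mult intro!: mult_mono)
    show "AE c in lborel. c \<notin> cball 0 A0 \<longrightarrow> f c * g c = 0" using supp0 by auto
  qed (use that in \<open>auto simp: emeasure_cball_complex A0_def\<close>)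
  have ln_int: "integrable lborel (\<lambda>c. f c * ln (max \<rho> (cmod (w - c))))" if "\<rho> > 0" for \<rho> w
  proof (rule f_int)
    fix c assume "cmod c \<le> A0"
    then have *: "max \<rho> (cmod (w - c)) \<le> \<rho> + cmod w + A0" using that norm_triangle_ineq4[of w c] A0_def by auto
    have "ln \<rho> \<le> ln (max \<rho> (cmod (w - c)))" using that by (subst ln_le_cancel_iff) auto
    moreover have "ln (max \<rho> (cmod (w - c))) \<le> ln (\<rho> + cmod w + A0)"
      using that * A0 norm_ge_zero[of w] by (subst ln_le_cancel_iff) linarith+
    ultimately show "\<bar>ln (max \<rho> (cmod (w - c)))\<bar> \<le> \<bar>ln \<rho>\<bar> + \<bar>ln (\<rho> + cmod w + A0)\<bar>" by linarith
  qed auto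
  have cm_int: "integrable lborel (\<lambda>z. ln (cmod (z - w)) * circle_mean f \<rho> z)" if "\<rho> > 0" for \<rho> w
    by (rule integrable_ln_dist_mult[of _ B "A0 + \<rho>"]) (use cm(1-3) that A0 in auto)
  have pot: "(\<integral>z. ln (cmod (z - w)) * \<phi> z \<partial>lborel) = (\<integral>c. f c * t (w - c) \<partial>lborel) / I" for w
  proof -
    have "(\<integral>z. ln (cmod (z - w)) * \<phi> z \<partial>lborel) =
       (\<integral>z. (ln (cmod (z - w)) * circle_mean f r z - ln (cmod (z - w)) * circle_mean f s z) / I \<partial>lborel)"
      by (simp add: \<phi>_def algebra_simps)
    also have "\<dots> = ((\<integral>c. f c * ln (max r (cmod (w - c))) \<partial>lborel) - (\<integral>c. f c * ln (max s (cmod (w - c))) \<partial>lborel)) / I"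
      using cm_int r s by (simp add: cm(4))
    also have "\<dots> = (\<integral>c. f c * t (w - c) \<partial>lborel) / I"
      using ln_int r s by (simp add: t_def right_diff_distrib)
    finally show ?thesis .
  qed
  have ft_int: "integrable lborel (\<lambda>c. f c * t (w - c))" for w
    by (rule f_int[where G="ln 2"]) (use t_nn t_le in auto)
  show ?thesis
  proof (rule that[of \<phi> "(2 * B) / I" "A0 + r"])
    show "\<phi> \<in> borel_measurable borel" unfolding \<phi>_def using cm(1) by measurable
    show "\<bar>\<phi> z\<bar> \<le> 2 * B / I" for z
      unfolding \<phi>_def using cm(2)[of r z] cm(2)[of s z] I_pos by (simp add: divide_right_mono abs_divide)
    show "\<phi> z = 0" if "cmod z > A0 + r" for z
      using that cm(3)[of r z] cm(3)[of s z] r s by (simp add: \<phi>_def)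
    show "A0 + r \<ge> 0" using r by (simp add: A0_def)
    fix w
    \<comment> \<open>The normalised bump has mass 1 and vanishes for |w - c| >= r, so the error
      averages \<open>f w - f c\<close> over points where \<open>f\<close> varies by less than
      \<epsilon>.\<close>
    have "f w = (\<integral>c. f w * t (w - c) \<partial>lborel) / I"
      using I_pos I_eq by simp
    then have "f w - (\<integral>z. ln (cmod (z - w)) * \<phi> z \<partial>lborel) = ((\<integral>c. f w * t (w - c) \<partial>lborel) - (\<integral>c. f c * t (w - c) \<partial>lborel)) / I"
      unfolding pot by (metis diff_divide_distrib)
    also have "(\<integral>c. f w * t (w - c) \<partial>lborel) - (\<integral>c. f c * t (w - c) \<partial>lborel) = (\<integral>c. (f w - f c) * t (w - c) \<partial>lborel)"
      using t_int ft_int by (simp add: left_diff_distrib)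
    finally have eq: "f w - (\<integral>z. ln (cmod (z - w)) * \<phi> z \<partial>lborel) = (\<integral>c. (f w - f c) * t (w - c) \<partial>lborel) / I" .
    have "\<bar>\<integral>c. (f w - f c) * t (w - c) \<partial>lborel\<bar> \<le> (\<integral>c. \<epsilon> * t (w - c) \<partial>lborel)"
    proof (rule integral_abs_bound_integral)
      show "integrable lborel (\<lambda>c. (f w - f c) * t (w - c))"
        using t_int ft_int by (simp add: left_diff_distrib)
      show "\<bar>(f w - f c) * t (w - c)\<bar> \<le> \<epsilon> * t (w - c)" for c
      proof (cases "dist w c < r")
        case True
        then show ?thesis using r(2)[of w c] t_nn[of "w - c"] by (simp add: abs_mult mult_right_mono)
      next
        case False
        then show ?thesis by (simp add: t_supp dist_norm)
      qed
    qed (use t_int in simp)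
    also have "\<dots> = \<epsilon> * I" by (simp add: I_eq)
    finally show "\<bar>f w - (\<integral>z. ln (cmod (z - w)) * \<phi> z \<partial>lborel)\<bar> \<le> \<epsilon>"
      unfolding eq using I_pos by (simp add: abs_divide divide_simps)
  qed
qed


section \<open>Two-valued sequences: strong law and small balls\<close>

locale two_valued_sequence = prob_space M for M :: "'w measure" +
  fixes a b :: "nat \<Rightarrow> complex" and \<xi> :: "nat \<Rightarrow> 'w \<Rightarrow> complex"
  assumes meas: "\<And>k. k \<ge> 1 \<Longrightarrow> \<xi> k \<in> borel_measurable M"
    and indep: "indep_vars (\<lambda>_. borel) \<xi> {1..}"
    and distr_neq: "\<And>k. k \<ge> 1 \<Longrightarrow> a k \<noteq> b k \<Longrightarrow>
        measure M {\<omega>\<in>space M. \<xi> k \<omega> = a k} = 1/2 \<and>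
        measure M {\<omega>\<in>space M. \<xi> k \<omega> = b k} = 1/2"
    and distr_eq: "\<And>k. k \<ge> 1 \<Longrightarrow> a k = b k \<Longrightarrow>
        measure M {\<omega>\<in>space M. \<xi> k \<omega> = a k} = 1"
begin

lemma AE_two_valued: "AE \<omega> in M. \<forall>k\<ge>1. \<xi> k \<omega> = a k \<or> \<xi> k \<omega> = b k"
proof -
  have "AE \<omega> in M. k \<ge> 1 \<longrightarrow> \<xi> k \<omega> = a k \<or> \<xi> k \<omega> = b k" for k
  proof (cases "k \<ge> 1")
    case True
    note [measurable] = meas[OF True]
    have "prob {\<omega>\<in>space M. \<xi> k \<omega> = a k \<or> \<xi> k \<omega> = b k} = 1"
    proof (cases "a k = b k")
      case False
      have "{\<omega>\<in>space M. \<xi> k \<omega> = a k \<or> \<xi> k \<omega> = b k} =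
        {\<omega>\<in>space M. \<xi> k \<omega> = a k} \<union> {\<omega>\<in>space M. \<xi> k \<omega> = b k}" by auto
      also have "prob \<dots> = prob {\<omega>\<in>space M. \<xi> k \<omega> = a k} + prob {\<omega>\<in>space M. \<xi> k \<omega> = b k}"
        by (rule finite_measure_Union) (use False in auto)
      finally show ?thesis using distr_neq[OF True False] by simp
    qed (use distr_eq[OF True] in simp)
    then have "AE \<omega> in M. \<omega> \<in> {\<omega>\<in>space M. \<xi> k \<omega> = a k \<or> \<xi> k \<omega> = b k}"
      by (subst (asm) prob_eq_1) auto
    then show ?thesis by eventually_elim auto
  qed auto
  then show ?thesis by (subst AE_all_countable) simp
qed

lemma AE_two_valued_at: "k \<ge> 1 \<Longrightarrow> AE \<omega> in M. \<xi> k \<omega> = a k \<or> \<xi> k \<omega> = b k"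
  using AE_two_valued by eventually_elim auto

lemma expectation_two_valued:
  fixes g :: "complex \<Rightarrow> real"
  assumes k: "k \<ge> 1" and [measurable]: "g \<in> borel_measurable borel"
  shows "expectation (\<lambda>\<omega>. g (\<xi> k \<omega>)) = (g (a k) + g (b k)) / 2"
proof (cases "a k = b k")
  case True
  note [measurable] = meas[OF k]
  have "expectation (\<lambda>\<omega>. g (\<xi> k \<omega>)) = expectation (\<lambda>\<omega>. g (a k))"
    by (rule integral_cong_AE) (use AE_two_valued_at[OF k] True in \<open>auto elim: eventually_mono\<close>)
  then show ?thesis using True by (simp add: prob_space)
next
  case False
  note [measurable] = meas[OF k]
  let ?A = "{\<omega>\<in>space M. \<xi> k \<omega> = a k}" and ?B = "{\<omega>\<in>space M. \<xi> k \<omega> = b k}"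
  have [simp]: "integrable M (indicat_real {\<omega>\<in>space M. \<xi> k \<omega> = c})" for c
    by (rule integrable_real_indicator) (auto simp: emeasure_eq_measure)
  have "expectation (\<lambda>\<omega>. g (\<xi> k \<omega>)) = expectation (\<lambda>\<omega>. g (a k) * indicator ?A \<omega> + g (b k) * indicator ?B \<omega>)"
  proof (rule integral_cong_AE)
    show "AE \<omega> in M. g (\<xi> k \<omega>) = g (a k) * indicator ?A \<omega> + g (b k) * indicator ?B \<omega>"
      using AE_two_valued_at[OF k] AE_space
      by eventually_elim (use False in \<open>auto simp: indicator_def\<close>)
  qed measurable
  also have "\<dots> = g (a k) * prob ?A + g (b k) * prob ?B"
    by (subst Bochner_Integration.integral_add) auto
  finally show ?thesis using distr_neq[OF k False] by simp
qed

text \<open>Hoeffding's inequality bounds the deviation probabilities by a geometric sequence, so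
  Borel-Cantelli applies for each tolerance, and the countably many tolerances
  \<open>1 / real (Suc m)\<close> suffice.\<close>

lemma strong_law_bounded:
  fixes g :: "complex \<Rightarrow> real"
  assumes g [measurable]: "g \<in> borel_measurable borel" and bound: "\<And>z. \<bar>g z\<bar> \<le> C"
  shows "AE \<omega> in M. (\<lambda>n. ((\<Sum>k=1..n. g (\<xi> k \<omega>)) - (\<Sum>k=1..n. (g (a k) + g (b k)) / 2)) / real n) \<longlonglongrightarrow> 0"
proof -
  define Y where "Y n \<omega> = (\<Sum>k=1..n. g (\<xi> k \<omega>)) - (\<Sum>k=1..n. (g (a k) + g (b k)) / 2)" for n \<omega>
  have Ym [measurable]: "Y n \<in> borel_measurable M" for n
    unfolding Y_def using meas by measurable
  \<comment> \<open>The added 1 gives the Hoeffding interval from \<open>- C'\<close> to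
    \<open>C'\<close> positive length.\<close>
  define C' where "C' = \<bar>C\<bar> + 1"
  have C': "C' > 0" "\<bar>g z\<bar> \<le> C'" for z using bound[of z] by (auto simp: C'_def)
  have ev: "AE \<omega> in M. eventually (\<lambda>n. \<bar>Y n \<omega>\<bar> < real n * e) sequentially" if e: "e > 0" for e
  proof -
    \<comment> \<open>Hoeffding's exponent 2 (n e)^2 / (n (2 C')^2) equals n e^2 / (2 C'^2), so the
      tail is 2 q^n.\<close>
    define q where "q = exp (- (e\<^sup>2 / (2 * C'\<^sup>2)))"
    have q: "0 < q" "q < 1" using e C' by (auto simp: q_def)
    have le: "prob {\<omega>\<in>space M. \<bar>Y n \<omega>\<bar> \<ge> real n * e} \<le> 2 * q ^ n" if n: "n \<ge> 1" for n
    proof -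
      interpret H: Hoeffding_ineq M "{1..n}" "\<lambda>k \<omega>. g (\<xi> k \<omega>)" "\<lambda>_. - C'" "\<lambda>_. C'"
        "\<Sum>k=1..n. expectation (\<lambda>\<omega>. g (\<xi> k \<omega>))"
      proof unfold_locales
        show "indep_vars (\<lambda>_. borel) (\<lambda>k \<omega>. g (\<xi> k \<omega>)) {1..n}"
          by (rule indep_vars_compose2[OF indep_vars_subset[OF indep]]) auto
        show "AE \<omega> in M. g (\<xi> k \<omega>) \<in> {- C'..C'}" for k
          using C'(2) by (auto simp: abs_le_iff intro!: AE_I2) (meson minus_le_iff)
      qed auto
      have exps: "(\<Sum>k=1..n. expectation (\<lambda>\<omega>. g (\<xi> k \<omega>))) = (\<Sum>k=1..n. (g (a k) + g (b k)) / 2)"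
        by (intro sum.cong refl expectation_two_valued) auto
      have "prob {\<omega>\<in>space M. \<bar>Y n \<omega>\<bar> \<ge> real n * e} \<le> 2 * exp (- 2 * (real n * e)\<^sup>2 / (\<Sum>i\<in>{1..n}. (C' - - C')\<^sup>2))"
        unfolding Y_def exps[symmetric]
        by (rule H.Hoeffding_ineq_abs_ge) (use e n C' in auto)
      also have "- 2 * (real n * e)\<^sup>2 / (\<Sum>i\<in>{1..n}. (C' - - C')\<^sup>2) = real n * (- (e\<^sup>2 / (2 * C'\<^sup>2)))"
        using n C' by (simp add: field_simps power2_eq_square)
      also have "exp \<dots> = q ^ n" unfolding q_def by (rule exp_of_nat_mult)
      finally show ?thesis .
    qed
    have "AE \<omega> in M. eventually (\<lambda>n. \<omega> \<in> space M - {\<omega>\<in>space M. \<bar>Y n \<omega>\<bar> \<ge> real n * e}) sequentially"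
    proof (rule borel_cantelli_AE1)
      show "summable (\<lambda>n. prob {\<omega>\<in>space M. \<bar>Y n \<omega>\<bar> \<ge> real n * e})"
      proof (rule summable_comparison_test')
        show "summable (\<lambda>n. 2 * q ^ n)" using q by (intro summable_mult summable_geometric) auto
        show "norm (prob {\<omega>\<in>space M. \<bar>Y n \<omega>\<bar> \<ge> real n * e}) \<le> 2 * q ^ n" if "n \<ge> 1" for n
          using le[OF that] by simp
      qed
    qed (auto simp: emeasure_eq_measure)
    then show ?thesis
      by (rule eventually_mono) (auto elim!: eventually_mono)
  qed
  have "AE \<omega> in M. \<forall>m. eventually (\<lambda>n. \<bar>Y n \<omega>\<bar> < real n * (1 / real (Suc m))) sequentially"
    by (subst AE_all_countable) (intro allI ev, simp)
  then show ?thesis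
  proof eventually_elim
    case (elim \<omega>)
    show ?case unfolding Y_def[symmetric]
    proof (rule tendstoI)
      fix e :: real assume "e > 0"
      then obtain m where m: "1 / real (Suc m) < e" using nat_approx_posE by blast
      from elim[rule_format, of m] eventually_gt_at_top[of 0]
      show "eventually (\<lambda>n. dist (Y n \<omega> / real n) 0 < e) sequentially"
      proof eventually_elim
        case (elim n)
        then have "\<bar>Y n \<omega>\<bar> / real n < 1 / real (Suc m)" by (simp add: divide_simps mult.commute)
        then show ?case using m by (simp add: abs_divide)
      qed
    qed
  qed
qed

text \<open>Induction on \<open>n\<close>, splitting by the value of the last variable, which is
  independent of the partial sum.\<close>

lemma prob_sum_mem:
  fixes h :: "complex \<Rightarrow> complex"
  assumes [measurable]: "h \<in> borel_measurable borel" and "A \<in> sets borel"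
  shows "prob {\<omega>\<in>space M. (\<Sum>k=1..n. h (\<xi> k \<omega>)) \<in> A} = two_point_law (\<lambda>k. h (a k)) (\<lambda>k. h (b k)) n A"
  using assms(2)
proof (induction n arbitrary: A)
  case 0
  then show ?case by (auto simp: indicator_def prob_space)
next
  case (Suc n)
  note [measurable] = Suc.prems
  define S where "S \<omega> = (\<Sum>k=1..n. h (\<xi> k \<omega>))" for \<omega>
  have [measurable]: "\<xi> (Suc n) \<in> borel_measurable M" by (rule meas) simp
  have Sm [measurable]: "S \<in> borel_measurable M" unfolding S_def using meas by measurable
  have tr [measurable]: "{s. s + c \<in> A} \<in> sets borel" for c :: complex
    by measurable
  have IH: "prob {\<omega>\<in>space M. S \<omega> + c \<in> A} = two_point_law (\<lambda>k. h (a k)) (\<lambda>k. h (b k)) n {s. s + c \<in> A}" for c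
    using Suc.IH[OF tr, of c] by (simp add: S_def)
  have sum: "(\<Sum>k=1..Suc n. h (\<xi> k \<omega>)) = S \<omega> + h (\<xi> (Suc n) \<omega>)" for \<omega> by (simp add: S_def)
  have ae: "AE \<omega> in M. \<xi> (Suc n) \<omega> = a (Suc n) \<or> \<xi> (Suc n) \<omega> = b (Suc n)"
    by (rule AE_two_valued_at) simp
  show ?case
  \<comment> \<open>When the two values coincide, the events for \<open>a\<close> and
    \<open>b\<close> are the same and their probabilities must not be added; both halves of the
    recursion then agree.\<close>
  proof (cases "a (Suc n) = b (Suc n)")
    case True
    have "prob {\<omega>\<in>space M. (\<Sum>k=1..Suc n. h (\<xi> k \<omega>)) \<in> A} = prob {\<omega>\<in>space M. S \<omega> + h (a (Suc n)) \<in> A}"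
      unfolding sum by (rule finite_measure_eq_AE) (use ae True in \<open>auto elim!: eventually_mono\<close>)
    then show ?thesis using IH True by (simp only: two_point_law.simps) simp
  next
    case False
    have ind: "indep_var borel (\<xi> (Suc n)) borel S"
    proof -
      have "indep_var borel ((\<lambda>f. f (Suc n)) \<circ> (\<lambda>\<omega>. restrict (\<lambda>i. \<xi> i \<omega>) {Suc n}))
        borel ((\<lambda>f. \<Sum>i=1..n. h (f i)) \<circ> (\<lambda>\<omega>. restrict (\<lambda>i. \<xi> i \<omega>) {1..n}))"
        by (intro indep_var_compose[OF indep_var_restrict[OF indep]]) auto
      also have "((\<lambda>f. f (Suc n)) \<circ> (\<lambda>\<omega>. restrict (\<lambda>i. \<xi> i \<omega>) {Suc n})) = \<xi> (Suc n)" by auto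
      also have "((\<lambda>f. \<Sum>i=1..n. h (f i)) \<circ> (\<lambda>\<omega>. restrict (\<lambda>i. \<xi> i \<omega>) {1..n})) = S" by (auto simp: S_def)
      finally show ?thesis .
    qed
    have prod: "prob {\<omega>\<in>space M. \<xi> (Suc n) \<omega> = c \<and> S \<omega> + d \<in> A} =
        prob {\<omega>\<in>space M. \<xi> (Suc n) \<omega> = c} * prob {\<omega>\<in>space M. S \<omega> + d \<in> A}" for c d
    proof -
      have "prob ((\<lambda>\<omega>. (\<xi> (Suc n) \<omega>, S \<omega>)) -` ({c} \<times> {s. s + d \<in> A}) \<inter> space M) =
        prob (\<xi> (Suc n) -` {c} \<inter> space M) * prob (S -` {s. s + d \<in> A} \<inter> space M)"
        by (rule indep_varD[OF ind]) auto
      then show ?thesis by (simp add: vimage_def Int_def conj_commute)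
    qed
    let ?A = "{\<omega>\<in>space M. \<xi> (Suc n) \<omega> = a (Suc n) \<and> S \<omega> + h (a (Suc n)) \<in> A}"
    let ?B = "{\<omega>\<in>space M. \<xi> (Suc n) \<omega> = b (Suc n) \<and> S \<omega> + h (b (Suc n)) \<in> A}"
    have "prob {\<omega>\<in>space M. (\<Sum>k=1..Suc n. h (\<xi> k \<omega>)) \<in> A} = prob (?A \<union> ?B)"
      unfolding sum by (rule finite_measure_eq_AE) (use ae in \<open>auto elim!: eventually_mono\<close>)
    also have "\<dots> = prob ?A + prob ?B"
      by (rule finite_measure_Union) (use False in auto)
    finally show ?thesis
      unfolding prod IH using distr_neq[of "Suc n"] False by simp
  qed
qed

text \<open>Since x \<mapsto> 1 / (z - x) is injective off \<open>z\<close>, infinitely many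
  summands remain nondegenerate. Of the radii \<open>exp (- real n * e)\<close> it only matters that
  they tend to 0.\<close>

lemma prob_sum_inverse_small_tendsto_0:
  assumes inf: "infinite {k. k \<ge> 1 \<and> a k \<noteq> b k}"
    and z: "\<And>k. k \<ge> 1 \<Longrightarrow> z \<noteq> a k \<and> z \<noteq> b k" and e: "e > 0"
  shows "(\<lambda>n. prob {\<omega>\<in>space M. cmod (\<Sum>k=1..n. 1 / (z - \<xi> k \<omega>)) < exp (- real n * e)}) \<longlonglongrightarrow> 0"
proof -
  have "{k. k \<ge> 1 \<and> 1 / (z - a k) \<noteq> 1 / (z - b k)} = {k. k \<ge> 1 \<and> a k \<noteq> b k}"
    using z by (auto simp: field_simps)
  then have "(\<lambda>n. two_point_law (\<lambda>k. 1 / (z - a k)) (\<lambda>k. 1 / (z - b k)) n (ball 0 (exp (- real n * e)))) \<longlonglongrightarrow> 0"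
    using inf e by (intro law_shrinking_ball_tendsto_0) (auto, real_asymp)
  moreover have "prob {\<omega>\<in>space M. cmod (\<Sum>k=1..n. 1 / (z - \<xi> k \<omega>)) < exp (- real n * e)} =
     two_point_law (\<lambda>k. 1 / (z - a k)) (\<lambda>k. 1 / (z - b k)) n (ball 0 (exp (- real n * e)))" for n
    using prob_sum_mem[of "\<lambda>x. 1 / (z - x)" "ball 0 (exp (- real n * e))" n] by simp
  ultimately show ?thesis by simp
qed

end

section \<open>Smooth test functions\<close>

text \<open>The classical flat function exp(-1/t), divided by powers of \<open>t\<close> so that the
  family is closed under differentiation up to linear combinations.\<close>

definition flat_exp :: "nat \<Rightarrow> real \<Rightarrow> real" where
  "flat_exp m t = (if t > 0 then exp (- 1 / t) / t ^ m else 0)"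

lemma flat_exp_nonneg: "flat_exp m t \<ge> 0"
  by (simp add: flat_exp_def)

lemma flat_exp_0_le_1: "flat_exp 0 t \<le> 1"
  by (simp add: flat_exp_def)

lemma power_div_fact_le_exp:
  fixes x :: real
  assumes "x \<ge> 0"
  shows "x ^ n / fact n \<le> exp x"
proof -
  have "(\<Sum>k\<in>{n}. x ^ k / fact k) \<le> (\<Sum>k. x ^ k / fact k)"
    by (rule sum_le_suminf) (use assms summable_exp[of x] in \<open>auto simp: divide_inverse mult.commute\<close>)
  also have "\<dots> = exp x" by (simp add: exp_def scaleR_conv_of_real divide_inverse mult.commute)
  finally show ?thesis by simp
qed

text \<open>One term of the exponential series at \<open>1 / t\<close>, of order
  \<open>m + 2\<close>, beats the factor \<open>t ^ m\<close> and leaves a square; this makes the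
  derivative at 0 vanish.\<close>

lemma flat_exp_le_square: "flat_exp m t \<le> fact (m + 2) * t\<^sup>2"
proof (cases "t > 0")
  case True
  have "(1 / t) ^ (m + 2) / fact (m + 2) \<le> exp (1 / t)"
    by (rule power_div_fact_le_exp) (use True in simp)
  then have "1 \<le> exp (1 / t) * fact (m + 2) * t ^ (m + 2)"
    using True by (simp add: power_divide divide_simps split: if_splits) (simp add: mult_ac)
  then show ?thesis
    using True by (simp add: flat_exp_def exp_minus power_add field_simps power2_eq_square)
qed (simp add: flat_exp_def)

lemma flat_exp_deriv:
  "(flat_exp m has_real_derivative flat_exp (m + 2) t - real m * flat_exp (m + 1) t) (at t)"
proof -
  consider "t > 0" | "t < 0" | "t = 0" by linarith
  then show ?thesis
  proof cases
    case 1
    have "((\<lambda>t. exp (- 1 / t) * inverse (t ^ m)) has_real_derivative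
        exp (- 1 / t) / t ^ (m + 2) - real m * (exp (- 1 / t) / t ^ (m + 1))) (at t)"
      by (rule derivative_eq_intros refl | use 1 in force)+
         (use 1 in \<open>cases m; simp add: field_simps power2_eq_square\<close>)
    then show ?thesis
      using 1 by (rule_tac DERIV_cong[OF has_field_derivative_transform_within_open[where S="{0<..}"]])
        (auto simp: flat_exp_def divide_inverse)
  next
    case 2
    have "(flat_exp m has_real_derivative 0) (at t)"
      by (rule has_field_derivative_transform_within_open[where S="{..<0}" and f="\<lambda>_. 0"])
        (use 2 in \<open>auto simp: flat_exp_def\<close>)
    then show ?thesis using 2 by (simp add: flat_exp_def)
  next
    case 3
    have flat_exp_at_0: "flat_exp m 0 = 0" by (simp add: flat_exp_def)
    have "((\<lambda>h. flat_exp m h / h) \<longlongrightarrow> 0) (at 0)"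
    proof (rule Lim_null_comparison)
      show "eventually (\<lambda>h. norm (flat_exp m h / h) \<le> fact (m + 2) * \<bar>h\<bar>) (at 0)"
        unfolding eventually_at_filter
      proof (rule always_eventually, intro allI impI)
        fix h :: real assume "h \<noteq> 0"
        then show "norm (flat_exp m h / h) \<le> fact (m + 2) * \<bar>h\<bar>"
          using flat_exp_le_square[of m h] flat_exp_nonneg[of m h]
          by (simp add: abs_divide divide_le_eq power2_eq_square mult.assoc)
      qed
      show "((\<lambda>h. fact (m + 2) * \<bar>h\<bar>) \<longlongrightarrow> 0) (at (0::real))"
        by (rule tendsto_eq_intros refl | simp)+
    qed
    then have "(flat_exp m has_real_derivative 0) (at 0)"
      using flat_exp_at_0 by (simp add: DERIV_def)
    then show ?thesis using 3 by (simp add: flat_exp_def)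
  qed
qed

lemma flat_exp_continuous [continuous_intros]:
  "continuous_on S f \<Longrightarrow> continuous_on S (\<lambda>x. flat_exp m (f x))"
  by (rule continuous_on_compose2[of UNIV "flat_exp m"])
     (auto intro!: continuous_at_imp_continuous_on DERIV_isCont flat_exp_deriv)

definition flat_monomial :: "real \<Rightarrow> nat \<Rightarrow> nat \<Rightarrow> nat \<Rightarrow> complex \<Rightarrow> real" where
  "flat_monomial s i j m z = Re z ^ i * Im z ^ j * flat_exp m (s - (Re z)\<^sup>2 - (Im z)\<^sup>2)"

text \<open>A class of test functions rich and concrete enough: it lies in \<open>Cc_inf\<close>, is
  uniformly dense among compactly supported continuous functions once \<open>s\<close> ranges over
  the naturals, and then has only countably many generators, so that almost sure statements can be
  collected.\<close>

inductive flat_span :: "real \<Rightarrow> (complex \<Rightarrow> real) \<Rightarrow> bool" for s where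
  flat_monomial: "flat_span s (flat_monomial s i j m)"
| add: "flat_span s f \<Longrightarrow> flat_span s g \<Longrightarrow> flat_span s (\<lambda>z. f z + g z)"
| scale: "flat_span s f \<Longrightarrow> flat_span s (\<lambda>z. c * f z)"

lemma flat_span_continuous: "flat_span s f \<Longrightarrow> continuous_on UNIV f"
  by (induction rule: flat_span.induct)
     (auto simp: flat_monomial_def[abs_def] intro!: continuous_intros)

lemma flat_span_support: "flat_span s f \<Longrightarrow> (cmod z)\<^sup>2 \<ge> s \<Longrightarrow> f z = 0"
  by (induction rule: flat_span.induct) (auto simp: flat_monomial_def flat_exp_def cmod_power2)

lemma flat_span_deriv:
  assumes "flat_span s f" "v \<in> {1, \<i>}"
  shows "\<exists>g. flat_span s g \<and> (\<forall>z. ((\<lambda>t. f (z + complex_of_real t * v)) has_real_derivative g z) (at 0))"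
  using assms(1)
proof (induction rule: flat_span.induct)
  case (flat_monomial i j m)
  let ?G = "flat_monomial s"
  have d: "((\<lambda>t. flat_exp m (q t)) has_real_derivative
      (flat_exp (m + 2) (q 0) - real m * flat_exp (m + 1) (q 0)) * q') (at 0)"
    if "(q has_real_derivative q') (at 0)" for q q'
    using DERIV_chain2[OF flat_exp_deriv[of m "q 0"] that] by simp
  show ?case
  proof (cases "v = 1")
    case True
    \<comment> \<open>The product rule with inner derivative \<open>- 2 * Re z\<close>. For
      \<open>i = 0\<close> the truncated exponent \<open>i - 1\<close> does no harm, since its
      coefficient is 0.\<close>
    let ?g = "\<lambda>z. (real i * ?G (i - 1) j m z + (- 2) * ?G (i + 1) j (m + 2) z) + (2 * real m) * ?G (i + 1) j (m + 1) z"
    have "((\<lambda>t. ?G i j m (z + complex_of_real t * v)) has_real_derivative ?g z) (at 0)" for z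
      unfolding flat_monomial_def True
      by (rule derivative_eq_intros d refl)+ (auto simp: algebra_simps power2_eq_square)
    then show ?thesis by (intro exI[of _ ?g] conjI flat_span.intros allI)
  next
    case False
    then have v: "v = \<i>" using assms by simp
    let ?g = "\<lambda>z. (real j * ?G i (j - 1) m z + (- 2) * ?G i (j + 1) (m + 2) z) + (2 * real m) * ?G i (j + 1) (m + 1) z"
    have "((\<lambda>t. ?G i j m (z + complex_of_real t * v)) has_real_derivative ?g z) (at 0)" for z
      unfolding flat_monomial_def v
      by (rule derivative_eq_intros d refl)+ (auto simp: algebra_simps power2_eq_square)
    then show ?thesis by (intro exI[of _ ?g] conjI flat_span.intros allI)
  qed
next
  case (add f g)
  then obtain f' g' where "flat_span s f'" "flat_span s g'"
    "\<And>z. ((\<lambda>t. f (z + complex_of_real t * v)) has_real_derivative f' z) (at 0)"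
    "\<And>z. ((\<lambda>t. g (z + complex_of_real t * v)) has_real_derivative g' z) (at 0)" by blast
  then show ?case
    by (intro exI[of _ "\<lambda>z. f' z + g' z"] conjI flat_span.add) (auto intro: DERIV_add)
next
  case (scale f c)
  then obtain f' where "flat_span s f'"
    "\<And>z. ((\<lambda>t. f (z + complex_of_real t * v)) has_real_derivative f' z) (at 0)" by blast
  then show ?case
    by (intro exI[of _ "\<lambda>z. c * f' z"] conjI flat_span.scale) (auto intro: DERIV_cmult)
qed

lemma flat_span_Cc_inf:
  assumes "flat_span s f"
  shows "Cc_inf f"
proof -
  have "f \<in> Ck k" for k
    using assms
  proof (induction k arbitrary: f)
    case 0
    then show ?case by (simp add: flat_span_continuous)
  next
    case (Suc k)
    have "\<exists>g\<in>Ck k. \<forall>z. ((\<lambda>t. f (z + complex_of_real t * v)) has_real_derivative g z) (at 0)"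
      if "v \<in> {1, \<i>}" for v
      using flat_span_deriv[OF Suc.prems that] Suc.IH by blast
    then show ?case
      unfolding Ck.simps by (intro CollectI conjI ballI flat_span_continuous[OF Suc.prems])
  qed
  moreover have "compact (closure {z. f z \<noteq> 0})"
  proof -
    have "{z. f z \<noteq> 0} \<subseteq> cball 0 (sqrt \<bar>s\<bar>)"
    proof
      fix z assume "z \<in> {z. f z \<noteq> 0}"
      then have "(cmod z)\<^sup>2 < s" using flat_span_support[OF assms] by (meson mem_Collect_eq not_le)
      then have "cmod z \<le> sqrt \<bar>s\<bar>" by (intro real_le_rsqrt) simp
      then show "z \<in> cball 0 (sqrt \<bar>s\<bar>)" by simp
    qed
    then have "bounded {z. f z \<noteq> 0}" using bounded_cball bounded_subset by blast
    then show ?thesis by (simp add: compact_closure)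
  qed
  ultimately show ?thesis by (simp add: Cc_inf_def smooth_c_def)
qed

text \<open>A real linear functional on the plane is a combination of \<open>Re\<close> and
  \<open>Im\<close>, and multiplying a generator by either only raises an exponent.\<close>

lemma flat_span_mult_polynomial:
  assumes "real_polynomial_function p" "flat_span s g"
  shows "flat_span s (\<lambda>z. p z * g z)"
  using assms
proof (induction arbitrary: g rule: real_polynomial_function.induct)
  case (linear p)
  have x: "flat_span s (\<lambda>z. Re z * g z) \<and> flat_span s (\<lambda>z. Im z * g z)"
    using linear.prems
  proof (induction rule: flat_span.induct)
    case (flat_monomial i j m)
    have "(\<lambda>z. Re z * flat_monomial s i j m z) = flat_monomial s (Suc i) j m"
      "(\<lambda>z. Im z * flat_monomial s i j m z) = flat_monomial s i (Suc j) m"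
      by (auto simp: flat_monomial_def fun_eq_iff)
    then show ?case by (simp add: flat_span.flat_monomial)
  next
    case (add f g)
    then show ?case by (auto simp: distrib_left intro: flat_span.add)
  next
    case (scale f c)
    then show ?case by (auto simp: mult.left_commute[of _ c] intro: flat_span.scale)
  qed
  interpret bounded_linear p by fact
  have pz: "p z = p 1 * Re z + p \<i> * Im z" for z
  proof -
    have "z = Re z *\<^sub>R 1 + Im z *\<^sub>R \<i>" by (simp add: complex_eq_iff)
    then have "p z = Re z *\<^sub>R p 1 + Im z *\<^sub>R p \<i>" by (metis add scaleR)
    then show ?thesis by (simp add: mult.commute)
  qed
  have "(\<lambda>z. p z * g z) = (\<lambda>z. p 1 * (Re z * g z) + p \<i> * (Im z * g z))"
    by (rule ext) (subst pz, simp add: algebra_simps)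
  then show ?case using x by (auto intro!: flat_span.add flat_span.scale)
next
  case (const c)
  then show ?case by (rule flat_span.scale)
next
  case (add f h)
  then show ?case by (simp add: distrib_right flat_span.add)
next
  case (mult f h)
  then show ?case by (simp add: mult.assoc)
qed

text \<open>Divide by a bump \<open>E\<close> that is positive on a disc larger than the support,
  approximate the quotient by a polynomial with Stone-Weierstrass, and multiply back;
  \<open>E \<le> 1\<close> preserves the error. The radius \<open>N + 1\<close> is an integer, so
  that its square is a natural index.\<close>

lemma flat_span_dense:
  fixes f :: "complex \<Rightarrow> real"
  assumes cont: "continuous_on UNIV f" and supp: "\<And>z. cmod z > A \<Longrightarrow> f z = 0" and \<epsilon>: "\<epsilon> > 0"
  obtains n g where "flat_span (real n) g" "\<And>z. \<bar>f z - g z\<bar> \<le> \<epsilon>"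
proof -
  obtain N :: nat where N: "real N \<ge> A" using real_arch_simple by blast
  define s where "s = (real N + 1)\<^sup>2"
  define E where "E = flat_monomial s 0 0 0"
  have E_eq: "E z = flat_exp 0 (s - (cmod z)\<^sup>2)" for z
    by (simp add: E_def flat_monomial_def cmod_power2 diff_diff_eq)
  have E_span: "flat_span s E" unfolding E_def by (rule flat_span.flat_monomial)
  have E_pos: "E z > 0" if "cmod z < real N + 1" for z
  proof -
    have "(cmod z)\<^sup>2 < s" unfolding s_def by (rule power_strict_mono) (use that in auto)
    then show ?thesis by (simp add: E_eq flat_exp_def)
  qed
  have E_0: "E z = 0" if "cmod z \<ge> real N + 1" for z
    by (rule flat_span_support[OF E_span]) (use that in \<open>auto simp: s_def intro!: power_mono\<close>)
  define h where "h z = f z / E z" for z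
  have f_eq: "f z = h z * E z" for z
    using E_pos[of z] supp[of z] N by (cases "cmod z < real N + 1") (auto simp: h_def)
  \<comment> \<open>The quotient is continuous on two overlapping open sets: inside the disc
    \<open>E\<close> is positive, and beyond radius \<open>N\<close> the quotient is 0.\<close>
  have "continuous_on (ball 0 (real N + 1) \<union> {z. cmod z > real N}) h"
  proof (rule continuous_on_open_Un)
    show "continuous_on (ball 0 (real N + 1)) h"
      unfolding h_def using E_pos
      by (intro continuous_on_divide continuous_on_subset[OF cont] continuous_on_subset[OF flat_span_continuous[OF E_span]])
         force+
    have "continuous_on {z. cmod z > real N} h \<longleftrightarrow> continuous_on {z. cmod z > real N} (\<lambda>_. 0::real)"
      by (rule continuous_on_cong) (use supp N in \<open>auto simp: h_def\<close>)
    then show "continuous_on {z. cmod z > real N} h" by simp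
  qed (auto intro!: open_Collect_less continuous_intros)
  moreover have "ball 0 (real N + 1) \<union> {z. cmod z > real N} = UNIV" by auto
  ultimately have h_cont: "continuous_on UNIV h" by simp
  obtain p where p: "real_polynomial_function p" "\<And>z. z \<in> cball 0 (real N + 1) \<Longrightarrow> \<bar>h z - p z\<bar> < \<epsilon>"
    using Stone_Weierstrass_real_polynomial_function[OF compact_cball continuous_on_subset[OF h_cont] \<epsilon>, of 0 "real N + 1"] by auto
  have "flat_span s (\<lambda>z. p z * E z)" by (rule flat_span_mult_polynomial[OF p(1) E_span])
  moreover have "s = real ((N + 1)\<^sup>2)" by (simp add: s_def)
  moreover have "\<bar>f z - p z * E z\<bar> \<le> \<epsilon>" for z
  proof (cases "cmod z < real N + 1")
    case True
    have "\<bar>f z - p z * E z\<bar> = \<bar>h z - p z\<bar> * E z"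
      using E_pos[OF True] by (simp add: f_eq abs_mult flip: left_diff_distrib)
    also have "\<dots> \<le> \<epsilon> * 1"
      using p(2)[of z] True E_pos[OF True] flat_exp_0_le_1 by (intro mult_mono) (auto simp: E_eq)
    finally show ?thesis by simp
  next
    case False
    then show ?thesis using E_0[of z] supp[of z] N \<epsilon> by simp
  qed
  ultimately show ?thesis by (intro that[of "(N + 1)\<^sup>2"]) auto
qed

section \<open>From compactly supported to bounded continuous test functions\<close>

lemma bounded_compact_support:
  fixes f :: "complex \<Rightarrow> real"
  assumes "continuous_on UNIV f" "\<And>z. cmod z > A \<Longrightarrow> f z = 0"
  obtains B where "B \<ge> 0" "\<And>z. \<bar>f z\<bar> \<le> B"
proof -
  have "bounded (f ` cball 0 A)"
    by (intro compact_imp_bounded compact_continuous_image continuous_on_subset[OF assms(1)]) auto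
  then obtain B where B: "\<And>z. z \<in> cball 0 A \<Longrightarrow> \<bar>f z\<bar> \<le> B"
    by (metis bounded_iff imageI real_norm_def)
  have "\<bar>f z\<bar> \<le> max B 0" for z using B[of z] assms(2)[of z] by (cases "cmod z \<le> A") auto
  then show ?thesis by (intro that[of "max B 0"]) auto
qed

lemma flat_span_bounded:
  assumes "flat_span s g"
  shows "\<exists>B. \<forall>z. \<bar>g z\<bar> \<le> B"
proof -
  have "g z = 0" if "cmod z > sqrt \<bar>s\<bar>" for z
  proof (rule flat_span_support[OF assms])
    have "sqrt \<bar>s\<bar> \<le> cmod z" using that by simp
    then have "\<bar>s\<bar> \<le> (cmod z)\<^sup>2" by (simp add: sqrt_le_D)
    then show "s \<le> (cmod z)\<^sup>2" by simp
  qed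
  then show ?thesis using bounded_compact_support[OF flat_span_continuous[OF assms]] by metis
qed

definition cutoff :: "nat \<Rightarrow> complex \<Rightarrow> real" where
  "cutoff m z = max 0 (min 1 (real m + 1 - cmod z))"

lemma cutoff_bounds: "0 \<le> cutoff m z" "cutoff m z \<le> 1"
  by (auto simp: cutoff_def)

lemma cutoff_continuous [continuous_intros]: "continuous_on S (cutoff m)"
  unfolding cutoff_def by (intro continuous_intros)

lemma cutoff_support: "cmod z > real m + 1 \<Longrightarrow> cutoff m z = 0"
  by (auto simp: cutoff_def)

lemma cutoff_tendsto_1: "(\<lambda>m. cutoff m z) \<longlonglongrightarrow> 1"
proof (rule tendsto_eventually)
  obtain N :: nat where "cmod z \<le> real N" using real_arch_simple by blast
  then show "eventually (\<lambda>m. cutoff m z = 1) sequentially"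
    by (intro eventually_sequentiallyI[of N]) (auto simp: cutoff_def)
qed

locale borel_prob_complex = prob_space \<mu> for \<mu> :: "complex measure" +
  assumes sets_mu [measurable_cong]: "sets \<mu> = sets borel"
begin

lemma integrable_continuous_bounded:
  fixes f :: "complex \<Rightarrow> real"
  assumes "continuous_on UNIV f" "\<And>z. \<bar>f z\<bar> \<le> B"
  shows "integrable \<mu> f"
proof (rule integrable_const_bound[of _ B])
  have "f \<in> borel_measurable borel" using assms(1) by (rule borel_measurable_continuous_onI)
  then show "f \<in> borel_measurable \<mu>" using measurable_cong_sets[OF sets_mu refl] by blast
qed (use assms in auto)

lemma integral_cutoff_tendsto_1: "(\<lambda>m. \<integral>z. cutoff m z \<partial>\<mu>) \<longlonglongrightarrow> 1"
proof -
  have "(\<lambda>m. \<integral>z. cutoff m z \<partial>\<mu>) \<longlonglongrightarrow> (\<integral>z. 1 \<partial>\<mu>)"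
  proof (rule integral_dominated_convergence[where w="\<lambda>_. 1"])
    show "cutoff m \<in> borel_measurable \<mu>" for m
      using integrable_continuous_bounded[OF cutoff_continuous, of m 1] cutoff_bounds by simp
  qed (use cutoff_tendsto_1 cutoff_bounds in auto)
  then show ?thesis by (simp add: prob_space)
qed

text \<open>The tail of \<open>p\<close> is bounded by the tail of \<open>\<mu>\<close> plus the
  discrepancy of the cutoff itself, so tightness is inherited from \<open>\<mu>\<close>. Both
  \<open>p\<close> and \<open>\<mu>\<close> contribute a tail, hence \<open>2 * B\<close>. The bound
  holds for each fixed \<open>p\<close> and thus serves both pathwise and in expectation.\<close>

lemma cutoff_error_le:
  fixes f :: "complex \<Rightarrow> real" and p :: "complex pmf"
  assumes f: "continuous_on UNIV f" "\<And>z. \<bar>f z\<bar> \<le> B"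
  shows "\<bar>(\<integral>z. f z \<partial>measure_pmf p) - (\<integral>z. f z \<partial>\<mu>)\<bar> \<le>
    \<bar>(\<integral>z. f z * cutoff m z \<partial>measure_pmf p) - (\<integral>z. f z * cutoff m z \<partial>\<mu>)\<bar>
    + B * \<bar>(\<integral>z. cutoff m z \<partial>measure_pmf p) - (\<integral>z. cutoff m z \<partial>\<mu>)\<bar>
    + 2 * B * (1 - (\<integral>z. cutoff m z \<partial>\<mu>))"
proof -
  have B: "B \<ge> 0" using f(2)[of 0] by linarith
  have fc: "\<bar>f z * cutoff m z\<bar> \<le> B" for z
  proof -
    have "\<bar>f z * cutoff m z\<bar> \<le> B * 1"
      unfolding abs_mult using f(2) cutoff_bounds B by (intro mult_mono) auto
    then show ?thesis by simp
  qed
  have tail: "\<bar>(\<integral>z. f z \<partial>N) - (\<integral>z. f z * cutoff m z \<partial>N)\<bar> \<le> B * (1 - (\<integral>z. cutoff m z \<partial>N))"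
    if N: "prob_space N" "integrable N f" "integrable N (\<lambda>z. f z * cutoff m z)" "integrable N (cutoff m)" for N
  proof -
    interpret N: prob_space N by fact
    have "\<bar>(\<integral>z. f z \<partial>N) - (\<integral>z. f z * cutoff m z \<partial>N)\<bar> = \<bar>\<integral>z. f z - f z * cutoff m z \<partial>N\<bar>"
      using N by simp
    also have "\<dots> \<le> (\<integral>z. B * (1 - cutoff m z) \<partial>N)"
    proof (rule integral_abs_bound_integral)
      show "\<bar>f z - f z * cutoff m z\<bar> \<le> B * (1 - cutoff m z)" for z
      proof -
        have "f z - f z * cutoff m z = f z * (1 - cutoff m z)" by (simp add: algebra_simps)
        then show ?thesis using f(2)[of z] cutoff_bounds[of m z] by (simp add: abs_mult mult_right_mono)
      qed
    qed (use N in auto)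
    also have "\<dots> = B * (1 - (\<integral>z. cutoff m z \<partial>N))" using N by (simp add: N.prob_space)
    finally show ?thesis .
  qed
  have "\<bar>(\<integral>z. f z \<partial>measure_pmf p) - (\<integral>z. f z * cutoff m z \<partial>measure_pmf p)\<bar> \<le> B * (1 - (\<integral>z. cutoff m z \<partial>measure_pmf p))"
    using f fc cutoff_bounds
    by (intro tail prob_space_measure_pmf measure_pmf.integrable_const_bound[where B=B and f=f]
        measure_pmf.integrable_const_bound[where B=B and f="\<lambda>z. f z * cutoff m z"]
        measure_pmf.integrable_const_bound[where B=1 and f="cutoff m"]) auto
  moreover have "\<bar>(\<integral>z. f z \<partial>\<mu>) - (\<integral>z. f z * cutoff m z \<partial>\<mu>)\<bar> \<le> B * (1 - (\<integral>z. cutoff m z \<partial>\<mu>))"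
    using f fc cutoff_bounds
    by (intro tail prob_space_axioms integrable_continuous_bounded[of f B]
        integrable_continuous_bounded[of "\<lambda>z. f z * cutoff m z" B]
        integrable_continuous_bounded[of "cutoff m" 1] continuous_intros) auto
  moreover have "B * (1 - (\<integral>z. cutoff m z \<partial>measure_pmf p)) \<le>
     B * (1 - (\<integral>z. cutoff m z \<partial>\<mu>)) + B * \<bar>(\<integral>z. cutoff m z \<partial>measure_pmf p) - (\<integral>z. cutoff m z \<partial>\<mu>)\<bar>"
    unfolding distrib_left[symmetric] using B by (intro mult_left_mono) auto
  ultimately show ?thesis by linarith
qed

text \<open>From the generators to their span by linearity, to compact support by uniform density,
  to bounded functions by cutoffs. No mass escapes because the limit is a probability
  measure.\<close>

lemma weak_conv_flat_span:
  fixes p :: "nat \<Rightarrow> complex pmf"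
  assumes conv: "\<And>s i j m. (\<lambda>n. \<integral>z. flat_monomial (real s) i j m z \<partial>measure_pmf (p n)) \<longlonglongrightarrow> (\<integral>z. flat_monomial (real s) i j m z \<partial>\<mu>)"
  shows "weak_conv_c (\<lambda>n. measure_pmf (p n)) \<mu>"
proof -
  have int: "integrable \<mu> g" "integrable (measure_pmf q) g"
    if g: "continuous_on UNIV g" "\<exists>B. \<forall>z. \<bar>g z\<bar> \<le> B" for g :: "complex \<Rightarrow> real" and q
  proof -
    obtain B where "\<And>z. \<bar>g z\<bar> \<le> B" using g(2) by blast
    then show "integrable \<mu> g" "integrable (measure_pmf q) g"
      using g(1) by (auto intro: integrable_continuous_bounded[of g B] measure_pmf.integrable_const_bound[where B=B])
  qed
  have span: "(\<lambda>n. \<integral>z. g z \<partial>measure_pmf (p n)) \<longlonglongrightarrow> (\<integral>z. g z \<partial>\<mu>)" if "flat_span (real s) g" for s g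
    using that
  proof (induction rule: flat_span.induct)
    case (flat_monomial i j m)
    show ?case by (rule conv)
  next
    case (add f g)
    have "integrable \<mu> f" "integrable (measure_pmf q) f" "integrable \<mu> g" "integrable (measure_pmf q) g" for q
      using add.hyps by (auto intro!: int flat_span_continuous flat_span_bounded)
    then show ?case using tendsto_add[OF add.IH] by simp
  next
    case (scale f c)
    then show ?case using tendsto_mult_left[OF scale.IH, of c] by simp
  qed
  have cc: "(\<lambda>n. \<integral>z. f z \<partial>measure_pmf (p n)) \<longlonglongrightarrow> (\<integral>z. f z \<partial>\<mu>)"
    if f: "continuous_on UNIV f" "\<And>z. cmod z > A \<Longrightarrow> f z = 0" for f :: "complex \<Rightarrow> real" and A
  proof (rule tendstoI)
    fix e :: real assume e: "e > 0"
    obtain s g where g: "flat_span (real s) g" "\<And>z. \<bar>f z - g z\<bar> \<le> e / 4"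
      by (rule flat_span_dense[of f A "e / 4"]) (use f e in auto)
    have fb: "\<exists>B. \<forall>z. \<bar>f z\<bar> \<le> B"
      by (rule bounded_compact_support[of f A]) (use f in auto)
    have fi: "integrable \<mu> f" "integrable (measure_pmf q) f" for q
      using int[OF f(1) fb] by auto
    have gi: "integrable \<mu> g" "integrable (measure_pmf q) g" for q
      using g(1) by (auto intro!: int flat_span_continuous flat_span_bounded)
    have close: "\<bar>(\<integral>z. f z \<partial>N) - (\<integral>z. g z \<partial>N)\<bar> \<le> e / 4" if "prob_space N" "integrable N f" "integrable N g" for N
    proof -
      interpret N: prob_space N by fact
      have "\<bar>(\<integral>z. f z \<partial>N) - (\<integral>z. g z \<partial>N)\<bar> = \<bar>\<integral>z. f z - g z \<partial>N\<bar>" using that by simp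
      also have "\<dots> \<le> (\<integral>z. e / 4 \<partial>N)"
        by (rule integral_abs_bound_integral) (use that g in auto)
      finally show ?thesis by (simp add: N.prob_space)
    qed
    have "eventually (\<lambda>n. dist (\<integral>z. g z \<partial>measure_pmf (p n)) (\<integral>z. g z \<partial>\<mu>) < e / 2) sequentially"
      using tendstoD[OF span[OF g(1)], of "e / 2"] e by simp
    then show "eventually (\<lambda>n. dist (\<integral>z. f z \<partial>measure_pmf (p n)) (\<integral>z. f z \<partial>\<mu>) < e) sequentially"
    proof eventually_elim
      case (elim n)
      then show ?case
        using close[OF prob_space_measure_pmf fi(2) gi(2), of "p n"] close[OF prob_space_axioms fi(1) gi(1)]
        unfolding dist_real_def by linarith
    qed
  qed
  show ?thesis unfolding weak_conv_c_def
  proof (intro allI impI, elim conjE)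
    fix f :: "complex \<Rightarrow> real" assume f: "continuous_on UNIV f" "bounded (range f)"
    obtain B where B: "\<And>z. \<bar>f z\<bar> \<le> B" using f(2) unfolding bounded_iff by (metis rangeI real_norm_def)
    have B0: "B \<ge> 0" using B[of 0] by linarith
    show "(\<lambda>n. \<integral>z. f z \<partial>measure_pmf (p n)) \<longlonglongrightarrow> (\<integral>z. f z \<partial>\<mu>)"
    proof (rule tendstoI)
      fix e :: real assume e: "e > 0"
      have "(\<lambda>m. 2 * B * (1 - (\<integral>z. cutoff m z \<partial>\<mu>))) \<longlonglongrightarrow> 2 * B * (1 - 1)"
        by (intro tendsto_intros integral_cutoff_tendsto_1)
      then have "eventually (\<lambda>m. 2 * B * (1 - (\<integral>z. cutoff m z \<partial>\<mu>)) < e / 2) sequentially"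
        using e by (intro order_tendstoD(2)) auto
      then obtain m where m: "2 * B * (1 - (\<integral>z. cutoff m z \<partial>\<mu>)) < e / 2"
        using eventually_happens'[OF sequentially_bot] by blast
      have c1: "(\<lambda>n. \<integral>z. f z * cutoff m z \<partial>measure_pmf (p n)) \<longlonglongrightarrow> (\<integral>z. f z * cutoff m z \<partial>\<mu>)"
      proof (rule cc)
        show "f z * cutoff m z = 0" if "cmod z > real m + 1" for z using cutoff_support[OF that] by simp
      qed (intro continuous_intros f)
      have c2: "(\<lambda>n. \<integral>z. cutoff m z \<partial>measure_pmf (p n)) \<longlonglongrightarrow> (\<integral>z. cutoff m z \<partial>\<mu>)"
        by (rule cc[OF cutoff_continuous cutoff_support])
      have "(\<lambda>n. \<bar>(\<integral>z. f z * cutoff m z \<partial>measure_pmf (p n)) - (\<integral>z. f z * cutoff m z \<partial>\<mu>)\<bar>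
        + B * \<bar>(\<integral>z. cutoff m z \<partial>measure_pmf (p n)) - (\<integral>z. cutoff m z \<partial>\<mu>)\<bar>) \<longlonglongrightarrow>
         \<bar>(\<integral>z. f z * cutoff m z \<partial>\<mu>) - (\<integral>z. f z * cutoff m z \<partial>\<mu>)\<bar> + B * \<bar>(\<integral>z. cutoff m z \<partial>\<mu>) - (\<integral>z. cutoff m z \<partial>\<mu>)\<bar>"
        by (intro tendsto_add tendsto_rabs tendsto_diff tendsto_mult c1 c2 tendsto_const)
      then have "eventually (\<lambda>n. \<bar>(\<integral>z. f z * cutoff m z \<partial>measure_pmf (p n)) - (\<integral>z. f z * cutoff m z \<partial>\<mu>)\<bar>
        + B * \<bar>(\<integral>z. cutoff m z \<partial>measure_pmf (p n)) - (\<integral>z. cutoff m z \<partial>\<mu>)\<bar> < e / 2) sequentially"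
        using e by (intro order_tendstoD(2)) auto
      then show "eventually (\<lambda>n. dist (\<integral>z. f z \<partial>measure_pmf (p n)) (\<integral>z. f z \<partial>\<mu>) < e) sequentially"
      proof eventually_elim
        case (elim n)
        then show ?case using cutoff_error_le[OF f(1) B, of "p n" m] m unfolding dist_real_def by linarith
      qed
    qed
  qed
qed

end

section \<open>The logarithmic derivative\<close>

lemma poly_rand_poly: "poly (rand_poly x n) z = (\<Prod>k=1..n. z - x k)"
  by (simp add: rand_poly_def poly_prod)

lemma degree_rand_poly: "degree (rand_poly x n) = n"
  unfolding rand_poly_def by (subst degree_prod_eq_sum_degree) auto

lemma lead_coeff_rand_poly: "lead_coeff (rand_poly x n) = 1"
  unfolding rand_poly_def by (subst lead_coeff_prod) auto

lemma rand_poly_nonzero: "rand_poly x n \<noteq> 0"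
  using lead_coeff_rand_poly[of x n] by auto

lemma proots_rand_poly: "proots (rand_poly x n) = image_mset x (mset_set {1..n})"
proof -
  have "proots (rand_poly x n) = (\<Sum>k\<in>{1..n}. proots [:- x k, 1:])"
    unfolding rand_poly_def by (rule proots_prod) auto
  also have "\<dots> = (\<Sum>k\<in>{1..n}. {#x k#})" by simp
  also have "\<dots> = image_mset x (mset_set {1..n})"
    by (induction n) (simp_all add: atLeastAtMostSuc_conv add_mset_commute)
  finally show ?thesis .
qed

lemma lead_coeff_pderiv_rand_poly: "n \<ge> 1 \<Longrightarrow> lead_coeff (pderiv (rand_poly x n)) = of_nat n"
  using lead_coeff_rand_poly[of x n]
  by (simp add: degree_pderiv degree_rand_poly coeff_pderiv del: of_nat_Suc)

lemma pderiv_rand_poly_nonzero: "n \<ge> 1 \<Longrightarrow> pderiv (rand_poly x n) \<noteq> 0"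
  using lead_coeff_pderiv_rand_poly[of n x] by auto

lemma size_proots_pderiv_rand_poly: "size (proots (pderiv (rand_poly x n))) = n - 1"
  by (simp add: size_proots_complex degree_pderiv degree_rand_poly)

lemma poly_pderiv_rand_poly:
  assumes "\<And>k. 1 \<le> k \<Longrightarrow> k \<le> n \<Longrightarrow> z \<noteq> x k"
  shows "poly (pderiv (rand_poly x n)) z = poly (rand_poly x n) z * (\<Sum>k=1..n. 1 / (z - x k))"
  using assms
proof (induction n)
  case 0
  then show ?case by (simp add: rand_poly_def)
next
  case (Suc n)
  have *: "rand_poly x (Suc n) = rand_poly x n * [:- x (Suc n), 1:]"
    by (simp add: rand_poly_def)
  have ne: "z - x (Suc n) \<noteq> 0" using Suc.prems by auto
  have pd: "poly (pderiv (p * [:- c, 1:])) z = poly (pderiv p) z * (z - c) + poly p z" for p and c :: complex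
    unfolding pderiv_mult poly_add poly_mult by (simp add: pderiv_pCons algebra_simps)
  define u L d where "u = poly (rand_poly x n) z" and "L = (\<Sum>k=1..n. 1 / (z - x k))" and "d = z - x (Suc n)"
  have "poly (pderiv (rand_poly x (Suc n))) z = u * L * d + u"
    unfolding * pd using Suc by (simp add: u_def L_def d_def)
  also have "\<dots> = u * d * (L + 1 / d)" using ne by (simp add: d_def[symmetric] field_simps)
  also have "u * d = poly (rand_poly x (Suc n)) z" by (simp add: * u_def d_def algebra_simps)
  also have "L + 1 / d = (\<Sum>k=1..Suc n. 1 / (z - x k))" by (simp add: L_def d_def)
  finally show ?case .
qed

lemma ln_norm_poly:
  fixes p :: "complex poly"
  assumes "poly p z \<noteq> 0"
  shows "ln (cmod (poly p z)) = ln (cmod (lead_coeff p)) + (\<Sum>\<zeta>\<in>#proots p. ln (cmod (z - \<zeta>)))"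
proof -
  have p: "p \<noteq> 0" using assms by auto
  have "z \<notin># proots p" using assms p by auto
  have "poly p z = lead_coeff p * (\<Prod>\<zeta>\<in>#proots p. z - \<zeta>)"
    by (subst complex_poly_decompose_multiset[of p, symmetric]) (simp add: poly_prod_mset)
  then have "cmod (poly p z) = cmod (lead_coeff p) * cmod (\<Prod>\<zeta>\<in>#proots p. z - \<zeta>)"
    by (simp add: norm_mult)
  moreover have prod: "ln (cmod (\<Prod>\<zeta>\<in>#A. z - \<zeta>)) = (\<Sum>\<zeta>\<in>#A. ln (cmod (z - \<zeta>))) \<and> (\<Prod>\<zeta>\<in>#A. z - \<zeta>) \<noteq> 0"
    if "z \<notin># A" for A
    using that by (induction A) (auto simp: norm_mult ln_mult)
  moreover have "ln (cmod (lead_coeff p) * cmod q) = ln (cmod (lead_coeff p)) + ln (cmod q)" if "q \<noteq> 0" for q :: complex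
    using that p by (simp add: ln_mult)
  ultimately show ?thesis using prod[OF \<open>z \<notin># proots p\<close>] by metis
qed

text \<open>Logarithms of moduli in P' = P * L, with both polynomials factorised;
  \<open>ln (real n)\<close> comes from the leading coefficient of P'.\<close>

lemma ln_norm_log_deriv:
  assumes n: "n \<ge> 1" and x: "\<And>k. 1 \<le> k \<Longrightarrow> k \<le> n \<Longrightarrow> z \<noteq> x k"
    and z: "poly (pderiv (rand_poly x n)) z \<noteq> 0"
  shows "ln (cmod (\<Sum>k=1..n. 1 / (z - x k))) =
    ln (real n) + (\<Sum>\<zeta>\<in>#proots (pderiv (rand_poly x n)). ln (cmod (z - \<zeta>))) - (\<Sum>k=1..n. ln (cmod (z - x k)))"
proof -
  let ?L = "\<Sum>k=1..n. 1 / (z - x k)" and ?P = "rand_poly x n"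
  have P0: "poly ?P z \<noteq> 0" using x by (simp add: poly_rand_poly)
  have eq: "poly (pderiv ?P) z = poly ?P z * ?L" by (rule poly_pderiv_rand_poly) (use x in auto)
  then have "?L \<noteq> 0" using z by auto
  then have "ln (cmod (poly (pderiv ?P) z)) = ln (cmod (poly ?P z)) + ln (cmod ?L)"
    using P0 by (simp add: eq norm_mult ln_mult)
  moreover have "ln (cmod (poly ?P z)) = (\<Sum>k=1..n. ln (cmod (z - x k)))"
    using ln_norm_poly[OF P0] lead_coeff_rand_poly[of x n]
    by (simp add: proots_rand_poly image_mset.compositionality o_def sum_unfold_sum_mset)
  moreover have "ln (cmod (poly (pderiv ?P) z)) = ln (real n) + (\<Sum>\<zeta>\<in>#proots (pderiv ?P). ln (cmod (z - \<zeta>)))"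
    using ln_norm_poly[OF z] lead_coeff_pderiv_rand_poly[OF n, of x] by simp
  ultimately show ?thesis by simp
qed

text \<open>The inequality \<open>ln x \<le> x - 1\<close> at \<open>exp (- T) / r\<close>. It
  splits the logarithmic singularity into a constant and an integrable kernel whose factor is as
  small as desired.\<close>

lemma neg_ln_le:
  fixes r T :: real
  assumes "r > 0"
  shows "- ln r \<le> T + exp (- T) / r"
proof -
  have "ln (exp (- T) / r) \<le> exp (- T) / r - 1"
    using assms by (intro ln_le_minus_one) simp
  then show ?thesis using assms by (simp add: ln_div)
qed

text \<open>\<open>log_plus (cmod x)\<close> is the logarithm of max 1 |x|, and |z - x| is at most
  (A + 1) times that maximum.\<close>

lemma ln_dist_le:
  fixes z x :: complex
  assumes "cmod z \<le> A" "z \<noteq> x"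
  shows "ln (cmod (z - x)) \<le> ln (A + 1) + log_plus (cmod x)"
proof -
  have A: "A \<ge> 0" using assms(1) norm_ge_zero order_trans by blast
  define m where "m = max 1 (cmod x)"
  have m: "m \<ge> 1" by (simp add: m_def)
  have "cmod (z - x) \<le> A + cmod x" using norm_triangle_ineq4[of z x] assms by simp
  also have "\<dots> \<le> A * m + m" using A m mult_left_mono[of 1 m A] by (simp add: m_def)
  also have "\<dots> = (A + 1) * m" by (simp add: algebra_simps)
  finally have "ln (cmod (z - x)) \<le> ln ((A + 1) * m)"
    using assms A m by (subst ln_le_cancel_iff) auto
  also have "\<dots> = ln (A + 1) + ln m" using A m by (subst ln_mult) auto
  also have "ln m = log_plus (cmod x)"
  proof (cases "cmod x \<ge> 1")
    case False
    then have "ln (cmod x) \<le> 0" by (cases "x = 0") auto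
    then show ?thesis using False by (simp add: m_def log_plus_def max_def)
  next
    case True
    then have "ln (cmod x) \<ge> 0" by simp
    then show ?thesis using True by (simp add: m_def log_plus_def max_absorb2)
  qed
  finally show ?thesis .
qed

lemma sum_mset_mono_le:
  fixes f g :: "'a \<Rightarrow> real"
  shows "(\<And>x. x \<in># A \<Longrightarrow> f x \<le> g x) \<Longrightarrow> (\<Sum>x\<in>#A. f x) \<le> (\<Sum>x\<in>#A. g x)"
  by (induction A) (auto intro: add_mono)

lemma sum_mset_affine:
  fixes f :: "'a \<Rightarrow> real"
  shows "(\<Sum>x\<in>#A. c + d * f x) = real (size A) * c + d * (\<Sum>x\<in>#A. f x)"
  by (induction A) (auto simp: algebra_simps)

lemma sum_mset_nonneg_real:
  fixes f :: "'a \<Rightarrow> real"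
  shows "(\<And>x. x \<in># A \<Longrightarrow> 0 \<le> f x) \<Longrightarrow> 0 \<le> (\<Sum>x\<in>#A. f x)"
  by (induction A) auto

text \<open>Measurability is carried along because additivity of the integral needs it in the
  induction step.\<close>

lemma nn_integral_sum_inverse_dist_le:
  assumes "A \<ge> 0"
  shows "(\<lambda>z. \<Sum>\<zeta>\<in>#Z. 1 / cmod (z - \<zeta>)) \<in> borel_measurable borel \<and>
    (\<integral>\<^sup>+z. ennreal (\<Sum>\<zeta>\<in>#Z. 1 / cmod (z - \<zeta>)) * indicator (cball 0 A) z \<partial>lborel) \<le> ennreal (real (size Z) * (pi * A\<^sup>2 + 4 * pi))"
proof (induction Z)
  case (add \<zeta> Z)
  let ?S = "\<lambda>z. \<Sum>\<zeta>\<in>#Z. 1 / cmod (z - \<zeta>)"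
  have [measurable]: "?S \<in> borel_measurable borel" using add by blast
  have "ennreal (1 / cmod (z - \<zeta>) + ?S z) * indicator (cball 0 A) z =
      ennreal (1 / cmod (z - \<zeta>)) * indicator (cball 0 A) z + ennreal (?S z) * indicator (cball 0 A) z" for z
    by (subst ennreal_plus) (auto intro!: sum_mset_nonneg_real simp: distrib_right)
  then have "(\<integral>\<^sup>+z. ennreal (1 / cmod (z - \<zeta>) + ?S z) * indicator (cball 0 A) z \<partial>lborel) =
     (\<integral>\<^sup>+z. ennreal (1 / cmod (z - \<zeta>)) * indicator (cball 0 A) z \<partial>lborel) + (\<integral>\<^sup>+z. ennreal (?S z) * indicator (cball 0 A) z \<partial>lborel)"
    by (simp add: nn_integral_add)
  also have "\<dots> \<le> ennreal (pi * A\<^sup>2 + 4 * pi) + ennreal (real (size Z) * (pi * A\<^sup>2 + 4 * pi))"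
    using add nn_integral_inverse_dist_le[OF assms] by (intro add_mono) auto
  also have "\<dots> = ennreal (real (size (add_mset \<zeta> Z)) * (pi * A\<^sup>2 + 4 * pi))"
    by (subst ennreal_plus[symmetric]) (auto simp: algebra_simps)
  finally show ?case by simp
qed simp

text \<open>Upper half: \<open>ln\<^sup>+ \<bar>L\<bar> \<le> ln (1 + S) \<le> ln n + (1 + S) / n\<close> with \<open>S = \<Sum> 1 / \<bar>z - x\<^sub>k\<bar>\<close>. Lower half: in
  \<open>- ln \<bar>L\<bar> = \<Sum> ln \<bar>z - x\<^sub>k\<bar> - \<Sum> ln \<bar>z - \<zeta>\<bar> - ln n\<close> the terms \<open>ln\<^sup>- \<bar>z - x\<^sub>k\<bar>\<close>, \<open>ln\<^sup>+ \<bar>z - \<zeta>\<bar>\<close> and \<open>ln n\<close>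
  have the favourable sign.\<close>

lemma abs_ln_log_deriv_le:
  fixes x :: "nat \<Rightarrow> complex" and n :: nat
  defines "L \<equiv> \<lambda>z. \<Sum>k=1..n. 1 / (z - x k)"
  defines "Z \<equiv> proots (pderiv (rand_poly x n))"
  assumes n: "n \<ge> 1" and x: "\<And>k. 1 \<le> k \<Longrightarrow> k \<le> n \<Longrightarrow> z \<noteq> x k"
    and z: "poly (pderiv (rand_poly x n)) z \<noteq> 0" "cmod z \<le> A"
    and B: "(\<Sum>k=1..n. log_plus (cmod (x k))) \<le> real n * B" and T: "T \<ge> 0" and \<epsilon>: "\<epsilon> > 0"
  shows "\<bar>ln (cmod (L z))\<bar> / real n \<le>
      (ln (real n) / real n + 1 / (real n)\<^sup>2 + \<epsilon>)
      + 1 / (real n)\<^sup>2 * (\<Sum>\<zeta>\<in>#image_mset x (mset_set {1..n}). 1 / cmod (z - \<zeta>))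
      + exp (- T) / real n * (\<Sum>\<zeta>\<in>#Z. 1 / cmod (z - \<zeta>))
      + (ln (A + 1) + B + T) * indicator {z. cmod (L z) < exp (- real n * \<epsilon>)} z"
proof -
  define S where "S = (\<Sum>k=1..n. 1 / cmod (z - x k))"
  have S_eq: "(\<Sum>\<zeta>\<in>#image_mset x (mset_set {1..n}). 1 / cmod (z - \<zeta>)) = S"
    by (simp add: S_def image_mset.compositionality o_def sum_unfold_sum_mset)
  have S0: "S \<ge> 0" by (auto simp: S_def intro: sum_nonneg)
  define R where "R = (\<Sum>\<zeta>\<in>#Z. 1 / cmod (z - \<zeta>))"
  have R0: "R \<ge> 0" unfolding R_def by (rule sum_mset_nonneg_real) simp
  have A: "A \<ge> 0" using z(2) norm_ge_zero order_trans by blast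
  have n0: "real n > 0" using n by simp
  have log_plus_nn: "log_plus t \<ge> 0" for t by (simp add: log_plus_def)
  have "0 \<le> real n * B" by (rule order_trans[OF _ B]) (simp add: sum_nonneg log_plus_nn)
  then have B0: "B \<ge> 0" using n0 by (simp add: zero_le_mult_iff)
  define K where "K = ln (A + 1) + B + T"
  have K0: "K \<ge> 0" unfolding K_def using A B0 T by simp
  have P0: "poly (rand_poly x n) z \<noteq> 0" using x by (simp add: poly_rand_poly)
  have L0: "L z \<noteq> 0" using z poly_pderiv_rand_poly[of n z x] x by (auto simp: L_def)
  have "cmod (L z) \<le> S"
    unfolding L_def S_def by (rule order_trans[OF norm_sum]) (simp add: norm_divide)
  \<comment> \<open>Taking out the factor \<open>real n\<close> leaves \<open>S\<close> with weight
    1/n^2 after division by n, so that integrating its n kernels yields only O(1/n).\<close>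
  then have "ln (cmod (L z)) \<le> ln (real n * ((1 + S) / real n))"
    using L0 n0 S0 by (subst ln_le_cancel_iff) auto
  also have "\<dots> = ln (real n) + ln ((1 + S) / real n)" using n0 S0 by (subst ln_mult) auto
  also have "ln ((1 + S) / real n) \<le> (1 + S) / real n"
    using n0 S0 by (intro ln_bound) auto
  finally have upper: "ln (cmod (L z)) / real n \<le> ln (real n) / real n + 1 / (real n)\<^sup>2 + 1 / (real n)\<^sup>2 * S"
    using n0 by (simp add: divide_simps power2_eq_square)
  have lnn: "ln (real n) \<ge> 0" using n by simp
  have "ln (cmod (L z)) = ln (real n) + (\<Sum>\<zeta>\<in>#Z. ln (cmod (z - \<zeta>))) - (\<Sum>k=1..n. ln (cmod (z - x k)))"
    unfolding L_def Z_def by (rule ln_norm_log_deriv) (use n x z in auto)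
  moreover have "(\<Sum>k=1..n. ln (cmod (z - x k))) \<le> (\<Sum>k=1..n. ln (A + 1) + log_plus (cmod (x k)))"
    by (intro sum_mono ln_dist_le z) (use x in auto)
  moreover have "\<dots> \<le> real n * (ln (A + 1) + B)" using B by (simp add: sum.distrib algebra_simps)
  moreover have "(\<Sum>\<zeta>\<in>#Z. - ln (cmod (z - \<zeta>))) \<le> real n * T + exp (- T) * R"
  proof -
    have "(\<Sum>\<zeta>\<in>#Z. - ln (cmod (z - \<zeta>))) \<le> (\<Sum>\<zeta>\<in>#Z. T + exp (- T) * (1 / cmod (z - \<zeta>)))"
    proof (rule sum_mset_mono_le)
      fix \<zeta> assume "\<zeta> \<in># Z"
      then have "z \<noteq> \<zeta>" using z(1) pderiv_rand_poly_nonzero[OF n, of x] by (auto simp: Z_def)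
      then show "- ln (cmod (z - \<zeta>)) \<le> T + exp (- T) * (1 / cmod (z - \<zeta>))"
        using neg_ln_le[of "cmod (z - \<zeta>)" T] by simp
    qed
    also have "\<dots> = real (n - 1) * T + exp (- T) * R"
      unfolding sum_mset_affine by (simp only: R_def Z_def size_proots_pderiv_rand_poly)
    also have "\<dots> \<le> real n * T + exp (- T) * R" using T by (simp add: mult_right_mono)
    finally show ?thesis .
  qed
  moreover have "(\<Sum>\<zeta>\<in>#Z. - ln (cmod (z - \<zeta>))) = - (\<Sum>\<zeta>\<in>#Z. ln (cmod (z - \<zeta>)))"
    by (induction Z) auto
  ultimately have "- ln (cmod (L z)) \<le> real n * K + exp (- T) * R"
    using lnn by (simp add: K_def algebra_simps)
  then have low: "- ln (cmod (L z)) / real n \<le> K + exp (- T) / real n * R"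
    using n0 by (simp add: divide_simps) (simp add: algebra_simps)
  \<comment> \<open>Off the exceptional set its definition already gives the bound \<epsilon>; the
    large constant \<open>K\<close> is paid only on the set itself.\<close>
  have low': "- ln (cmod (L z)) / real n \<le> \<epsilon>" if "\<not> cmod (L z) < exp (- real n * \<epsilon>)"
  proof -
    have "- real n * \<epsilon> \<le> ln (cmod (L z))"
      using that L0 by (subst ln_ge_iff) auto
    then show ?thesis using n0 by (simp add: divide_simps mult.commute)
  qed
  have nn: "0 \<le> ln (real n) / real n + 1 / (real n)\<^sup>2" "0 \<le> 1 / (real n)\<^sup>2 * S" "0 \<le> exp (- T) / real n * R"
    using lnn n0 S0 R0 by auto
  have "\<bar>ln (cmod (L z))\<bar> / real n = max (ln (cmod (L z)) / real n) (- ln (cmod (L z)) / real n)"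
    using n0 by (simp add: abs_if max_def divide_simps)
  also have "\<dots> \<le> (ln (real n) / real n + 1 / (real n)\<^sup>2 + \<epsilon>) + 1 / (real n)\<^sup>2 * S + exp (- T) / real n * R
      + K * indicator {z. cmod (L z) < exp (- real n * \<epsilon>)} z"
  proof (cases "cmod (L z) < exp (- real n * \<epsilon>)")
    case True
    then show ?thesis using upper low nn K0 \<epsilon> by (simp add: indicator_def)
  next
    case False
    then show ?thesis using upper low' nn \<epsilon> by (simp add: indicator_def)
  qed
  finally show ?thesis unfolding S_eq R_def K_def .
qed

lemma AE_not_proots:
  fixes p :: "complex poly"
  assumes "p \<noteq> 0"
  shows "AE z in lborel. poly p z \<noteq> 0"
proof -
  have "{z. poly p z = 0} \<in> null_sets lborel"
    by (rule finite_imp_null_set_lborel) (use poly_roots_finite[OF assms] in simp)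
  from AE_not_in[OF this] show ?thesis by simp
qed

lemma ennreal_combine:
  fixes c u v y w k i :: real
  assumes "c \<ge> 0" "u \<ge> 0" "v \<ge> 0" "y \<ge> 0" "w \<ge> 0" "k \<ge> 0" "i \<ge> 0"
  shows "ennreal (c + u * v + y * w + k * i) = ennreal c + ennreal u * ennreal v + ennreal y * ennreal w + ennreal k * ennreal i"
  using assms by (simp add: ennreal_mult)

text \<open>Each kernel integrates to at most \<open>C\<close>, wherever its pole lies. The n
  kernels of \<open>S\<close> carry weight 1/n^2 and give \<open>C / real n\<close>; those of the
  zeros of P' carry \<open>exp (- T) / real n\<close> and give \<open>exp (- T) * C\<close>, which
  only the choice of \<open>T\<close> makes small.\<close>

lemma nn_integral_abs_ln_log_deriv_le:
  fixes x :: "nat \<Rightarrow> complex" and n :: nat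
  defines "L \<equiv> \<lambda>z. \<Sum>k=1..n. 1 / (z - x k)"
  assumes n: "n \<ge> 1" and A: "A \<ge> 0"
    and B: "(\<Sum>k=1..n. log_plus (cmod (x k))) \<le> real n * B" and T: "T \<ge> 0" and \<epsilon>: "\<epsilon> > 0"
  defines "C \<equiv> pi * A\<^sup>2 + 4 * pi"
  shows "(\<integral>\<^sup>+z. ennreal (\<bar>ln (cmod (L z))\<bar> / real n) * indicator (cball 0 A) z \<partial>lborel) \<le>
     ennreal ((ln (real n) / real n + 1 / (real n)\<^sup>2 + \<epsilon>) * (pi * A\<^sup>2) + C / real n + exp (- T) * C)
     + ennreal (ln (A + 1) + B + T) * emeasure lborel {z\<in>cball 0 A. cmod (L z) < exp (- real n * \<epsilon>)}"
proof -
  let ?Q = "indicator (cball (0::complex) A) :: complex \<Rightarrow> ennreal"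
  define Z where "Z = proots (pderiv (rand_poly x n))"
  define X where "X = image_mset x (mset_set {1..n})"
  let ?S = "\<lambda>Z z. \<Sum>\<zeta>\<in>#Z. 1 / cmod (z - \<zeta>)"
  note S = nn_integral_sum_inverse_dist_le[OF A, folded C_def]
  have [measurable]: "?S Z \<in> borel_measurable borel" for Z using S by blast
  have Lm [measurable]: "L \<in> borel_measurable borel" unfolding L_def by measurable
  define c1 where "c1 = ln (real n) / real n + 1 / (real n)\<^sup>2 + \<epsilon>"
  define K where "K = ln (A + 1) + B + T"
  have n0: "real n > 0" using n by simp
  have log_plus_nn: "log_plus t \<ge> 0" for t by (simp add: log_plus_def)
  have "0 \<le> real n * B" by (rule order_trans[OF _ B]) (simp add: sum_nonneg log_plus_nn)
  then have B0: "B \<ge> 0" using n0 by (simp add: zero_le_mult_iff)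
  have K0: "K \<ge> 0" unfolding K_def using A B0 T by simp
  have c10: "c1 \<ge> 0" unfolding c1_def using n \<epsilon> by simp
  have C0: "C \<ge> 0" by (simp add: C_def)
  let ?bad = "{z. cmod (L z) < exp (- real n * \<epsilon>)}"
  have "(\<integral>\<^sup>+z. ennreal (\<bar>ln (cmod (L z))\<bar> / real n) * ?Q z \<partial>lborel) \<le>
     (\<integral>\<^sup>+z. ennreal c1 * ?Q z + ennreal (1 / (real n)\<^sup>2) * (ennreal (?S X z) * ?Q z)
       + ennreal (exp (- T) / real n) * (ennreal (?S Z z) * ?Q z) + ennreal K * indicator {z\<in>cball 0 A. cmod (L z) < exp (- real n * \<epsilon>)} z \<partial>lborel)"
  proof (rule nn_integral_mono_AE)
    \<comment> \<open>The pointwise bound needs \<open>z\<close> to be a zero of neither P nor P',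
      which excludes finitely many points.\<close>
    have "AE z in lborel. poly (rand_poly x n) z \<noteq> 0" by (rule AE_not_proots) (rule rand_poly_nonzero)
    moreover have "AE z in lborel. poly (pderiv (rand_poly x n)) z \<noteq> 0"
      by (rule AE_not_proots) (rule pderiv_rand_poly_nonzero[OF n])
    ultimately show "AE z in lborel. ennreal (\<bar>ln (cmod (L z))\<bar> / real n) * ?Q z \<le>
        ennreal c1 * ?Q z + ennreal (1 / (real n)\<^sup>2) * (ennreal (?S X z) * ?Q z)
       + ennreal (exp (- T) / real n) * (ennreal (?S Z z) * ?Q z) + ennreal K * indicator {z\<in>cball 0 A. cmod (L z) < exp (- real n * \<epsilon>)} z"
    proof eventually_elim
      case (elim z)
      show ?case
      proof (cases "cmod z \<le> A")
        case True
        have nn: "?S X z \<ge> 0" "?S Z z \<ge> 0" by (auto intro!: sum_mset_nonneg_real)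
        have "\<bar>ln (cmod (L z))\<bar> / real n \<le> c1 + 1 / (real n)\<^sup>2 * ?S X z + exp (- T) / real n * ?S Z z + K * indicator ?bad z"
          unfolding L_def c1_def K_def X_def Z_def
          by (rule abs_ln_log_deriv_le) (use elim n True B T \<epsilon> in \<open>auto simp: poly_rand_poly\<close>)
        then have "ennreal (\<bar>ln (cmod (L z))\<bar> / real n) \<le>
           ennreal (c1 + 1 / (real n)\<^sup>2 * ?S X z + exp (- T) / real n * ?S Z z + K * indicator ?bad z)"
          by (rule ennreal_leI)
        also have "\<dots> = ennreal c1 + ennreal (1 / (real n)\<^sup>2) * ennreal (?S X z) + ennreal (exp (- T) / real n) * ennreal (?S Z z)
           + ennreal K * ennreal (indicator ?bad z)"
          by (rule ennreal_combine) (use c10 K0 nn in auto)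
        finally show ?thesis
          using True by (cases "cmod (L z) < exp (- real n * \<epsilon>)") (simp_all add: indicator_def)
      qed simp
    qed
  qed
  also have "\<dots> = ennreal c1 * emeasure lborel (cball (0::complex) A) + ennreal (1 / (real n)\<^sup>2) * (\<integral>\<^sup>+z. ennreal (?S X z) * ?Q z \<partial>lborel)
     + ennreal (exp (- T) / real n) * (\<integral>\<^sup>+z. ennreal (?S Z z) * ?Q z \<partial>lborel) + ennreal K * emeasure lborel {z\<in>cball 0 A. cmod (L z) < exp (- real n * \<epsilon>)}"
  proof -
    have [measurable]: "{z\<in>cball 0 A. cmod (L z) < exp (- real n * \<epsilon>)} \<in> sets borel"
    proof -
      have "{z\<in>cball 0 A. cmod (L z) < exp (- real n * \<epsilon>)} = cball 0 A \<inter> {z\<in>space borel. cmod (L z) < exp (- real n * \<epsilon>)}" by auto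
      also have "\<dots> \<in> sets borel" by (intro sets.Int cball_in_sets_borel) measurable
      finally show ?thesis .
    qed
    show ?thesis by (simp add: nn_integral_add nn_integral_cmult)
  qed
  also have "\<dots> \<le> ennreal c1 * ennreal (pi * A\<^sup>2) + ennreal (1 / (real n)\<^sup>2) * ennreal (real n * C)
     + ennreal (exp (- T) / real n) * ennreal (real n * C) + ennreal K * emeasure lborel {z\<in>cball 0 A. cmod (L z) < exp (- real n * \<epsilon>)}"
  proof (intro add_mono mult_left_mono)
    show "(\<integral>\<^sup>+z. ennreal (?S X z) * ?Q z \<partial>lborel) \<le> ennreal (real n * C)"
      using S[of X] by (simp add: X_def)
    have "real (size Z) * C \<le> real n * C" using C0
      by (intro mult_right_mono) (auto simp: Z_def size_proots_pderiv_rand_poly)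
    then show "(\<integral>\<^sup>+z. ennreal (?S Z z) * ?Q z \<partial>lborel) \<le> ennreal (real n * C)"
      using S[of Z] ennreal_leI order_trans by blast
  qed (use A in \<open>auto simp: emeasure_cball_complex\<close>)
  also have "ennreal c1 * ennreal (pi * A\<^sup>2) + ennreal (1 / (real n)\<^sup>2) * ennreal (real n * C)
     + ennreal (exp (- T) / real n) * ennreal (real n * C) = ennreal (c1 * (pi * A\<^sup>2) + 1 / (real n)\<^sup>2 * (real n * C) + exp (- T) / real n * (real n * C))"
    using ennreal_combine[of c1 "1 / (real n)\<^sup>2" "real n * C" "exp (- T) / real n" "real n * C" 0 0] c10 C0
    by (simp add: ennreal_mult)
  also have "c1 * (pi * A\<^sup>2) + 1 / (real n)\<^sup>2 * (real n * C) + exp (- T) / real n * (real n * C) = c1 * (pi * A\<^sup>2) + C / real n + exp (- T) * C"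
    using n0 by (simp add: power2_eq_square)
  finally show ?thesis unfolding c1_def K_def .
qed


section \<open>Expected logarithmic derivative\<close>

lemma ennreal_tendsto_0I:
  fixes F :: "nat \<Rightarrow> ennreal"
  assumes "\<And>r. r > 0 \<Longrightarrow> eventually (\<lambda>n. F n \<le> ennreal r) sequentially"
  shows "F \<longlonglongrightarrow> 0"
proof (rule order_tendstoI)
  fix e :: ennreal assume "0 < e"
  then obtain d where d: "0 < d" "d < e" using dense by blast
  then obtain r where r: "d = ennreal r" "r \<ge> 0" by (cases d) auto
  then have "r > 0" using d by simp
  from assms[OF this] show "eventually (\<lambda>n. F n < e) sequentially"
    by eventually_elim (use d r in auto)
qed simp

lemma ennreal_tendsto_0D:
  fixes F :: "nat \<Rightarrow> ennreal"
  assumes "F \<longlonglongrightarrow> 0" "r > 0"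
  shows "eventually (\<lambda>n. F n \<le> ennreal r) sequentially"
proof -
  have "eventually (\<lambda>n. F n < ennreal r) sequentially"
    using order_tendstoD(2)[OF assms(1), of "ennreal r"] assms(2) by simp
  then show ?thesis by eventually_elim simp
qed

text \<open>Dividing a tolerance by \<open>k + 1\<close> rather than \<open>k\<close> allows
  \<open>k = 0\<close>.\<close>

lemma mult_divide_add_1_le:
  fixes k r c :: real
  assumes "k \<ge> 0" "r \<ge> 0" "c > 0"
  shows "k * (r / (c * (k + 1))) \<le> r / c"
proof -
  have "k * (r / (c * (k + 1))) = r / c * (k / (k + 1))" by simp
  also have "\<dots> \<le> r / c * 1" using assms by (intro mult_left_mono) auto
  finally show ?thesis by simp
qed

lemma log_cesaro_bounded_sum_le:
  assumes "log_cesaro_bounded a"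
  obtains B where "B \<ge> 0" "\<And>n. (\<Sum>k=1..n. log_plus (cmod (a k))) \<le> real n * B"
proof -
  obtain B where B: "B > 0" "\<And>n. norm ((\<Sum>k=1..n. log_plus (cmod (a k))) / real n) \<le> B"
    using assms unfolding log_cesaro_bounded_def Bseq_def by auto
  show ?thesis
  proof (rule that[of B])
    show "(\<Sum>k=1..n. log_plus (cmod (a k))) \<le> real n * B" for n
    proof (cases "n = 0")
      case False
      have "(\<Sum>k=1..n. log_plus (cmod (a k))) / real n \<le> B"
        using B(2)[of n] unfolding real_norm_def by linarith
      then show ?thesis using False by (simp add: divide_le_eq mult.commute)
    qed simp
  qed (use B in simp)
qed

context two_valued_sequence
begin

lemma log_deriv_measurable:
  "(\<lambda>p. \<Sum>k=1..n. 1 / (snd p - \<xi> k (fst p))) \<in> borel_measurable (M \<Otimes>\<^sub>M lborel)"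
proof (rule borel_measurable_sum)
  fix k assume "k \<in> {1..n}"
  then have [measurable]: "\<xi> k \<in> borel_measurable M" by (intro meas) simp
  show "(\<lambda>p. 1 / (snd p - \<xi> k (fst p))) \<in> borel_measurable (M \<Otimes>\<^sub>M lborel)" by measurable
qed

text \<open>Fubini turns the expected area into an integral over \<open>z\<close> of probabilities,
  which tend to 0 for almost every \<open>z\<close> and are dominated by the indicator of the
  disc.\<close>

lemma nn_integral_prob_small_log_deriv_tendsto_0:
  assumes inf: "infinite {k. k \<ge> 1 \<and> a k \<noteq> b k}" and \<epsilon>: "\<epsilon> > 0" and A: "A \<ge> 0"
  shows "(\<lambda>n. \<integral>\<^sup>+\<omega>. emeasure lborel {z\<in>cball 0 A. cmod (\<Sum>k=1..n. 1 / (z - \<xi> k \<omega>)) < exp (- real n * \<epsilon>)} \<partial>M) \<longlonglongrightarrow> 0"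
    and "\<And>n. (\<lambda>\<omega>. emeasure lborel {z\<in>cball 0 A. cmod (\<Sum>k=1..n. 1 / (z - \<xi> k \<omega>)) < exp (- real n * \<epsilon>)}) \<in> borel_measurable M"
proof -
  interpret P: pair_sigma_finite M "lborel :: complex measure" ..
  define f :: "nat \<Rightarrow> 'w \<Rightarrow> complex \<Rightarrow> ennreal" where
    "f n \<omega> z = (if cmod z \<le> A \<and> cmod (\<Sum>k=1..n. 1 / (z - \<xi> k \<omega>)) < exp (- real n * \<epsilon>) then 1 else 0)" for n \<omega> z
  have fm [measurable]: "case_prod (f n) \<in> borel_measurable (M \<Otimes>\<^sub>M lborel)" for n
  proof -
    note [measurable] = log_deriv_measurable[of n]
    show ?thesis unfolding f_def case_prod_beta by measurable
  qed
  have em: "emeasure lborel {z\<in>cball 0 A. cmod (\<Sum>k=1..n. 1 / (z - \<xi> k \<omega>)) < exp (- real n * \<epsilon>)} = (\<integral>\<^sup>+z. f n \<omega> z \<partial>lborel)" for n \<omega>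
  proof -
    have [measurable]: "{z\<in>cball 0 A. cmod (\<Sum>k=1..n. 1 / (z - \<xi> k \<omega>)) < exp (- real n * \<epsilon>)} \<in> sets lborel"
    proof -
      have "{z\<in>cball 0 A. cmod (\<Sum>k=1..n. 1 / (z - \<xi> k \<omega>)) < exp (- real n * \<epsilon>)} =
        cball 0 A \<inter> {z\<in>space borel. cmod (\<Sum>k=1..n. 1 / (z - \<xi> k \<omega>)) < exp (- real n * \<epsilon>)}" by auto
      also have "\<dots> \<in> sets borel" by (intro sets.Int cball_in_sets_borel) measurable
      finally show ?thesis by simp
    qed
    have "(\<integral>\<^sup>+z. f n \<omega> z \<partial>lborel) = (\<integral>\<^sup>+z. indicator {z\<in>cball 0 A. cmod (\<Sum>k=1..n. 1 / (z - \<xi> k \<omega>)) < exp (- real n * \<epsilon>)} z \<partial>lborel)"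
      by (rule nn_integral_cong) (auto simp: f_def)
    then show ?thesis by simp
  qed
  show "(\<lambda>\<omega>. emeasure lborel {z\<in>cball 0 A. cmod (\<Sum>k=1..n. 1 / (z - \<xi> k \<omega>)) < exp (- real n * \<epsilon>)}) \<in> borel_measurable M" for n
    unfolding em by measurable
  have swap: "(\<integral>\<^sup>+\<omega>. \<integral>\<^sup>+z. f n \<omega> z \<partial>lborel \<partial>M) = (\<integral>\<^sup>+z. \<integral>\<^sup>+\<omega>. f n \<omega> z \<partial>M \<partial>lborel)" for n
    by (rule P.Fubini'[OF fm, symmetric])
  have "(\<lambda>n. \<integral>\<^sup>+z. \<integral>\<^sup>+\<omega>. f n \<omega> z \<partial>M \<partial>lborel) \<longlonglongrightarrow> (\<integral>\<^sup>+z. 0 \<partial>(lborel :: complex measure))"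
  proof (rule nn_integral_dominated_convergence[where w="indicator (cball 0 A)"])
    show "(\<lambda>z. \<integral>\<^sup>+\<omega>. f n \<omega> z \<partial>M) \<in> borel_measurable lborel" for n
    proof -
      have "(\<lambda>p. f n (snd p) (fst p)) \<in> borel_measurable (lborel \<Otimes>\<^sub>M M)"
        using measurable_pair_swap[OF fm[of n]] by (simp add: case_prod_beta)
      then show ?thesis by (intro borel_measurable_nn_integral) (simp add: case_prod_beta)
    qed
    show "AE z in lborel. (\<integral>\<^sup>+\<omega>. f n \<omega> z \<partial>M) \<le> indicator (cball 0 A) z" for n
    proof (rule AE_I2)
      fix z :: complex
      have "(\<integral>\<^sup>+\<omega>. f n \<omega> z \<partial>M) \<le> (\<integral>\<^sup>+\<omega>. indicator (cball 0 A) z \<partial>M)"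
        by (rule nn_integral_mono) (auto simp: f_def indicator_def)
      then show "(\<integral>\<^sup>+\<omega>. f n \<omega> z \<partial>M) \<le> indicator (cball 0 A) z" by (simp add: emeasure_space_1)
    qed
    show "(\<integral>\<^sup>+z. indicator (cball (0::complex) A) z \<partial>lborel) < \<infinity>"
      using A by (simp add: emeasure_cball_complex)
    \<comment> \<open>The anticoncentration estimate requires \<open>z\<close> to differ from all
      \<open>a k\<close> and \<open>b k\<close>, which excludes a countable null set.\<close>
    have "countable (range a \<union> range b)" by simp
    then have "range a \<union> range b \<in> null_sets lborel" by (rule countable_imp_null_set_lborel)
    then have "AE z in lborel. z \<notin> range a \<union> range b" by (rule AE_not_in)
    then show "AE z in lborel. (\<lambda>n. \<integral>\<^sup>+\<omega>. f n \<omega> z \<partial>M) \<longlonglongrightarrow> 0"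
    proof eventually_elim
      case (elim z)
      have "(\<lambda>n. prob {\<omega>\<in>space M. cmod (\<Sum>k=1..n. 1 / (z - \<xi> k \<omega>)) < exp (- real n * \<epsilon>)}) \<longlonglongrightarrow> 0"
        using elim by (intro prob_sum_inverse_small_tendsto_0 inf \<epsilon>) auto
      then have lim: "(\<lambda>n. ennreal (prob {\<omega>\<in>space M. cmod (\<Sum>k=1..n. 1 / (z - \<xi> k \<omega>)) < exp (- real n * \<epsilon>)})) \<longlonglongrightarrow> 0"
        by (simp add: ennreal_tendsto_0_iff)
      show ?case
      proof (rule tendsto_sandwich[OF _ _ tendsto_const lim])
        have "(\<integral>\<^sup>+\<omega>. f n \<omega> z \<partial>M) \<le> ennreal (prob {\<omega>\<in>space M. cmod (\<Sum>k=1..n. 1 / (z - \<xi> k \<omega>)) < exp (- real n * \<epsilon>)})" for n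
        proof -
          let ?S = "{\<omega>\<in>space M. cmod (\<Sum>k=1..n. 1 / (z - \<xi> k \<omega>)) < exp (- real n * \<epsilon>)}"
          have S: "?S \<in> sets M" using meas by measurable
          have "(\<integral>\<^sup>+\<omega>. f n \<omega> z \<partial>M) \<le> (\<integral>\<^sup>+\<omega>. indicator ?S \<omega> \<partial>M)"
            by (rule nn_integral_mono) (auto simp: f_def indicator_def)
          also have "\<dots> = emeasure M ?S" by (rule nn_integral_indicator[OF S])
          finally show ?thesis by (simp only: emeasure_eq_measure)
        qed
        then show "eventually (\<lambda>n. (\<integral>\<^sup>+\<omega>. f n \<omega> z \<partial>M) \<le> ennreal (prob {\<omega>\<in>space M. cmod (\<Sum>k=1..n. 1 / (z - \<xi> k \<omega>)) < exp (- real n * \<epsilon>)})) sequentially"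
          by simp
      qed simp
    qed
  qed auto
  then show "(\<lambda>n. \<integral>\<^sup>+\<omega>. emeasure lborel {z\<in>cball 0 A. cmod (\<Sum>k=1..n. 1 / (z - \<xi> k \<omega>)) < exp (- real n * \<epsilon>)} \<partial>M) \<longlonglongrightarrow> 0"
    unfolding em swap by simp
qed

text \<open>The choices are nested: \<open>T\<close> and \<epsilon> depend on \<open>r\<close> alone
  and fix \<open>K\<close>; only then does \<open>n\<close> grow until \<open>K\<close> times the
  expected exceptional area is small.\<close>

lemma nn_expectation_abs_ln_log_deriv_tendsto_0:
  assumes lca: "log_cesaro_bounded a" and lcb: "log_cesaro_bounded b"
    and inf: "infinite {k. k \<ge> 1 \<and> a k \<noteq> b k}" and A: "A \<ge> 0"
  shows "(\<lambda>n. \<integral>\<^sup>+\<omega>. \<integral>\<^sup>+z. ennreal (\<bar>ln (cmod (\<Sum>k=1..n. 1 / (z - \<xi> k \<omega>)))\<bar> / real n) * indicator (cball 0 A) z \<partial>lborel \<partial>M) \<longlonglongrightarrow> 0"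
    (is "?E \<longlonglongrightarrow> 0")
proof (rule ennreal_tendsto_0I)
  fix r :: real assume r: "r > 0"
  obtain Ba where Ba: "Ba \<ge> 0" "\<And>n. (\<Sum>k=1..n. log_plus (cmod (a k))) \<le> real n * Ba"
    using log_cesaro_bounded_sum_le[OF lca] by metis
  obtain Bb where Bb: "Bb \<ge> 0" "\<And>n. (\<Sum>k=1..n. log_plus (cmod (b k))) \<le> real n * Bb"
    using log_cesaro_bounded_sum_le[OF lcb] by metis
  \<comment> \<open>Almost surely \<open>\<xi> k\<close> equals \<open>a k\<close> or
    \<open>b k\<close>, so the sum of the two bounds serves for almost every path.\<close>
  define B where "B = Ba + Bb"
  define q C where "q = pi * A\<^sup>2" and "C = pi * A\<^sup>2 + 4 * pi"
  have q: "q \<ge> 0" and C: "C > 0" by (auto simp: q_def C_def intro: add_nonneg_pos)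
  \<comment> \<open>Since \<open>exp T\<close> exceeds \<open>T\<close>, this value yields
    \<open>exp (- T) * C \<le> r / 4\<close>.\<close>
  define T where "T = 4 * C / r"
  define \<epsilon> where "\<epsilon> = r / (4 * (q + 1))"
  define K where "K = ln (A + 1) + B + T"
  have T: "T \<ge> 0" and \<epsilon>: "\<epsilon> > 0" using r C q by (auto simp: T_def \<epsilon>_def)
  have K: "K \<ge> 0" using T Ba(1) Bb(1) A by (simp add: K_def B_def)
  have T_small: "exp (- T) * C \<le> r / 4"
  proof -
    have "4 * C / r \<le> exp T" using exp_ge_add_one_self[of T] unfolding T_def by linarith
    then have "4 * C \<le> exp T * r" using r by (simp add: divide_le_eq)
    then show ?thesis by (simp add: exp_minus field_simps)
  qed
  have \<epsilon>_small: "\<epsilon> * q \<le> r / 4"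
    using q r by (simp add: \<epsilon>_def divide_simps)
  let ?bad = "\<lambda>n \<omega>. emeasure lborel {z\<in>cball 0 A. cmod (\<Sum>k=1..n. 1 / (z - \<xi> k \<omega>)) < exp (- real n * \<epsilon>)}"
  note bad = nn_integral_prob_small_log_deriv_tendsto_0[OF inf \<epsilon> A]
  have [measurable]: "?bad n \<in> borel_measurable M" for n by (rule bad(2))
  let ?c = "\<lambda>n. (ln (real n) / real n + 1 / (real n)\<^sup>2 + \<epsilon>) * q + C / real n + exp (- T) * C"
  have le: "?E n \<le> ennreal (?c n) + ennreal K * (\<integral>\<^sup>+\<omega>. ?bad n \<omega> \<partial>M)" if n: "n \<ge> 1" for n
  proof -
    have "?E n \<le> (\<integral>\<^sup>+\<omega>. ennreal (?c n) + ennreal K * ?bad n \<omega> \<partial>M)"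
    proof (rule nn_integral_mono_AE)
      show "AE \<omega> in M. (\<integral>\<^sup>+z. ennreal (\<bar>ln (cmod (\<Sum>k=1..n. 1 / (z - \<xi> k \<omega>)))\<bar> / real n) * indicator (cball 0 A) z \<partial>lborel)
          \<le> ennreal (?c n) + ennreal K * ?bad n \<omega>"
        using AE_two_valued
      proof eventually_elim
        case (elim \<omega>)
        have nn: "log_plus t \<ge> 0" for t by (simp add: log_plus_def)
        have "(\<Sum>k=1..n. log_plus (cmod (\<xi> k \<omega>))) \<le> (\<Sum>k=1..n. log_plus (cmod (a k)) + log_plus (cmod (b k)))"
        proof (rule sum_mono)
          fix k assume "k \<in> {1..n}"
          then have "\<xi> k \<omega> = a k \<or> \<xi> k \<omega> = b k" using elim by simp
          then show "log_plus (cmod (\<xi> k \<omega>)) \<le> log_plus (cmod (a k)) + log_plus (cmod (b k))"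
            using nn[of "cmod (a k)"] nn[of "cmod (b k)"] by auto
        qed
        also have "\<dots> \<le> real n * B" using Ba(2)[of n] Bb(2)[of n] by (simp add: sum.distrib B_def distrib_left)
        finally show ?case
          unfolding K_def q_def C_def by (rule nn_integral_abs_ln_log_deriv_le[OF n A _ T \<epsilon>])
      qed
    qed
    also have "\<dots> = ennreal (?c n) + ennreal K * (\<integral>\<^sup>+\<omega>. ?bad n \<omega> \<partial>M)"
    proof -
      have "(\<integral>\<^sup>+\<omega>. G + k * g \<omega> \<partial>M) = G + k * (\<integral>\<^sup>+\<omega>. g \<omega> \<partial>M)" if "g \<in> borel_measurable M" for G k g
        using that by (subst nn_integral_add) (simp_all add: nn_integral_cmult emeasure_space_1)
      from this[OF bad(2)] show ?thesis .
    qed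
    finally show ?thesis .
  qed
  have "?c \<longlonglongrightarrow> (0 + 0 + \<epsilon>) * q + 0 + exp (- T) * C"
  proof (intro tendsto_add tendsto_mult tendsto_const)
    show "(\<lambda>n. ln (real n) / real n) \<longlonglongrightarrow> 0" by real_asymp
    show "(\<lambda>n. 1 / (real n)\<^sup>2) \<longlonglongrightarrow> 0" by real_asymp
    show "(\<lambda>n. C / real n) \<longlonglongrightarrow> 0" by (rule lim_const_over_n)
  qed
  \<comment> \<open>The limit is at most r/2, one quarter of \<open>r\<close> from \<epsilon> and
    one from \<open>T\<close>.\<close>
  then have ev1: "eventually (\<lambda>n. ?c n < 3 * r / 4) sequentially"
    using T_small \<epsilon>_small r by (intro order_tendstoD(2)) auto
  have ev2: "eventually (\<lambda>n. (\<integral>\<^sup>+\<omega>. ?bad n \<omega> \<partial>M) \<le> ennreal (r / (4 * (K + 1)))) sequentially"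
    by (rule ennreal_tendsto_0D[OF bad(1)]) (use r K in simp)
  show "eventually (\<lambda>n. ?E n \<le> ennreal r) sequentially"
    using ev1 ev2 eventually_ge_at_top[of 1]
  proof eventually_elim
    case (elim n)
    have "?E n \<le> ennreal (?c n) + ennreal K * (\<integral>\<^sup>+\<omega>. ?bad n \<omega> \<partial>M)" by (rule le) fact
    also have "\<dots> \<le> ennreal (3 * r / 4) + ennreal K * ennreal (r / (4 * (K + 1)))"
      using elim by (intro add_mono mult_left_mono ennreal_leI) auto
    also have "\<dots> = ennreal (3 * r / 4) + ennreal (K * (r / (4 * (K + 1))))"
      using K r by (subst ennreal_mult) auto
    also have "\<dots> = ennreal (3 * r / 4 + K * (r / (4 * (K + 1))))"
      using K r by (intro ennreal_plus[symmetric]) auto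
    also have "\<dots> \<le> ennreal r"
    proof (rule ennreal_leI)
      have "K * (r / (4 * (K + 1))) \<le> r / 4" by (rule mult_divide_add_1_le) (use K r in auto)
      then show "3 * r / 4 + K * (r / (4 * (K + 1))) \<le> r" by linarith
    qed
    finally show ?case .
  qed
qed

end

section \<open>Empirical measures\<close>

lemma integral_pmf_of_multiset:
  fixes f :: "'a \<Rightarrow> real"
  assumes "Z \<noteq> {#}"
  shows "(\<integral>z. f z \<partial>measure_pmf (pmf_of_multiset Z)) = (\<Sum>z\<in>#Z. f z) / real (size Z)"
proof -
  have *: "(\<Sum>z\<in>#W. f z) = (\<Sum>z\<in>S. f z * real (count W z))" if "finite S" "set_mset W \<subseteq> S" for W S
    using that(2)
  proof (induction W)
    case (add w W)
    then have "(\<Sum>z\<in>S. f z * real (count (add_mset w W) z)) = (\<Sum>z\<in>S. f z * real (count W z) + (if z = w then f z else 0))"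
      by (intro sum.cong) (auto simp: algebra_simps)
    also have "\<dots> = (\<Sum>z\<in>S. f z * real (count W z)) + f w"
      using add.prems that(1) by (simp add: sum.distrib sum.delta)
    finally show ?case using add by simp
  qed simp
  have "(\<integral>z. f z \<partial>measure_pmf (pmf_of_multiset Z)) = (\<Sum>z\<in>set_mset Z. f z * (real (count Z z) / real (size Z)))"
    using assms by (subst integral_measure_pmf_real[of "set_mset Z"]) auto
  also have "\<dots> = (\<Sum>z\<in>#Z. f z) / real (size Z)"
    by (subst *[of "set_mset Z"]) (auto simp: sum_divide_distrib)
  finally show ?thesis .
qed

lemma integral_zero_measure_rand_poly:
  fixes f :: "complex \<Rightarrow> real"
  assumes "n \<ge> 1"
  shows "(\<integral>z. f z \<partial>zero_measure (rand_poly x n)) = (\<Sum>k=1..n. f (x k)) / real n"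
proof -
  have "{1..n} \<noteq> {}" using assms by auto
  then have "image_mset x (mset_set {1..n}) \<noteq> {#}" by (simp add: mset_set_empty_iff)
  then show ?thesis
    unfolding zero_measure_def proots_rand_poly
    by (subst integral_pmf_of_multiset)
       (auto simp: image_mset.compositionality o_def sum_unfold_sum_mset)
qed

text \<open>For \<open>n = 1\<close> the derivative is constant and has an empty multiset of zeros,
  to which no uniform distribution belongs; hence \<open>n \<ge> 2\<close>.\<close>

lemma integral_zero_measure_pderiv_rand_poly:
  fixes f :: "complex \<Rightarrow> real"
  assumes "n \<ge> 2"
  shows "(\<integral>z. f z \<partial>zero_measure (pderiv (rand_poly x n))) = (\<Sum>\<zeta>\<in>#proots (pderiv (rand_poly x n)). f \<zeta>) / real (n - 1)"
proof -
  have "size (proots (pderiv (rand_poly x n))) \<noteq> 0"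
    unfolding size_proots_pderiv_rand_poly using assms by simp
  then have "proots (pderiv (rand_poly x n)) \<noteq> {#}" by fastforce
  then show ?thesis
    unfolding zero_measure_def by (subst integral_pmf_of_multiset) (auto simp: size_proots_pderiv_rand_poly)
qed

text \<open>Integrating \<open>\<phi>\<close> against \<open>ln \<bar>P' / P\<bar>\<close> compares the zeros of \<open>P'\<close> and \<open>P\<close> on the potential of \<open>\<phi>\<close>.\<close>

locale log_potential_test =
  fixes \<phi> :: "complex \<Rightarrow> real" and A B :: real
  assumes phi_measurable [measurable]: "\<phi> \<in> borel_measurable borel"
    and phi_bound: "\<And>z. \<bar>\<phi> z\<bar> \<le> B" and phi_support: "\<And>z. cmod z > A \<Longrightarrow> \<phi> z = 0" and A_nonneg: "A \<ge> 0"
begin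

definition pot :: "complex \<Rightarrow> real" where
  "pot w = (\<integral>z. ln (cmod (z - w)) * \<phi> z \<partial>lborel)"

lemma B_nonneg: "B \<ge> 0"
  using phi_bound[of 0] by linarith

lemma integrable_ln_dist_phi: "integrable lborel (\<lambda>z. ln (cmod (z - w)) * \<phi> z)"
  by (rule integrable_ln_dist_mult[OF phi_measurable phi_bound phi_support A_nonneg])

lemma sum_pot:
  "integrable lborel (\<lambda>z. (\<Sum>\<zeta>\<in>#Z. ln (cmod (z - \<zeta>))) * \<phi> z) \<and>
   (\<Sum>\<zeta>\<in>#Z. pot \<zeta>) = (\<integral>z. (\<Sum>\<zeta>\<in>#Z. ln (cmod (z - \<zeta>))) * \<phi> z \<partial>lborel)"
proof (induction Z)
  case (add \<zeta> Z)
  then show ?case using integrable_ln_dist_phi[of \<zeta>] by (simp add: distrib_right pot_def)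
qed simp

text \<open>\<open>ln_norm_log_deriv\<close> holds off the finitely many zeros of both polynomials.
  Its sums of logarithmic kernels are integrable against \<open>\<phi>\<close>, which also supplies
  the integrability of the logarithmic derivative term.\<close>

lemma sum_pot_pderiv:
  fixes x :: "nat \<Rightarrow> complex"
  assumes n: "n \<ge> 1"
  shows "integrable lborel (\<lambda>z. (ln (cmod (\<Sum>k=1..n. 1 / (z - x k))) - ln (real n)) * \<phi> z)"
    and "(\<Sum>\<zeta>\<in>#proots (pderiv (rand_poly x n)). pot \<zeta>) - (\<Sum>k=1..n. pot (x k)) =
      (\<integral>z. (ln (cmod (\<Sum>k=1..n. 1 / (z - x k))) - ln (real n)) * \<phi> z \<partial>lborel)"
proof -
  define Z where "Z = proots (pderiv (rand_poly x n))"
  define X where "X = image_mset x (mset_set {1..n})"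
  let ?L = "\<lambda>z. \<Sum>k=1..n. 1 / (z - x k)"
  let ?h = "\<lambda>Z z. \<Sum>\<zeta>\<in>#Z. ln (cmod (z - \<zeta>))"
  have X: "(\<Sum>\<zeta>\<in>#X. g \<zeta>) = (\<Sum>k=1..n. g (x k))" for g :: "complex \<Rightarrow> real"
    by (simp add: X_def image_mset.compositionality o_def sum_unfold_sum_mset)
  have int: "integrable lborel (\<lambda>z. ?h Z z * \<phi> z - ?h X z * \<phi> z)"
    using sum_pot[of Z] sum_pot[of X] by (intro Bochner_Integration.integrable_diff) auto
  have ae: "AE z in lborel. ?h Z z * \<phi> z - ?h X z * \<phi> z = (ln (cmod (?L z)) - ln (real n)) * \<phi> z"
  proof -
    have "AE z in lborel. poly (rand_poly x n) z \<noteq> 0" by (rule AE_not_proots) (rule rand_poly_nonzero)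
    moreover have "AE z in lborel. poly (pderiv (rand_poly x n)) z \<noteq> 0"
      by (rule AE_not_proots) (rule pderiv_rand_poly_nonzero[OF n])
    ultimately show ?thesis
    proof eventually_elim
      case (elim z)
      have "ln (cmod (?L z)) = ln (real n) + ?h Z z - (\<Sum>k=1..n. ln (cmod (z - x k)))"
        unfolding Z_def by (rule ln_norm_log_deriv) (use n elim in \<open>auto simp: poly_rand_poly\<close>)
      then have "ln (cmod (?L z)) - ln (real n) = ?h Z z - ?h X z" unfolding X by simp
      then show ?case by (simp add: left_diff_distrib)
    qed
  qed
  have m: "(\<lambda>z. (ln (cmod (?L z)) - ln (real n)) * \<phi> z) \<in> borel_measurable lborel" by measurable
  show "integrable lborel (\<lambda>z. (ln (cmod (?L z)) - ln (real n)) * \<phi> z)"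
    using int by (subst integrable_cong_AE[symmetric, OF borel_measurable_integrable[OF int] m ae])
  have "(\<Sum>\<zeta>\<in>#Z. pot \<zeta>) - (\<Sum>\<zeta>\<in>#X. pot \<zeta>) = (\<integral>z. ?h Z z * \<phi> z - ?h X z * \<phi> z \<partial>lborel)"
    using sum_pot[of Z] sum_pot[of X] by simp
  also have "\<dots> = (\<integral>z. (ln (cmod (?L z)) - ln (real n)) * \<phi> z \<partial>lborel)"
    by (rule integral_cong_AE[OF borel_measurable_integrable[OF int] m ae])
  finally show "(\<Sum>\<zeta>\<in>#proots (pderiv (rand_poly x n)). pot \<zeta>) - (\<Sum>k=1..n. pot (x k)) =
      (\<integral>z. (ln (cmod (?L z)) - ln (real n)) * \<phi> z \<partial>lborel)"
    unfolding X Z_def .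
qed

lemma abs_sum_mset_diff_le:
  fixes f g :: "'a \<Rightarrow> real"
  assumes "\<And>z. \<bar>f z - g z\<bar> \<le> \<epsilon>"
  shows "\<bar>(\<Sum>z\<in>#Z. f z) - (\<Sum>z\<in>#Z. g z)\<bar> \<le> real (size Z) * \<epsilon>"
proof (induction Z)
  case (add w Z)
  then show ?case using assms[of w] by (simp add: algebra_simps)
qed simp

text \<open>\<open>2 * \<epsilon>\<close> pays for replacing \<open>f\<close> by the potential at
  both sets of zeros, \<open>F / real n\<close> for the weight 1/(n-1) against 1/n, and the term
  with \<open>ln (real n)\<close> for the leading coefficient of P'.\<close>

lemma zeros_pderiv_close:
  fixes x :: "nat \<Rightarrow> complex" and f :: "complex \<Rightarrow> real"
  assumes n: "n \<ge> 2" and f: "\<And>z. \<bar>f z - pot z\<bar> \<le> \<epsilon>" "\<And>z. \<bar>f z\<bar> \<le> F"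
  shows "ennreal \<bar>(\<integral>z. f z \<partial>zero_measure (pderiv (rand_poly x n))) - (\<Sum>k=1..n. f (x k)) / real n\<bar> \<le>
    ennreal (2 * \<epsilon> + F / real n + B * (ln (real n) / real n * (pi * A\<^sup>2)))
    + ennreal B * (\<integral>\<^sup>+z. ennreal (\<bar>ln (cmod (\<Sum>k=1..n. 1 / (z - x k)))\<bar> / real n) * indicator (cball 0 A) z \<partial>lborel)"
proof -
  define Z where "Z = proots (pderiv (rand_poly x n))"
  define N where "N = real n"
  have N: "N \<ge> 2" using n by (simp add: N_def)
  have sz: "real (size Z) = N - 1" using n by (simp add: Z_def N_def size_proots_pderiv_rand_poly of_nat_diff)
  let ?L = "\<lambda>z. \<Sum>k=1..n. 1 / (z - x k)"
  let ?J = "\<integral>\<^sup>+z. ennreal (\<bar>ln (cmod (?L z))\<bar> / real n) * indicator (cball 0 A) z \<partial>lborel"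
  let ?g = "\<lambda>z. (ln (cmod (?L z)) - ln N) * \<phi> z"
  have [measurable]: "?L \<in> borel_measurable borel" by measurable
  have \<epsilon>: "\<epsilon> \<ge> 0" and F: "F \<ge> 0" using f(1)[of 0] f(2)[of 0] by linarith+
  define sZ uZ sX uX where "sZ = (\<Sum>\<zeta>\<in>#Z. f \<zeta>)" and "uZ = (\<Sum>\<zeta>\<in>#Z. pot \<zeta>)"
    and "sX = (\<Sum>k=1..n. f (x k))" and "uX = (\<Sum>k=1..n. pot (x k))"
  define D where "D = uZ - uX"
  have D: "D = (\<integral>z. ?g z \<partial>lborel)"
    unfolding D_def uZ_def uX_def Z_def N_def by (rule sum_pot_pderiv) (use n in auto)
  have eZ: "\<bar>sZ - uZ\<bar> \<le> (N - 1) * \<epsilon>"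
    unfolding sZ_def uZ_def sz[symmetric] by (rule abs_sum_mset_diff_le) (rule f)
  have eX: "\<bar>sX - uX\<bar> \<le> N * \<epsilon>"
  proof -
    have "\<bar>sX - uX\<bar> \<le> (\<Sum>k=1..n. \<bar>f (x k) - pot (x k)\<bar>)"
      unfolding sX_def uX_def sum_subtractf[symmetric] by (rule sum_abs)
    also have "\<dots> \<le> (\<Sum>k=1..n. \<epsilon>)" by (intro sum_mono f)
    finally show ?thesis by (simp add: N_def)
  qed
  have sF: "\<bar>sZ\<bar> \<le> (N - 1) * F"
    using abs_sum_mset_diff_le[of f "\<lambda>_. 0" F Z] f(2) by (simp add: sZ_def sz[symmetric])
  \<comment> \<open>Changing the weight from 1/(N-1) to 1/N costs the first term, which is at most
    F/N because there are N-1 zeros.\<close>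
  have "sZ / (N - 1) - sX / N = sZ / (N - 1) / N + (sZ - uZ) / N + (uX - sX) / N + D / N"
    using N by (simp add: D_def field_simps)
  also have "\<bar>\<dots>\<bar> \<le> F / N + \<epsilon> + \<epsilon> + \<bar>D\<bar> / N"
  proof -
    have "\<bar>sZ / (N - 1) / N\<bar> \<le> F / N"
      using sF N by (simp add: abs_divide divide_simps mult.commute)
    moreover have "\<bar>(sZ - uZ) / N\<bar> \<le> \<epsilon>"
    proof -
      have "(N - 1) * \<epsilon> \<le> N * \<epsilon>" using \<epsilon> by (intro mult_right_mono) auto
      then have "\<bar>sZ - uZ\<bar> \<le> N * \<epsilon>" using eZ by linarith
      then show ?thesis using N by (simp add: abs_divide divide_le_eq mult.commute)
    qed
    moreover have "\<bar>(uX - sX) / N\<bar> \<le> \<epsilon>"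
      using eX N by (simp add: abs_divide divide_le_eq mult.commute abs_minus_commute)
    moreover have "\<bar>D / N\<bar> \<le> \<bar>D\<bar> / N" using N by (simp add: abs_divide)
    moreover have "\<bar>p + q + r + s\<bar> \<le> p' + q' + r' + s'"
      if "\<bar>p\<bar> \<le> p'" "\<bar>q\<bar> \<le> q'" "\<bar>r\<bar> \<le> r'" "\<bar>s\<bar> \<le> s'" for p q r s p' q' r' s' :: real
      using that by linarith
    ultimately show ?thesis by blast
  qed
  finally have main: "\<bar>sZ / (N - 1) - sX / N\<bar> \<le> 2 * \<epsilon> + F / N + \<bar>D\<bar> / N" by simp
  have DN: "ennreal (\<bar>D\<bar> / N) \<le> ennreal (B * (ln N / N * (pi * A\<^sup>2))) + ennreal B * ?J"
  proof -
    have int: "integrable lborel (\<lambda>z. ?g z / N)"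
      using sum_pot_pderiv(1)[of n x] n by (simp add: N_def)
    have "\<bar>D\<bar> / N = norm (\<integral>z. ?g z / N \<partial>lborel)" using N by (simp add: D)
    then have "ennreal (\<bar>D\<bar> / N) \<le> (\<integral>\<^sup>+z. ennreal (norm (?g z / N)) \<partial>lborel)"
      using integral_norm_bound_ennreal[OF int] by simp
    also have "\<dots> \<le> (\<integral>\<^sup>+z. ennreal (B * (ln N / N)) * indicator (cball 0 A) z
        + ennreal B * (ennreal (\<bar>ln (cmod (?L z))\<bar> / real n) * indicator (cball 0 A) z) \<partial>lborel)"
    proof (rule nn_integral_mono)
      fix z
      show "ennreal (norm (?g z / N)) \<le> ennreal (B * (ln N / N)) * indicator (cball 0 A) z
        + ennreal B * (ennreal (\<bar>ln (cmod (?L z))\<bar> / real n) * indicator (cball 0 A) z)"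
      proof (cases "cmod z \<le> A")
        case True
        have "norm (?g z / N) = \<bar>ln (cmod (?L z)) - ln N\<bar> * \<bar>\<phi> z\<bar> / N"
          using N by (simp add: abs_mult)
        also have "\<dots> \<le> (\<bar>ln (cmod (?L z))\<bar> + ln N) * B / N"
        proof (intro divide_right_mono mult_mono)
          have "ln N \<ge> 0" using N by simp
          then show "\<bar>ln (cmod (?L z)) - ln N\<bar> \<le> \<bar>ln (cmod (?L z))\<bar> + ln N"
            "0 \<le> \<bar>ln (cmod (?L z))\<bar> + ln N" by linarith+
        qed (use N phi_bound in auto)
        also have "\<dots> = B * (ln N / N) + B * (\<bar>ln (cmod (?L z))\<bar> / N)"
          by (simp add: algebra_simps add_divide_distrib)
        finally have "ennreal (norm (?g z / N)) \<le> ennreal (B * (ln N / N) + B * (\<bar>ln (cmod (?L z))\<bar> / N))"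
          by (rule ennreal_leI)
        also have "\<dots> = ennreal (B * (ln N / N)) + ennreal B * ennreal (\<bar>ln (cmod (?L z))\<bar> / N)"
          using ennreal_combine[of "B * (ln N / N)" B "\<bar>ln (cmod (?L z))\<bar> / N" 0 0 0 0] N B_nonneg by simp
        finally show ?thesis using True by (simp add: N_def)
      next
        case False
        then show ?thesis using phi_support[of z] by simp
      qed
    qed
    also have "\<dots> = ennreal (B * (ln N / N)) * emeasure lborel (cball (0::complex) A) + ennreal B * ?J"
      by (simp add: nn_integral_add nn_integral_cmult)
    also have "ennreal (B * (ln N / N)) * emeasure lborel (cball (0::complex) A) = ennreal (B * (ln N / N) * (pi * A\<^sup>2))"
      unfolding emeasure_cball_complex[OF A_nonneg] using B_nonneg N by (intro ennreal_mult[symmetric]) auto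
    also have "B * (ln N / N) * (pi * A\<^sup>2) = B * (ln N / N * (pi * A\<^sup>2))" by simp
    finally show ?thesis .
  qed
  have "(\<integral>z. f z \<partial>zero_measure (pderiv (rand_poly x n))) = sZ / (N - 1)"
    using integral_zero_measure_pderiv_rand_poly[OF n, of x f] n by (simp add: sZ_def Z_def N_def of_nat_diff)
  then have "ennreal \<bar>(\<integral>z. f z \<partial>zero_measure (pderiv (rand_poly x n))) - (\<Sum>k=1..n. f (x k)) / real n\<bar> \<le>
     ennreal (2 * \<epsilon> + F / N + \<bar>D\<bar> / N)"
    using main by (intro ennreal_leI) (simp add: sX_def N_def)
  also have "\<dots> = ennreal (2 * \<epsilon> + F / N) + ennreal (\<bar>D\<bar> / N)"
    using \<epsilon> F N by (intro ennreal_plus) auto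
  also have "\<dots> \<le> ennreal (2 * \<epsilon> + F / N) + (ennreal (B * (ln N / N * (pi * A\<^sup>2))) + ennreal B * ?J)"
    by (intro add_left_mono DN)
  also have "\<dots> = ennreal (2 * \<epsilon> + F / N + B * (ln N / N * (pi * A\<^sup>2))) + ennreal B * ?J"
    using \<epsilon> F N B_nonneg by (subst ennreal_plus[of "2 * \<epsilon> + F / N"]) (auto simp: add.assoc)
  finally show ?thesis by (simp add: N_def)
qed

end


section \<open>Convergence of the zeros\<close>

lemma (in prob_space) nn_integral_Markov_real:
  fixes X :: "'a \<Rightarrow> real"
  assumes [measurable]: "X \<in> borel_measurable M" and "e > 0"
  shows "ennreal (prob {\<omega>\<in>space M. X \<omega> \<ge> e}) \<le> ennreal (1 / e) * (\<integral>\<^sup>+\<omega>. ennreal (X \<omega>) \<partial>M)"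
proof -
  have "{\<omega>\<in>space M. X \<omega> \<ge> e} \<subseteq> {\<omega>\<in>space M. 1 \<le> ennreal (1 / e) * ennreal (X \<omega>)}"
  proof safe
    fix \<omega> assume "e \<le> X \<omega>"
    then have "1 \<le> 1 / e * X \<omega>" using assms(2) by (simp add: field_simps)
    then have "ennreal 1 \<le> ennreal (1 / e * X \<omega>)" by (rule ennreal_leI)
    also have "\<dots> = ennreal (1 / e) * ennreal (X \<omega>)" using assms(2) \<open>e \<le> X \<omega>\<close> by (intro ennreal_mult) auto
    finally show "1 \<le> ennreal (1 / e) * ennreal (X \<omega>)" by simp
  qed
  then have "emeasure M {\<omega>\<in>space M. X \<omega> \<ge> e} \<le> emeasure M {\<omega>\<in>space M. 1 \<le> ennreal (1 / e) * ennreal (X \<omega>)}"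
    by (intro emeasure_mono) measurable
  also have "\<dots> \<le> ennreal (1 / e) * (\<integral>\<^sup>+\<omega>. ennreal (X \<omega>) * indicator (space M) \<omega> \<partial>M)"
    by (rule nn_integral_Markov_inequality) auto
  also have "(\<integral>\<^sup>+\<omega>. ennreal (X \<omega>) * indicator (space M) \<omega> \<partial>M) = (\<integral>\<^sup>+\<omega>. ennreal (X \<omega>) \<partial>M)"
    by (rule nn_integral_cong) simp
  finally show ?thesis by (simp add: emeasure_eq_measure)
qed

text \<open>Existential form of \<open>log_potential_approx\<close>, so that a test can be chosen
  for every tolerance at once.\<close>

lemma log_potential_test_exists:
  fixes f :: "complex \<Rightarrow> real"
  assumes "continuous_on UNIV f" "\<And>z. cmod z > R \<Longrightarrow> f z = 0" "\<epsilon> > 0"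
  shows "\<exists>\<phi> A B. log_potential_test \<phi> A B \<and> (\<forall>w. \<bar>f w - log_potential_test.pot \<phi> w\<bar> \<le> \<epsilon>)"
proof -
  show ?thesis
  proof (rule log_potential_approx[OF assms])
    fix \<phi> A B
    assume *: "\<phi> \<in> borel_measurable borel" "\<And>z. \<bar>\<phi> z\<bar> \<le> B" "\<And>z. cmod z > A \<Longrightarrow> \<phi> z = 0" "A \<ge> 0"
      "\<And>w. \<bar>f w - (\<integral>z. ln (cmod (z - w)) * \<phi> z \<partial>lborel)\<bar> \<le> \<epsilon>"
    have t: "log_potential_test \<phi> A B" by unfold_locales (fact *)+
    then have "\<forall>w. \<bar>f w - log_potential_test.pot \<phi> w\<bar> \<le> \<epsilon>"
      using *(5) by (simp add: log_potential_test.pot_def[OF t])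
    with t show ?thesis by blast
  qed
qed

section \<open>Measurability of averages over the zeros of P'\<close>

context two_valued_sequence
begin

text \<open>No measurable enumeration of the zeros is constructed. For a potential, the sum over the
  zeros equals an integral of ln|L| plus a sum over the \<open>\<xi> k\<close>, both measurable;
  \<open>f\<close> is a uniform limit of potentials and the number of zeros is fixed.\<close>

lemma zeros_pderiv_measurable_compact_support:
  fixes f :: "complex \<Rightarrow> real"
  assumes f: "continuous_on UNIV f" "\<And>z. cmod z > R \<Longrightarrow> f z = 0" and n: "n \<ge> 2"
  shows "(\<lambda>\<omega>. \<integral>z. f z \<partial>zero_measure (pderiv (rand_poly (\<lambda>k. \<xi> k \<omega>) n))) \<in> borel_measurable M"
proof -
  have "\<forall>m. \<exists>\<phi> A B. log_potential_test \<phi> A B \<and> (\<forall>w. \<bar>f w - log_potential_test.pot \<phi> w\<bar> \<le> 1 / real (Suc m))"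
    by (intro allI log_potential_test_exists[OF f]) auto
  then obtain \<phi> A B where \<phi>: "\<And>m. log_potential_test (\<phi> m) (A m) (B m)"
    "\<And>m w. \<bar>f w - log_potential_test.pot (\<phi> m) w\<bar> \<le> 1 / real (Suc m)"
    by metis
  define Z where "Z \<omega> = proots (pderiv (rand_poly (\<lambda>k. \<xi> k \<omega>) n))" for \<omega>
  define V where "V m \<omega> = (\<integral>z. (ln (cmod (\<Sum>k=1..n. 1 / (z - \<xi> k \<omega>))) - ln (real n)) * \<phi> m z \<partial>lborel)
     + (\<Sum>k=1..n. log_potential_test.pot (\<phi> m) (\<xi> k \<omega>))" for m \<omega>
  have V_eq: "V m \<omega> = (\<Sum>\<zeta>\<in>#Z \<omega>. log_potential_test.pot (\<phi> m) \<zeta>)" for m \<omega>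
    using log_potential_test.sum_pot_pderiv(2)[OF \<phi>(1), of n m "\<lambda>k. \<xi> k \<omega>"] n by (simp add: V_def Z_def)
  have V_meas: "V m \<in> borel_measurable M" for m
  proof -
    interpret log_potential_test "\<phi> m" "A m" "B m" by (rule \<phi>(1))
    note [measurable] = log_deriv_measurable[of n]
    have [measurable]: "(\<lambda>\<omega>. \<integral>z. (ln (cmod (\<Sum>k=1..n. 1 / (z - \<xi> k \<omega>))) - ln (real n)) * \<phi> m z \<partial>lborel) \<in> borel_measurable M"
      by (rule lborel.borel_measurable_lebesgue_integral) (unfold case_prod_beta, measurable)
    have pm [measurable]: "pot \<in> borel_measurable borel"
      unfolding pot_def[abs_def] by (rule lborel.borel_measurable_lebesgue_integral) (unfold case_prod_beta, measurable)
    have [measurable]: "(\<lambda>\<omega>. \<Sum>k=1..n. pot (\<xi> k \<omega>)) \<in> borel_measurable M"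
      by (intro borel_measurable_sum measurable_compose[OF meas pm]) simp
    show ?thesis unfolding V_def[abs_def] by measurable
  qed
  have "(\<lambda>\<omega>. \<Sum>\<zeta>\<in>#Z \<omega>. f \<zeta>) \<in> borel_measurable M"
  proof (rule borel_measurable_LIMSEQ_real[OF _ V_meas])
    fix \<omega>
    have "\<bar>(\<Sum>\<zeta>\<in>#Z \<omega>. f \<zeta>) - V m \<omega>\<bar> \<le> real (size (Z \<omega>)) * (1 / real (Suc m))" for m
      unfolding V_eq by (rule log_potential_test.abs_sum_mset_diff_le[OF \<phi>(1) \<phi>(2)])
    then have *: "norm (V m \<omega> - (\<Sum>\<zeta>\<in>#Z \<omega>. f \<zeta>)) \<le> real (size (Z \<omega>)) * (1 / real (Suc m))" for m
      by (simp add: abs_minus_commute)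
    have "(\<lambda>m. real (size (Z \<omega>)) * (1 / real (Suc m))) \<longlonglongrightarrow> real (size (Z \<omega>)) * 0"
      by (intro tendsto_mult tendsto_const) real_asymp
    then have "(\<lambda>m. V m \<omega> - (\<Sum>\<zeta>\<in>#Z \<omega>. f \<zeta>)) \<longlonglongrightarrow> 0"
      by (intro Lim_null_comparison[OF always_eventually[OF allI[OF *]]]) simp
    then show "(\<lambda>m. V m \<omega>) \<longlonglongrightarrow> (\<Sum>\<zeta>\<in>#Z \<omega>. f \<zeta>)" by (simp add: LIM_zero_iff)
  qed
  then show ?thesis
    unfolding integral_zero_measure_pderiv_rand_poly[OF n] Z_def by simp
qed

text \<open>For each path, dominated convergence over the cutoffs writes the integral as a limit of
  the compactly supported case.\<close>

lemma zeros_pderiv_measurable: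
  fixes f :: "complex \<Rightarrow> real"
  assumes f: "continuous_on UNIV f" "\<And>z. \<bar>f z\<bar> \<le> B" and n: "n \<ge> 2"
  shows "(\<lambda>\<omega>. \<integral>z. f z \<partial>zero_measure (pderiv (rand_poly (\<lambda>k. \<xi> k \<omega>) n))) \<in> borel_measurable M"
proof (rule borel_measurable_LIMSEQ_real)
  have B: "B \<ge> 0" using f(2)[of 0] by linarith
  show "(\<lambda>\<omega>. \<integral>z. f z * cutoff m z \<partial>zero_measure (pderiv (rand_poly (\<lambda>k. \<xi> k \<omega>) n))) \<in> borel_measurable M" for m
  proof (rule zeros_pderiv_measurable_compact_support[OF _ _ n])
    show "continuous_on UNIV (\<lambda>z. f z * cutoff m z)" by (intro continuous_intros f)
    show "f z * cutoff m z = 0" if "cmod z > real m + 1" for z using cutoff_support[OF that] by simp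
  qed
  fix \<omega>
  show "(\<lambda>m. \<integral>z. f z * cutoff m z \<partial>zero_measure (pderiv (rand_poly (\<lambda>k. \<xi> k \<omega>) n))) \<longlonglongrightarrow>
     (\<integral>z. f z \<partial>zero_measure (pderiv (rand_poly (\<lambda>k. \<xi> k \<omega>) n)))"
    unfolding zero_measure_def
  proof (rule integral_dominated_convergence[where w="\<lambda>_. B"])
    show "AE z in measure_pmf p. (\<lambda>m. f z * cutoff m z) \<longlonglongrightarrow> f z" for p
    proof (rule AE_I2)
      fix z show "(\<lambda>m. f z * cutoff m z) \<longlonglongrightarrow> f z"
        using tendsto_mult[OF tendsto_const cutoff_tendsto_1, of "f z" z] by simp
    qed
    show "AE z in measure_pmf p. norm (f z * cutoff m z) \<le> B" for p m
    proof (rule AE_I2)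
      fix z
      have "\<bar>f z\<bar> * \<bar>cutoff m z\<bar> \<le> B * 1" using f(2) cutoff_bounds B by (intro mult_mono) auto
      then show "norm (f z * cutoff m z) \<le> B" by (simp add: abs_mult)
    qed
  qed auto
qed

end

locale random_zeros = two_valued_sequence M a b \<xi> + mu: borel_prob_complex \<mu>
  for M :: "'w measure" and a b \<xi> and \<mu> :: "complex measure" +
  assumes mu_dist: "mu_distributed \<mu> a" "mu_distributed \<mu> b"
    and log_bounded: "log_cesaro_bounded a" "log_cesaro_bounded b"
    and infinite_diff: "infinite {k. k \<ge> 1 \<and> a k \<noteq> b k}"
begin

text \<open>The strong law compares the random averages with the mean of the averages along
  \<open>a\<close> and \<open>b\<close>; both converge to the integral against \<open>\<mu>\<close>,
  since \<open>flat_span\<close> lies in \<open>Cc_inf\<close>.\<close>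

lemma AE_weak_conv_zeros: "AE \<omega> in M. weak_conv_c (\<lambda>n. zero_measure (rand_poly (\<lambda>k. \<xi> k \<omega>) n)) \<mu>"
proof -
  have "AE \<omega> in M. (\<lambda>n. (\<Sum>k=1..n. g (\<xi> k \<omega>)) / real n) \<longlonglongrightarrow> (\<integral>z. g z \<partial>\<mu>)"
    if g: "flat_span s g" for s g
  proof -
    obtain C where C: "\<And>z. \<bar>g z\<bar> \<le> C" using flat_span_bounded[OF g] by blast
    have gm: "g \<in> borel_measurable borel"
      using flat_span_continuous[OF g] by (rule borel_measurable_continuous_onI)
    have "(\<lambda>n. (\<Sum>k=1..n. g (a k)) / real n) \<longlonglongrightarrow> (\<integral>z. g z \<partial>\<mu>)" "(\<lambda>n. (\<Sum>k=1..n. g (b k)) / real n) \<longlonglongrightarrow> (\<integral>z. g z \<partial>\<mu>)"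
      using mu_dist flat_span_Cc_inf[OF g] unfolding mu_distributed_def by auto
    from tendsto_divide[OF tendsto_add[OF this] tendsto_const[of 2]]
    have mean: "(\<lambda>n. (\<Sum>k=1..n. (g (a k) + g (b k)) / 2) / real n) \<longlonglongrightarrow> (\<integral>z. g z \<partial>\<mu>)"
      by (simp add: sum.distrib add_divide_distrib sum_divide_distrib mult.commute)
    show ?thesis
      using strong_law_bounded[OF gm C]
    proof eventually_elim
      case (elim \<omega>)
      show ?case using tendsto_add[OF elim mean] by (simp add: diff_divide_distrib)
    qed
  qed
  \<comment> \<open>Natural indices only: the exceptional null sets form a countable family and
    unite to one.\<close>
  then have "AE \<omega> in M. \<forall>s i j m. (\<lambda>n. (\<Sum>k=1..n. flat_monomial (real s) i j m (\<xi> k \<omega>)) / real n) \<longlonglongrightarrow>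
      (\<integral>z. flat_monomial (real s) i j m z \<partial>\<mu>)"
    unfolding AE_all_countable using flat_span.flat_monomial by blast
  then show ?thesis
  proof eventually_elim
    case (elim \<omega>)
    show ?case unfolding zero_measure_def
    proof (rule mu.weak_conv_flat_span)
      fix s i j m
      have "eventually (\<lambda>n. (\<Sum>k=1..n. flat_monomial (real s) i j m (\<xi> k \<omega>)) / real n =
        (\<integral>z. flat_monomial (real s) i j m z \<partial>measure_pmf (pmf_of_multiset (proots (rand_poly (\<lambda>k. \<xi> k \<omega>) n))))) sequentially"
        using eventually_ge_at_top[of 1]
        by eventually_elim (use integral_zero_measure_rand_poly in \<open>simp add: zero_measure_def\<close>)
      from Lim_transform_eventually[OF elim[rule_format] this]
      show "(\<lambda>n. \<integral>z. flat_monomial (real s) i j m z \<partial>measure_pmf (pmf_of_multiset (proots (rand_poly (\<lambda>k. \<xi> k \<omega>) n)))) \<longlonglongrightarrow>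
        (\<integral>z. flat_monomial (real s) i j m z \<partial>\<mu>)" .
    qed
  qed
qed

text \<open>Almost sure convergence of averages bounded by \<open>F\<close> gives convergence in
  mean, with \<open>2 * F\<close> as dominating constant.\<close>

lemma nn_expectation_zeros_tendsto_0:
  fixes f :: "complex \<Rightarrow> real"
  assumes f: "continuous_on UNIV f" "\<And>z. \<bar>f z\<bar> \<le> F"
  shows "(\<lambda>n. \<integral>\<^sup>+\<omega>. ennreal \<bar>(\<Sum>k=1..n. f (\<xi> k \<omega>)) / real n - (\<integral>z. f z \<partial>\<mu>)\<bar> \<partial>M) \<longlonglongrightarrow> 0"
proof -
  have fm: "f \<in> borel_measurable borel" using f(1) by (rule borel_measurable_continuous_onI)
  have m: "(\<lambda>\<omega>. \<Sum>k=1..n. f (\<xi> k \<omega>)) \<in> borel_measurable M" for n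
    by (intro borel_measurable_sum measurable_compose[OF meas fm]) simp
  have F: "F \<ge> 0" using f(2)[of 0] by linarith
  have mu_le: "\<bar>\<integral>z. f z \<partial>\<mu>\<bar> \<le> F"
  proof -
    have "\<bar>\<integral>z. f z \<partial>\<mu>\<bar> \<le> (\<integral>z. F \<partial>\<mu>)"
      by (rule integral_abs_bound_integral) (use f in \<open>auto intro: mu.integrable_continuous_bounded\<close>)
    then show ?thesis by (simp add: mu.prob_space)
  qed
  have "(\<lambda>n. \<integral>\<^sup>+\<omega>. ennreal \<bar>(\<Sum>k=1..n. f (\<xi> k \<omega>)) / real n - (\<integral>z. f z \<partial>\<mu>)\<bar> \<partial>M) \<longlonglongrightarrow> (\<integral>\<^sup>+\<omega>. 0 \<partial>M)"
  proof (rule nn_integral_dominated_convergence[where w="\<lambda>_. ennreal (2 * F)"])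
    show "(\<lambda>\<omega>. ennreal \<bar>(\<Sum>k=1..n. f (\<xi> k \<omega>)) / real n - (\<integral>z. f z \<partial>\<mu>)\<bar>) \<in> borel_measurable M" for n
      using m[of n] by measurable
    show "AE \<omega> in M. ennreal \<bar>(\<Sum>k=1..n. f (\<xi> k \<omega>)) / real n - (\<integral>z. f z \<partial>\<mu>)\<bar> \<le> ennreal (2 * F)" for n
    proof (intro AE_I2 ennreal_leI)
      fix \<omega>
      have "\<bar>\<Sum>k=1..n. f (\<xi> k \<omega>)\<bar> \<le> (\<Sum>k=1..n. F)"
        by (rule order_trans[OF sum_abs]) (intro sum_mono f)
      then have "\<bar>(\<Sum>k=1..n. f (\<xi> k \<omega>)) / real n\<bar> \<le> F"
        using F by (cases "n = 0") (simp_all add: abs_divide divide_le_eq mult.commute)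
      then show "\<bar>(\<Sum>k=1..n. f (\<xi> k \<omega>)) / real n - (\<integral>z. f z \<partial>\<mu>)\<bar> \<le> 2 * F"
        using mu_le by linarith
    qed
    show "AE \<omega> in M. (\<lambda>n. ennreal \<bar>(\<Sum>k=1..n. f (\<xi> k \<omega>)) / real n - (\<integral>z. f z \<partial>\<mu>)\<bar>) \<longlonglongrightarrow> 0"
      using AE_weak_conv_zeros
    proof eventually_elim
      case (elim \<omega>)
      have "bounded (range f)" using f(2) by (auto simp: bounded_iff)
      then have lim: "(\<lambda>n. \<integral>z. f z \<partial>zero_measure (rand_poly (\<lambda>k. \<xi> k \<omega>) n)) \<longlonglongrightarrow> (\<integral>z. f z \<partial>\<mu>)"
        using elim f(1) unfolding weak_conv_c_def by blast
      have "eventually (\<lambda>n. (\<integral>z. f z \<partial>zero_measure (rand_poly (\<lambda>k. \<xi> k \<omega>) n)) = (\<Sum>k=1..n. f (\<xi> k \<omega>)) / real n) sequentially"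
        using eventually_ge_at_top[of 1] by eventually_elim (rule integral_zero_measure_rand_poly)
      from Lim_transform_eventually[OF lim this]
      have "(\<lambda>n. \<bar>(\<Sum>k=1..n. f (\<xi> k \<omega>)) / real n - (\<integral>z. f z \<partial>\<mu>)\<bar>) \<longlonglongrightarrow> 0"
        by (intro tendsto_rabs_zero) (simp add: LIM_zero_iff)
      then show ?case by (simp add: ennreal_tendsto_0_iff)
    qed
  qed (auto simp: emeasure_space_1)
  then show ?thesis by simp
qed

abbreviation deviation :: "(complex \<Rightarrow> real) \<Rightarrow> nat \<Rightarrow> 'w \<Rightarrow> real" where
  "deviation f n \<omega> \<equiv> \<bar>(\<integral>z. f z \<partial>zero_measure (pderiv (rand_poly (\<lambda>k. \<xi> k \<omega>) n))) - (\<integral>z. f z \<partial>\<mu>)\<bar>"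

lemma deviation_measurable:
  assumes "(\<lambda>\<omega>. \<integral>z. f z \<partial>zero_measure (pderiv (rand_poly (\<lambda>k. \<xi> k \<omega>) n))) \<in> borel_measurable M"
  shows "deviation f n \<in> borel_measurable M"
  by (intro borel_measurable_abs borel_measurable_diff borel_measurable_const assms)

text \<open>The triangle inequality through the average of \<open>f\<close> over the
  \<open>\<xi> k\<close>: \<open>zeros_pderiv_close\<close> bounds one side and
  \<open>nn_expectation_zeros_tendsto_0\<close> the other.\<close>

lemma nn_expectation_deviation_compact_support:
  fixes f :: "complex \<Rightarrow> real"
  assumes f: "continuous_on UNIV f" "\<And>z. cmod z > R \<Longrightarrow> f z = 0"
  shows "(\<lambda>n. \<integral>\<^sup>+\<omega>. ennreal (deviation f n \<omega>) \<partial>M) \<longlonglongrightarrow> 0"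
proof (rule ennreal_tendsto_0I)
  fix r :: real assume r: "r > 0"
  obtain F where F: "F \<ge> 0" "\<And>z. \<bar>f z\<bar> \<le> F" using bounded_compact_support[OF f] by blast
  \<comment> \<open>The tolerance enters \<open>zeros_pderiv_close\<close> twice, so its
    contribution r/6 leaves room below r/3.\<close>
  have "\<exists>\<phi> A B. log_potential_test \<phi> A B \<and> (\<forall>w. \<bar>f w - log_potential_test.pot \<phi> w\<bar> \<le> r / 12)"
    by (rule log_potential_test_exists[OF f]) (use r in simp_all)
  then obtain \<phi> A B where test: "log_potential_test \<phi> A B" "\<And>w. \<bar>f w - log_potential_test.pot \<phi> w\<bar> \<le> r / 12"
    by blast
  interpret log_potential_test \<phi> A B by (rule test)
  let ?J = "\<lambda>n \<omega>. \<integral>\<^sup>+z. ennreal (\<bar>ln (cmod (\<Sum>k=1..n. 1 / (z - \<xi> k \<omega>)))\<bar> / real n) * indicator (cball 0 A) z \<partial>lborel"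
  let ?G = "\<lambda>n \<omega>. \<bar>(\<Sum>k=1..n. f (\<xi> k \<omega>)) / real n - (\<integral>z. f z \<partial>\<mu>)\<bar>"
  let ?c = "\<lambda>n. 2 * (r / 12) + F / real n + B * (ln (real n) / real n * (pi * A\<^sup>2))"
  have Jm [measurable]: "?J n \<in> borel_measurable M" for n
  proof -
    note [measurable] = log_deriv_measurable[of n]
    show ?thesis by (rule lborel.borel_measurable_nn_integral) (unfold case_prod_beta, measurable)
  qed
  have fm: "f \<in> borel_measurable borel" using f(1) by (rule borel_measurable_continuous_onI)
  have [measurable]: "(\<lambda>\<omega>. \<Sum>k=1..n. f (\<xi> k \<omega>)) \<in> borel_measurable M" for n
    by (intro borel_measurable_sum measurable_compose[OF meas fm]) simp
  have le: "(\<integral>\<^sup>+\<omega>. ennreal (deviation f n \<omega>) \<partial>M) \<le>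
      ennreal (?c n) + ennreal B * (\<integral>\<^sup>+\<omega>. ?J n \<omega> \<partial>M) + (\<integral>\<^sup>+\<omega>. ennreal (?G n \<omega>) \<partial>M)" if n: "n \<ge> 2" for n
  proof -
    have "(\<integral>\<^sup>+\<omega>. ennreal (deviation f n \<omega>) \<partial>M) \<le> (\<integral>\<^sup>+\<omega>. (ennreal (?c n) + ennreal B * ?J n \<omega>) + ennreal (?G n \<omega>) \<partial>M)"
    proof (rule nn_integral_mono)
      fix \<omega>
      let ?D = "\<bar>(\<integral>z. f z \<partial>zero_measure (pderiv (rand_poly (\<lambda>k. \<xi> k \<omega>) n))) - (\<Sum>k=1..n. f (\<xi> k \<omega>)) / real n\<bar>"
      have "deviation f n \<omega> \<le> ?D + ?G n \<omega>" by linarith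
      then have "ennreal (deviation f n \<omega>) \<le> ennreal (?D + ?G n \<omega>)" by (rule ennreal_leI)
      also have "\<dots> = ennreal ?D + ennreal (?G n \<omega>)" by (rule ennreal_plus) auto
      also have "\<dots> \<le> (ennreal (?c n) + ennreal B * ?J n \<omega>) + ennreal (?G n \<omega>)"
        by (intro add_right_mono zeros_pderiv_close n test F)
      finally show "ennreal (deviation f n \<omega>) \<le> (ennreal (?c n) + ennreal B * ?J n \<omega>) + ennreal (?G n \<omega>)" .
    qed
    also have "\<dots> = ennreal (?c n) + ennreal B * (\<integral>\<^sup>+\<omega>. ?J n \<omega> \<partial>M) + (\<integral>\<^sup>+\<omega>. ennreal (?G n \<omega>) \<partial>M)"
    proof -
      have *: "(\<integral>\<^sup>+\<omega>. (C + k * J \<omega>) + G \<omega> \<partial>M) = C + k * (\<integral>\<^sup>+\<omega>. J \<omega> \<partial>M) + (\<integral>\<^sup>+\<omega>. G \<omega> \<partial>M)"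
        if [measurable]: "J \<in> borel_measurable M" "G \<in> borel_measurable M" for C k J G
        by (simp add: nn_integral_add nn_integral_cmult emeasure_space_1)
      show ?thesis by (rule *[OF Jm]) measurable
    qed
    finally show ?thesis .
  qed
  have "?c \<longlonglongrightarrow> 2 * (r / 12) + 0 + B * (0 * (pi * A\<^sup>2))"
  proof (intro tendsto_add tendsto_mult tendsto_const)
    show "(\<lambda>n. ln (real n) / real n) \<longlonglongrightarrow> 0" by real_asymp
    show "(\<lambda>n. F / real n) \<longlonglongrightarrow> 0" by (rule lim_const_over_n)
  qed
  then have ev1: "eventually (\<lambda>n. ?c n < r / 3) sequentially"
    by (rule order_tendstoD(2)) (use r in simp)
  have ev2: "eventually (\<lambda>n. (\<integral>\<^sup>+\<omega>. ?J n \<omega> \<partial>M) \<le> ennreal (r / (3 * (B + 1)))) sequentially"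
    by (rule ennreal_tendsto_0D[OF nn_expectation_abs_ln_log_deriv_tendsto_0[OF log_bounded infinite_diff A_nonneg]])
       (use r B_nonneg in simp)
  have ev3: "eventually (\<lambda>n. (\<integral>\<^sup>+\<omega>. ennreal (?G n \<omega>) \<partial>M) \<le> ennreal (r / 3)) sequentially"
    by (rule ennreal_tendsto_0D[OF nn_expectation_zeros_tendsto_0[OF f(1) F(2)]]) (use r in simp)
  show "eventually (\<lambda>n. (\<integral>\<^sup>+\<omega>. ennreal (deviation f n \<omega>) \<partial>M) \<le> ennreal r) sequentially"
    using ev1 ev2 ev3 eventually_ge_at_top[of 2]
  proof eventually_elim
    case (elim n)
    have "(\<integral>\<^sup>+\<omega>. ennreal (deviation f n \<omega>) \<partial>M) \<le>
      ennreal (?c n) + ennreal B * (\<integral>\<^sup>+\<omega>. ?J n \<omega> \<partial>M) + (\<integral>\<^sup>+\<omega>. ennreal (?G n \<omega>) \<partial>M)" by (rule le) fact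
    also have "\<dots> \<le> ennreal (r / 3) + ennreal B * ennreal (r / (3 * (B + 1))) + ennreal (r / 3)"
      using elim by (intro add_mono mult_left_mono ennreal_leI) auto
    also have "ennreal B * ennreal (r / (3 * (B + 1))) = ennreal (B * (r / (3 * (B + 1))))"
      using r B_nonneg by (intro ennreal_mult[symmetric]) auto
    also have "\<dots> \<le> ennreal (r / 3)"
      using r B_nonneg by (intro ennreal_leI mult_divide_add_1_le) auto
    also have "ennreal (r / 3) + ennreal (r / 3) + ennreal (r / 3) = ennreal r"
      using r by (simp flip: ennreal_plus)
    finally show ?case by (simp add: add_mono)
  qed
qed

text \<open>\<open>cutoff_error_le\<close> reduces to the compactly supported functions
  \<open>f * cutoff m\<close> and \<open>cutoff m\<close>, with \<open>m\<close> fixed beforehand so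
  that the tail of \<open>\<mu>\<close> costs less than r/3.\<close>

lemma nn_expectation_deviation_tendsto_0:
  fixes f :: "complex \<Rightarrow> real"
  assumes f: "continuous_on UNIV f" "\<And>z. \<bar>f z\<bar> \<le> F"
  shows "(\<lambda>n. \<integral>\<^sup>+\<omega>. ennreal (deviation f n \<omega>) \<partial>M) \<longlonglongrightarrow> 0"
proof (rule ennreal_tendsto_0I)
  fix r :: real assume r: "r > 0"
  have F: "F \<ge> 0" using f(2)[of 0] by linarith
  have "(\<lambda>m. 2 * F * (1 - (\<integral>z. cutoff m z \<partial>\<mu>))) \<longlonglongrightarrow> 2 * F * (1 - 1)"
    by (intro tendsto_intros mu.integral_cutoff_tendsto_1)
  then have "eventually (\<lambda>m. 2 * F * (1 - (\<integral>z. cutoff m z \<partial>\<mu>)) < r / 3) sequentially"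
    by (rule order_tendstoD(2)) (use r in simp)
  then obtain m where m: "2 * F * (1 - (\<integral>z. cutoff m z \<partial>\<mu>)) < r / 3"
    using eventually_happens'[OF sequentially_bot] by blast
  let ?fm = "\<lambda>z. f z * cutoff m z"
  have fm_cont: "continuous_on UNIV ?fm" by (intro continuous_intros f)
  have fm_supp: "?fm z = 0" if "cmod z > real m + 1" for z using cutoff_support[OF that] by simp
  have meas2: "deviation ?fm n \<in> borel_measurable M" "deviation (cutoff m) n \<in> borel_measurable M" if "n \<ge> 2" for n
  proof -
    show "deviation ?fm n \<in> borel_measurable M"
      by (rule deviation_measurable, rule zeros_pderiv_measurable_compact_support[OF fm_cont _ that], rule fm_supp)
    show "deviation (cutoff m) n \<in> borel_measurable M"
      by (rule deviation_measurable, rule zeros_pderiv_measurable_compact_support[OF cutoff_continuous _ that], rule cutoff_support)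
  qed
  have le: "(\<integral>\<^sup>+\<omega>. ennreal (deviation f n \<omega>) \<partial>M) \<le>
      (\<integral>\<^sup>+\<omega>. ennreal (deviation ?fm n \<omega>) \<partial>M) + ennreal F * (\<integral>\<^sup>+\<omega>. ennreal (deviation (cutoff m) n \<omega>) \<partial>M) + ennreal (r / 3)"
    if n: "n \<ge> 2" for n
  proof -
    have "(\<integral>\<^sup>+\<omega>. ennreal (deviation f n \<omega>) \<partial>M) \<le>
      (\<integral>\<^sup>+\<omega>. ennreal (deviation ?fm n \<omega>) + ennreal F * ennreal (deviation (cutoff m) n \<omega>) + ennreal (r / 3) \<partial>M)"
    proof (rule nn_integral_mono)
      fix \<omega>
      have "deviation f n \<omega> \<le> deviation ?fm n \<omega> + F * deviation (cutoff m) n \<omega> + r / 3"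
        using mu.cutoff_error_le[OF f, of "pmf_of_multiset (proots (pderiv (rand_poly (\<lambda>k. \<xi> k \<omega>) n)))" m] m
        unfolding zero_measure_def by linarith
      then have "ennreal (deviation f n \<omega>) \<le> ennreal (deviation ?fm n \<omega> + F * deviation (cutoff m) n \<omega> + r / 3)"
        by (rule ennreal_leI)
      also have "\<dots> = ennreal (deviation ?fm n \<omega>) + ennreal F * ennreal (deviation (cutoff m) n \<omega>) + ennreal (r / 3)"
        using F r by (simp add: ennreal_mult)
      finally show "ennreal (deviation f n \<omega>) \<le>
        ennreal (deviation ?fm n \<omega>) + ennreal F * ennreal (deviation (cutoff m) n \<omega>) + ennreal (r / 3)" .
    qed
    also have "\<dots> = (\<integral>\<^sup>+\<omega>. ennreal (deviation ?fm n \<omega>) \<partial>M) + ennreal F * (\<integral>\<^sup>+\<omega>. ennreal (deviation (cutoff m) n \<omega>) \<partial>M) + ennreal (r / 3)"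
    proof -
      have *: "(\<integral>\<^sup>+\<omega>. ennreal (G \<omega>) + k * ennreal (H \<omega>) + C \<partial>M) = (\<integral>\<^sup>+\<omega>. ennreal (G \<omega>) \<partial>M) + k * (\<integral>\<^sup>+\<omega>. ennreal (H \<omega>) \<partial>M) + C"
        if [measurable]: "G \<in> borel_measurable M" "H \<in> borel_measurable M" for G H C k
        by (simp add: nn_integral_add nn_integral_cmult emeasure_space_1)
      show ?thesis by (rule *[OF meas2[OF n]])
    qed
    finally show ?thesis .
  qed
  have ev1: "eventually (\<lambda>n. (\<integral>\<^sup>+\<omega>. ennreal (deviation ?fm n \<omega>) \<partial>M) \<le> ennreal (r / 3)) sequentially"
    by (rule ennreal_tendsto_0D[OF nn_expectation_deviation_compact_support[where R="real m + 1", OF fm_cont fm_supp]]) (use r in auto)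
  have ev2: "eventually (\<lambda>n. (\<integral>\<^sup>+\<omega>. ennreal (deviation (cutoff m) n \<omega>) \<partial>M) \<le> ennreal (r / (3 * (F + 1)))) sequentially"
    by (rule ennreal_tendsto_0D[OF nn_expectation_deviation_compact_support[where R="real m + 1", OF cutoff_continuous cutoff_support]]) (use r F in auto)
  show "eventually (\<lambda>n. (\<integral>\<^sup>+\<omega>. ennreal (deviation f n \<omega>) \<partial>M) \<le> ennreal r) sequentially"
    using ev1 ev2 eventually_ge_at_top[of 2]
  proof eventually_elim
    case (elim n)
    have "(\<integral>\<^sup>+\<omega>. ennreal (deviation f n \<omega>) \<partial>M) \<le>
      (\<integral>\<^sup>+\<omega>. ennreal (deviation ?fm n \<omega>) \<partial>M) + ennreal F * (\<integral>\<^sup>+\<omega>. ennreal (deviation (cutoff m) n \<omega>) \<partial>M) + ennreal (r / 3)"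
      by (rule le) fact
    also have "\<dots> \<le> ennreal (r / 3) + ennreal F * ennreal (r / (3 * (F + 1))) + ennreal (r / 3)"
      using elim by (intro add_mono mult_left_mono) auto
    also have "ennreal F * ennreal (r / (3 * (F + 1))) = ennreal (F * (r / (3 * (F + 1))))"
      using r F by (intro ennreal_mult[symmetric]) auto
    also have "\<dots> \<le> ennreal (r / 3)"
      using r F by (intro ennreal_leI mult_divide_add_1_le) auto
    also have "ennreal (r / 3) + ennreal (r / 3) + ennreal (r / 3) = ennreal r"
      using r by (simp flip: ennreal_plus)
    finally show ?case by (simp add: add_mono)
  qed
qed

lemma prob_deviation_tendsto_0:
  fixes f :: "complex \<Rightarrow> real"
  assumes f: "continuous_on UNIV f" "\<And>z. \<bar>f z\<bar> \<le> F" and e: "e > 0"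
  shows "(\<lambda>n. prob {\<omega>\<in>space M. deviation f n \<omega> \<ge> e}) \<longlonglongrightarrow> 0"
proof -
  have "(\<lambda>n. ennreal (prob {\<omega>\<in>space M. deviation f n \<omega> \<ge> e})) \<longlonglongrightarrow> 0"
  proof (rule tendsto_sandwich[OF _ _ tendsto_const])
    show "(\<lambda>n. ennreal (1 / e) * (\<integral>\<^sup>+\<omega>. ennreal (deviation f n \<omega>) \<partial>M)) \<longlonglongrightarrow> 0"
      using ennreal_tendsto_cmult[OF _ nn_expectation_deviation_tendsto_0[OF f], of "ennreal (1 / e)"] by simp
    show "eventually (\<lambda>n. ennreal (prob {\<omega>\<in>space M. deviation f n \<omega> \<ge> e}) \<le>
       ennreal (1 / e) * (\<integral>\<^sup>+\<omega>. ennreal (deviation f n \<omega>) \<partial>M)) sequentially"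
      using eventually_ge_at_top[of 2]
    proof eventually_elim
      case (elim n)
      show ?case
        by (rule nn_integral_Markov_real[OF deviation_measurable[OF zeros_pderiv_measurable[OF f elim]] e])
    qed
  qed simp
  then show ?thesis by (simp add: ennreal_tendsto_0_iff)
qed

text \<open>A basic neighbourhood involves finitely many test functions, so leaving it is a finite
  union of deviation events. The estimate starts at \<open>n = 2\<close>, where measurability of the
  deviations is available.\<close>

lemma weak_conv_in_prob_zeros_pderiv:
  "weak_conv_in_prob M (\<lambda>n \<omega>. zero_measure (pderiv (rand_poly (\<lambda>k. \<xi> k \<omega>) n))) \<mu>"
  unfolding weak_conv_in_prob_def
proof (intro allI impI, elim conjE)
  fix T :: "(complex \<Rightarrow> real) set" and e :: real
  assume T: "finite T" "\<forall>f\<in>T. continuous_on UNIV f \<and> bounded (range f)" and e: "0 < e"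
  let ?N = "\<lambda>n. {\<omega>\<in>space M. zero_measure (pderiv (rand_poly (\<lambda>k. \<xi> k \<omega>) n)) \<in> weak_nbhd \<mu> T e}"
  have bd: "\<exists>F. \<forall>z. \<bar>f z\<bar> \<le> F" if "f \<in> T" for f
    using T(2) that by (fastforce simp: bounded_iff)
  have le: "1 - (\<Sum>f\<in>T. prob {\<omega>\<in>space M. deviation f n \<omega> \<ge> e}) \<le> prob (?N n)" if n: "n \<ge> 2" for n
  proof -
    have m: "{\<omega>\<in>space M. deviation f n \<omega> \<ge> e} \<in> events" if fT: "f \<in> T" for f
    proof -
      obtain F where F: "\<And>z. \<bar>f z\<bar> \<le> F" using bd[OF fT] by blast
      have "deviation f n \<in> borel_measurable M"
        using T(2) fT F n by (intro deviation_measurable zeros_pderiv_measurable) auto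
      then show ?thesis by (intro borel_measurable_le borel_measurable_const)
    qed
    have U: "(\<Union>f\<in>T. {\<omega>\<in>space M. deviation f n \<omega> \<ge> e}) \<in> events"
      using m T(1) by (intro sets.finite_UN) auto
    have N: "?N n = space M - (\<Union>f\<in>T. {\<omega>\<in>space M. deviation f n \<omega> \<ge> e})"
      by (auto simp: weak_nbhd_def not_le)
    have "prob (\<Union>f\<in>T. {\<omega>\<in>space M. deviation f n \<omega> \<ge> e}) \<le> (\<Sum>f\<in>T. prob {\<omega>\<in>space M. deviation f n \<omega> \<ge> e})"
      using m T(1) by (intro finite_measure_subadditive_finite) auto
    then show ?thesis unfolding N prob_compl[OF U] by simp
  qed
  have "(\<lambda>n. \<Sum>f\<in>T. prob {\<omega>\<in>space M. deviation f n \<omega> \<ge> e}) \<longlonglongrightarrow> (\<Sum>f\<in>T. 0)"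
  proof (rule tendsto_sum)
    fix f assume "f \<in> T"
    then obtain F where "\<And>z. \<bar>f z\<bar> \<le> F" using bd by blast
    then show "(\<lambda>n. prob {\<omega>\<in>space M. deviation f n \<omega> \<ge> e}) \<longlonglongrightarrow> 0"
      using T(2) \<open>f \<in> T\<close> e by (intro prob_deviation_tendsto_0) auto
  qed
  then have lim: "(\<lambda>n. 1 - (\<Sum>f\<in>T. prob {\<omega>\<in>space M. deviation f n \<omega> \<ge> e})) \<longlonglongrightarrow> 1 - (\<Sum>f\<in>T. 0)"
    by (intro tendsto_diff tendsto_const)
  show "(\<lambda>n. prob (?N n)) \<longlonglongrightarrow> 1"
  proof (rule tendsto_sandwich[OF _ _ _ tendsto_const])
    show "(\<lambda>n. 1 - (\<Sum>f\<in>T. prob {\<omega>\<in>space M. deviation f n \<omega> \<ge> e})) \<longlonglongrightarrow> 1" using lim by simp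
    show "eventually (\<lambda>n. 1 - (\<Sum>f\<in>T. prob {\<omega>\<in>space M. deviation f n \<omega> \<ge> e}) \<le> prob (?N n)) sequentially"
      using eventually_ge_at_top[of 2] by eventually_elim (rule le)
    show "eventually (\<lambda>n. prob (?N n) \<le> 1) sequentially" by simp
  qed
qed

end

theorem mainTheorem2:
  fixes \<mu> :: "complex measure" and a b :: "nat \<Rightarrow> complex"
    and M :: "'w measure" and \<xi> :: "nat \<Rightarrow> 'w \<Rightarrow> complex"
  assumes mu: "prob_space \<mu>" "sets \<mu> = sets borel"
    and a: "mu_distributed \<mu> a" "log_cesaro_bounded a"
    and b: "mu_distributed \<mu> b" "log_cesaro_bounded b"
    and infdiff: "infinite {k. k \<ge> 1 \<and> a k \<noteq> b k}"
    and M: "prob_space M"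
    and meas: "\<And>k. k \<ge> 1 \<Longrightarrow> \<xi> k \<in> borel_measurable M"
    and indep: "prob_space.indep_vars M (\<lambda>_. borel) \<xi> {1..}"
    and distr_neq: "\<And>k. k \<ge> 1 \<Longrightarrow> a k \<noteq> b k \<Longrightarrow>
        measure M {\<omega>\<in>space M. \<xi> k \<omega> = a k} = 1/2 \<and>
        measure M {\<omega>\<in>space M. \<xi> k \<omega> = b k} = 1/2"
    and distr_eq: "\<And>k. k \<ge> 1 \<Longrightarrow> a k = b k \<Longrightarrow>
        measure M {\<omega>\<in>space M. \<xi> k \<omega> = a k} = 1"
  shows "(AE \<omega> in M. weak_conv_c (\<lambda>n. zero_measure (rand_poly (\<lambda>k. \<xi> k \<omega>) n)) \<mu>)
    \<and> weak_conv_in_prob M (\<lambda>n \<omega>. zero_measure (pderiv (rand_poly (\<lambda>k. \<xi> k \<omega>) n))) \<mu>"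
proof -
  interpret M: prob_space M by (rule M)
  interpret mu: prob_space \<mu> by (rule mu)
  interpret random_zeros M a b \<xi> \<mu>
    by unfold_locales (fact meas indep distr_neq distr_eq mu(2) a b infdiff)+
  show ?thesis using AE_weak_conv_zeros weak_conv_in_prob_zeros_pderiv by blast
qed

end
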